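(* Let $S=U/\Gamma$ be an Inoue surface (of type I, II or III). The holomorphic tangent bundle $T_S$ admits a unique holomorphic connection. The pull-back of this connection to $U$ (via the covering projection $U\to S$) coincides with the trivial connection on $T_U=U\times\mathbb{C}^2$; in particular this connection is flat and torsion free.
   Context: Notation: $\mathbb{N}^*=\{1,2,\dots\}$; $H=\{w\in\mathbb{C}\mid \mathrm{Im}(w)>0\}$; $U=H\times\mathbb{C}\subset\mathbb{C}^2$ with coordinates $(w,z)$; $\mathrm{Aff}(U)$ is the group of complex affine transformations $f$ of $\mathbb{C}^2$ with $f(U)=U$, acting on $U$. For $x,y\in\mathbb{C}^2$, $x\wedge y=x_1y_2-x_2y_1$. An Inoue surface is a quotient $S=U/\Gamma$, where $\Gamma\subset\mathrm{Aff}(U)$ is one of the following groups (each acts properly discontinuously on $U$, and $U\to S$ is the universal covering of the compact complex surface $S$). Type I. A number $\beta\in\mathbb{C}\setminus\mathbb{R}$ with $|\beta|<1$ is admissible if $|\beta|^{-2},\beta,\bar\beta$ are the roots of a polynomial $X^3-\theta_2X^2+\theta_1X-1$ with $\theta_1,\theta_2\in\mathbb{Z}$. A pair $(a,b)\in\mathbb{R}^3\times\mathbb{C}^3$ is $\beta$-compatible if $a,b,\bar b$ are linearly independent over $\mathbb{C}$ and, $P$ being the matrix with columns $a,b,\bar b$, $P\,\mathrm{diag}(|\beta|^{-2},\beta,\bar\beta)\,P^{-1}\in M_3(\mathbb{Z})$. Then $\Gamma=G(\beta,a,b)$ is generated by $g_0:(w,z)\mapsto(|\beta|^{-2}w,\beta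 z)$ and $g_i:(w,z)\mapsto(w+a_i,z+b_i)$, $1\le i\le3$. Type II. $\alpha=\frac{\theta+\sqrt{\theta^2-4}}{2}$ with $\theta\in\mathbb{Z}$, $\theta\ge3$; $(a,b)\in\mathbb{R}^2\times\mathbb{R}^2$ is a linearly independent pair such that, $P$ being the matrix with columns $a,b$, $N=(n_{ij}):=P\,\mathrm{diag}(\alpha,\alpha^{-1})P^{-1}\in M_2(\mathbb{Z})$; $r\in\mathbb{N}^*$; $c\in\mathbb{R}^2$ satisfies $$(I_2-N)\Big(c-\tfrac12\begin{pmatrix}a_1b_1\\ a_2b_2\end{pmatrix}\Big)-\tfrac{b\wedge a}{2}\begin{pmatrix}n_{11}n_{12}\\ n_{21}n_{22}\end{pmatrix}\in\tfrac{b\wedge a}{r}\mathbb{Z}^2;$$ $t\in\mathbb{C}$. Then $\Gamma=G(\alpha,a,b,c,r,t)$ is generated by $g_0:(w,z)\mapsto(\alpha w,z+t)$, $g_i:(w,z)\mapsto(w+a_i,z+b_iw+c_i)$ ($i=1,2$), $g_3:(w,z)\mapsto(w,z+\frac{b\wedge a}{r})$. Type III. $\alpha=\frac{\theta+\sqrt{\theta^2+4}}{2}$ with $\theta\in\mathbb{N}^*$; $(a,b)\in\mathbb{R}^2\times\mathbb{R}^2$ is a linearly independent pair such that, with $P$ as for type II, $N=(n_{ij}):=P\,\mathrm{diag}(\alpha,-\alpha^{-1})P^{-1}\in M_2(\mathbb{Z})$; $r\in\mathbb{N}^*$; $c\in\mathbb{R}^2$ satisfies $$(I_2+N)\Big(c-\tfrac12\begin{pmatrix}a_1b_1\\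 a_2b_2\end{pmatrix}\Big)-\tfrac{a\wedge b}{2}\begin{pmatrix}n_{11}n_{12}\\ n_{21}n_{22}\end{pmatrix}\in\tfrac{a\wedge b}{r}\mathbb{Z}^2.$$ Then $\Gamma=G(\alpha,a,b,c,r)$ is generated by $g_0:(w,z)\mapsto(\alpha w,-z)$ and $g_1,g_2,g_3$ given by the same formulae as for type II. *)

theory Defs
  imports "HOL-Analysis.Analysis" "HOL-Algebra.Generated_Groups"
begin

section \<open>Holomorphic maps between complex coordinate spaces\<close>

text \<open>Used on open sets only: complex differentiability at every point, i.e. the real Frechet
  derivative exists and is complex linear.\<close>

definition holomorphic_map :: "(complex^'n \<Rightarrow> complex^'m) \<Rightarrow> (complex^'n) set \<Rightarrow> bool" where
  "holomorphic_map F V \<longleftrightarrow>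
     (\<forall>x\<in>V. \<exists>F'. (F has_derivative F') (at x) \<and> (\<forall>k v. F' (k *s v) = k *s F' v))"

definition holomorphic_fun :: "(complex^'n \<Rightarrow> complex) \<Rightarrow> (complex^'n) set \<Rightarrow> bool" where
  "holomorphic_fun f V \<longleftrightarrow>
     (\<forall>x\<in>V. \<exists>f'. (f has_derivative f') (at x) \<and> (\<forall>k v. f' (k *s v) = k * f' v))"


section \<open>Complex manifolds, the tangent bundle and holomorphic connections\<close>

text \<open>A chart is a pair of its domain \<open>W\<close> and a map \<open>\<phi>\<close>, of which only the
  values on \<open>W\<close> matter. A complex manifold of dimension \<open>CARD('n)\<close> is given by its topology
  (the topspace being the set of points) and a holomorphic atlas, not necessarily maximal.\<close>

type_synonym ('p, 'n) chart = "'p set \<times> ('p \<Rightarrow> complex^'n)"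

record ('p, 'n) cmfd =
  mtop :: "'p topology"
  atlas :: "('p, 'n) chart set"

definition chart_inv :: "('p, 'n) chart \<Rightarrow> complex^'n \<Rightarrow> 'p" where
  "chart_inv c = inv_into (fst c) (snd c)"

definition holomorphic_function_on :: "('p, 'n::finite) cmfd \<Rightarrow> 'p set \<Rightarrow> ('p \<Rightarrow> complex) \<Rightarrow> bool" where
  "holomorphic_function_on M V f \<longleftrightarrow>
     (\<forall>c\<in>atlas M. holomorphic_fun (f \<circ> chart_inv c) (snd c ` (fst c \<inter> V)))"

text \<open>A tangent vector (of type (1,0)) at \<open>p\<close> is given by its coordinate vectors in all charts
  around \<open>p\<close>, related by the derivatives of the coordinate changes. Accordingly a vector field
  maps a chart \<open>c\<close> and a point \<open>p\<close> to the coordinate vector at \<open>p\<close> with respect to \<open>c\<close>.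
  Outside the chart domain, and outside the open set \<open>V\<close> on which the field lives, the value
  is normalised to 0, so that equality of fields is equality of functions.\<close>

type_synonym ('p, 'n) vfield = "('p, 'n) chart \<Rightarrow> 'p \<Rightarrow> complex^'n"

definition vector_fields :: "('p, 'n::finite) cmfd \<Rightarrow> 'p set \<Rightarrow> ('p, 'n) vfield set" where
  "vector_fields M V = {X.
     (\<forall>c\<in>atlas M. holomorphic_map (X c \<circ> chart_inv c) (snd c ` (fst c \<inter> V))) \<and>
     (\<forall>c\<in>atlas M. \<forall>d\<in>atlas M. \<forall>p\<in>fst c \<inter> fst d \<inter> V.
        X d p = frechet_derivative (snd d \<circ> chart_inv c) (at (snd c p)) (X c p)) \<and>
     (\<forall>c p. \<not> (c \<in> atlas M \<and> p \<in> fst c \<inter> V) \<longrightarrow> X c p = 0)}"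

definition vf_add :: "('p, 'n::finite) vfield \<Rightarrow> ('p, 'n) vfield \<Rightarrow> ('p, 'n) vfield" where
  "vf_add X Y = (\<lambda>c p. X c p + Y c p)"

definition vf_diff :: "('p, 'n::finite) vfield \<Rightarrow> ('p, 'n) vfield \<Rightarrow> ('p, 'n) vfield" where
  "vf_diff X Y = (\<lambda>c p. X c p - Y c p)"

definition vf_scale :: "('p \<Rightarrow> complex) \<Rightarrow> ('p, 'n::finite) vfield \<Rightarrow> ('p, 'n) vfield" where
  "vf_scale f X = (\<lambda>c p. f p *s X c p)"

definition vf_restrict :: "'p set \<Rightarrow> ('p, 'n::finite) vfield \<Rightarrow> ('p, 'n) vfield" where
  "vf_restrict W X = (\<lambda>c p. if p \<in> W then X c p else 0)"

text \<open>The derivative \<open>X f\<close> of a function at a point \<open>p\<close>, computed in the chart \<open>c\<close>.\<close>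

definition fun_deriv :: "('p, 'n::finite) vfield \<Rightarrow> ('p \<Rightarrow> complex) \<Rightarrow> ('p, 'n) chart \<Rightarrow> 'p \<Rightarrow> complex" where
  "fun_deriv X f c p = frechet_derivative (f \<circ> chart_inv c) (at (snd c p)) (X c p)"

text \<open>The componentwise derivative of \<open>Y\<close> along \<open>X\<close> in the coordinates of the chart \<open>c\<close>.\<close>

definition coord_deriv ::
    "('p, 'n::finite) vfield \<Rightarrow> ('p, 'n) vfield \<Rightarrow> ('p, 'n) chart \<Rightarrow> 'p \<Rightarrow> complex^'n" where
  "coord_deriv X Y c p = frechet_derivative (Y c \<circ> chart_inv c) (at (snd c p)) (X c p)"

definition lie_bracket ::
    "('p, 'n::finite) cmfd \<Rightarrow> 'p set \<Rightarrow> ('p, 'n) vfield \<Rightarrow> ('p, 'n) vfield \<Rightarrow> ('p, 'n) vfield" where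
  "lie_bracket M V X Y = (\<lambda>c p.
     if c \<in> atlas M \<and> p \<in> fst c \<inter> V then coord_deriv X Y c p - coord_deriv Y X c p else 0)"

text \<open>A holomorphic connection on the holomorphic tangent bundle, i.e. a sheaf map from
  \<open>T\<close> to \<open>\<Omega>\<^sup>1 \<otimes> T = Hom(T, T)\<close> satisfying the Leibniz rule, written as a covariant
  derivative: \<open>D V X Y\<close> is the field \<open>\<nabla>\<^sub>X Y\<close> on the open set \<open>V\<close>. The extensional function
  spaces make equality of connections coincide with equality of functions. Complex linearity in
  \<open>Y\<close> follows from additivity and the Leibniz rule for constant functions.\<close>

type_synonym ('p, 'n) connection =
  "'p set \<Rightarrow> ('p, 'n) vfield \<Rightarrow> ('p, 'n) vfield \<Rightarrow> ('p, 'n) vfield"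

definition holomorphic_connection :: "('p, 'n::finite) cmfd \<Rightarrow> ('p, 'n) connection \<Rightarrow> bool" where
  "holomorphic_connection M D \<longleftrightarrow>
     D \<in> (\<Pi>\<^sub>E V\<in>{V. openin (mtop M) V}.
            vector_fields M V \<rightarrow>\<^sub>E vector_fields M V \<rightarrow>\<^sub>E vector_fields M V) \<and>
     (\<forall>V W. openin (mtop M) V \<and> openin (mtop M) W \<and> W \<subseteq> V \<longrightarrow>
        (\<forall>X\<in>vector_fields M V. \<forall>Y\<in>vector_fields M V.
           D W (vf_restrict W X) (vf_restrict W Y) = vf_restrict W (D V X Y))) \<and>
     (\<forall>V. openin (mtop M) V \<longrightarrow>
        (\<forall>X\<in>vector_fields M V. \<forall>X'\<in>vector_fields M V. \<forall>Y\<in>vector_fields M V.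
           D V (vf_add X X') Y = vf_add (D V X Y) (D V X' Y)) \<and>
        (\<forall>X\<in>vector_fields M V. \<forall>Y\<in>vector_fields M V. \<forall>Y'\<in>vector_fields M V.
           D V X (vf_add Y Y') = vf_add (D V X Y) (D V X Y')) \<and>
        (\<forall>f. holomorphic_function_on M V f \<longrightarrow>
           (\<forall>X\<in>vector_fields M V. \<forall>Y\<in>vector_fields M V.
              D V (vf_scale f X) Y = vf_scale f (D V X Y) \<and>
              (\<forall>c\<in>atlas M. \<forall>p\<in>fst c \<inter> V.
                 D V X (vf_scale f Y) c p = fun_deriv X f c p *s Y c p + f p *s D V X Y c p))))"

definition flat_connection :: "('p, 'n::finite) cmfd \<Rightarrow> ('p, 'n) connection \<Rightarrow> bool" where
  "flat_connection M D \<longleftrightarrow>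
     (\<forall>V. openin (mtop M) V \<longrightarrow>
        (\<forall>X\<in>vector_fields M V. \<forall>Y\<in>vector_fields M V. \<forall>Z\<in>vector_fields M V.
           vf_diff (vf_diff (D V X (D V Y Z)) (D V Y (D V X Z))) (D V (lie_bracket M V X Y) Z)
             = (\<lambda>c p. 0)))"

definition torsion_free_connection :: "('p, 'n::finite) cmfd \<Rightarrow> ('p, 'n) connection \<Rightarrow> bool" where
  "torsion_free_connection M D \<longleftrightarrow>
     (\<forall>V. openin (mtop M) V \<longrightarrow>
        (\<forall>X\<in>vector_fields M V. \<forall>Y\<in>vector_fields M V.
           vf_diff (vf_diff (D V X Y) (D V Y X)) (lie_bracket M V X Y) = (\<lambda>c p. 0)))"


section \<open>Pull-back along a local biholomorphism\<close>

text \<open>The derivative of \<open>h\<close> maps \<open>X'\<close> to \<open>X\<close>. If \<open>h\<close> is a local biholomorphism, every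
  field \<open>X\<close> on \<open>V\<close> is related to exactly one field on the preimage of \<open>V\<close>, its pull-back
  under the identification of the pulled back tangent bundle with \<open>T M\<close>.\<close>

definition vf_related :: "('p, 'n::finite) cmfd \<Rightarrow> ('q, 'n) cmfd \<Rightarrow> ('p \<Rightarrow> 'q) \<Rightarrow> 'q set \<Rightarrow>
    ('p, 'n) vfield \<Rightarrow> ('q, 'n) vfield \<Rightarrow> bool" where
  "vf_related M N h V X' X \<longleftrightarrow>
     (\<forall>c\<in>atlas M. \<forall>d\<in>atlas N. \<forall>p\<in>fst c \<inter> h -` (fst d \<inter> V).
        frechet_derivative (snd d \<circ> h \<circ> chart_inv c) (at (snd c p)) (X' c p) = X d (h p))"

text \<open>\<open>D'\<close> is the pull-back \<open>h\<^sup>* D\<close>: the connection for which the covariant derivative of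
  pull-backs is the pull-back of the covariant derivative.\<close>

definition pullback_connection :: "('p, 'n::finite) cmfd \<Rightarrow> ('q, 'n) cmfd \<Rightarrow> ('p \<Rightarrow> 'q) \<Rightarrow>
    ('q, 'n) connection \<Rightarrow> ('p, 'n) connection \<Rightarrow> bool" where
  "pullback_connection M N h D D' \<longleftrightarrow>
     holomorphic_connection M D' \<and>
     (\<forall>V. openin (mtop N) V \<longrightarrow>
        (let V' = topspace (mtop M) \<inter> h -` V in
         \<forall>X\<in>vector_fields N V. \<forall>Y\<in>vector_fields N V.
         \<forall>X'\<in>vector_fields M V'. \<forall>Y'\<in>vector_fields M V'.
           vf_related M N h V X' X \<and> vf_related M N h V Y' Y \<longrightarrow>
           vf_related M N h V (D' V' X' Y') (D V X Y)))"


section \<open>Open subsets of the coordinate space and their quotients\<close>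

definition open_cmfd :: "(complex^'n) set \<Rightarrow> (complex^'n, 'n::finite) cmfd" where
  "open_cmfd A = \<lparr>mtop = top_of_set A, atlas = {(A, \<lambda>x. x)}\<rparr>"

definition trivial_connection :: "(complex^'n) set \<Rightarrow> (complex^'n, 'n::finite) connection" where
  "trivial_connection A =
     (\<lambda>V\<in>{V. openin (mtop (open_cmfd A)) V}.
        \<lambda>X\<in>vector_fields (open_cmfd A) V. \<lambda>Y\<in>vector_fields (open_cmfd A) V.
          \<lambda>c p. if c \<in> atlas (open_cmfd A) \<and> p \<in> V then coord_deriv X Y c p else 0)"

text \<open>The covering projection \<open>A \<rightarrow> A/G\<close>; points of the quotient are orbits.\<close>

definition orbit_map :: "('a \<Rightarrow> 'a) set \<Rightarrow> 'a \<Rightarrow> 'a set" where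
  "orbit_map G x = (\<lambda>g. g x) ` G"

text \<open>The quotient topology, with the local inverses of the projection as charts.\<close>

definition quotient_cmfd ::
    "(complex^'n) set \<Rightarrow> (complex^'n \<Rightarrow> complex^'n) set \<Rightarrow> ((complex^'n) set, 'n::finite) cmfd" where
  "quotient_cmfd A G =
     \<lparr>mtop = topology (\<lambda>V. V \<subseteq> orbit_map G ` A \<and> openin (top_of_set A) (A \<inter> orbit_map G -` V)),
      atlas = {(orbit_map G ` W, inv_into W (orbit_map G)) | W.
                 openin (top_of_set A) W \<and> inj_on (orbit_map G) W}\<rparr>"


section \<open>Inoue surfaces\<close>

definition inoue_U :: "(complex^2) set" where
  "inoue_U = {x. Im (x $ 1) > 0}"

definition inoue_Aff :: "(complex^2 \<Rightarrow> complex^2) monoid" where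
  "inoue_Aff =
     \<lparr>carrier = {f. (\<exists>A v. invertible A \<and> f = (\<lambda>x. A *v x + v)) \<and> f ` inoue_U = inoue_U},
      mult = (\<circ>), one = id\<rparr>"

definition wedge :: "'a::comm_ring_1^2 \<Rightarrow> 'a^2 \<Rightarrow> 'a" where
  "wedge x y = x$1 * y$2 - x$2 * y$1"

definition diag :: "'a::zero^'n \<Rightarrow> 'a^'n^'n" where
  "diag v = (\<chi> i j. if i = j then v $ i else 0)"

definition integer_matrix :: "'a::ring_1^'n^'m \<Rightarrow> bool" where
  "integer_matrix A \<longleftrightarrow> (\<forall>i j. A $ i $ j \<in> \<int>)"

subsection \<open>Type I\<close>

definition admissible :: "complex \<Rightarrow> bool" where
  "admissible \<beta> \<longleftrightarrow> \<beta> \<notin> \<real> \<and> cmod \<beta> < 1 \<and>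
     (\<exists>\<theta>1 \<theta>2 :: int. {x::complex. x^3 - of_int \<theta>2 * x^2 + of_int \<theta>1 * x - 1 = 0}
        = {of_real (1 / (cmod \<beta>)\<^sup>2), \<beta>, cnj \<beta>})"

definition cnj_vec :: "complex^'n \<Rightarrow> complex^'n" where
  "cnj_vec b = (\<chi> i. cnj (b $ i))"

definition of_real_vec :: "real^'n \<Rightarrow> complex^'n" where
  "of_real_vec a = (\<chi> i. of_real (a $ i))"

definition matrix_I :: "real^3 \<Rightarrow> complex^3 \<Rightarrow> complex^3^3" where
  "matrix_I a b = transpose (vector [of_real_vec a, b, cnj_vec b])"

definition compatible :: "complex \<Rightarrow> real^3 \<Rightarrow> complex^3 \<Rightarrow> bool" where
  "compatible \<beta> a b \<longleftrightarrow>
     (\<forall>x y z. x *s of_real_vec a + y *s b + z *s cnj_vec b = 0 \<longrightarrow> x = 0 \<and> y = 0 \<and> z = 0) \<and>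
     integer_matrix (matrix_I a b ** diag (vector [of_real (1 / (cmod \<beta>)\<^sup>2), \<beta>, cnj \<beta>])
                       ** matrix_inv (matrix_I a b))"

definition group_I :: "complex \<Rightarrow> real^3 \<Rightarrow> complex^3 \<Rightarrow> (complex^2 \<Rightarrow> complex^2) set" where
  "group_I \<beta> a b = generate inoue_Aff
     ({\<lambda>x. vector [of_real (1 / (cmod \<beta>)\<^sup>2) * x$1, \<beta> * x$2]} \<union>
      {\<lambda>x. vector [x$1 + of_real (a$i), x$2 + b$i] | i. True})"

subsection \<open>Types II and III\<close>

definition lin_indep_pair :: "real^2 \<Rightarrow> real^2 \<Rightarrow> bool" where
  "lin_indep_pair a b \<longleftrightarrow> (\<forall>x y. x *s a + y *s b = 0 \<longrightarrow> x = 0 \<and> y = 0)"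

definition conj_diag :: "real^2 \<Rightarrow> real^2 \<Rightarrow> real \<Rightarrow> real \<Rightarrow> real^2^2" where
  "conj_diag a b l m =
     (let P = transpose (vector [a, b]) :: real^2^2 in P ** diag (vector [l, m]) ** matrix_inv P)"

text \<open>The generators \<open>g\<^sub>1, g\<^sub>2, g\<^sub>3\<close> common to types II and III.\<close>

definition nilpotent_generators ::
    "real^2 \<Rightarrow> real^2 \<Rightarrow> real^2 \<Rightarrow> nat \<Rightarrow> (complex^2 \<Rightarrow> complex^2) set" where
  "nilpotent_generators a b c r =
     {\<lambda>x. vector [x$1 + of_real (a$i), x$2 + of_real (b$i) * x$1 + of_real (c$i)] | i. True} \<union>
     {\<lambda>x. vector [x$1, x$2 + of_real (wedge b a / real r)]}"

definition group_II :: "real \<Rightarrow> real^2 \<Rightarrow> real^2 \<Rightarrow> real^2 \<Rightarrow> nat \<Rightarrow> complex \<Rightarrow>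
    (complex^2 \<Rightarrow> complex^2) set" where
  "group_II \<alpha> a b c r t = generate inoue_Aff
     ({\<lambda>x. vector [of_real \<alpha> * x$1, x$2 + t]} \<union> nilpotent_generators a b c r)"

definition group_III :: "real \<Rightarrow> real^2 \<Rightarrow> real^2 \<Rightarrow> real^2 \<Rightarrow> nat \<Rightarrow> (complex^2 \<Rightarrow> complex^2) set" where
  "group_III \<alpha> a b c r = generate inoue_Aff
     ({\<lambda>x. vector [of_real \<alpha> * x$1, - x$2]} \<union> nilpotent_generators a b c r)"

definition half_products :: "real^2 \<Rightarrow> real^2 \<Rightarrow> real^2" where
  "half_products a b = (1/2) *s vector [a$1 * b$1, a$2 * b$2]"

definition row_products :: "real^2^2 \<Rightarrow> real^2" where
  "row_products N = vector [N$1$1 * N$1$2, N$2$1 * N$2$2]"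

definition scaled_lattice :: "real \<Rightarrow> (real^2) set" where
  "scaled_lattice s = {s *s k | k. \<forall>i. k $ i \<in> \<int>}"

inductive inoue_group :: "(complex^2 \<Rightarrow> complex^2) set \<Rightarrow> bool" where
  type_I: "admissible \<beta> \<Longrightarrow> compatible \<beta> a b \<Longrightarrow> inoue_group (group_I \<beta> a b)"
| type_II:
    "\<theta> \<ge> (3::int) \<Longrightarrow> \<alpha> = (of_int \<theta> + sqrt ((of_int \<theta>)\<^sup>2 - 4)) / 2 \<Longrightarrow>
     lin_indep_pair a b \<Longrightarrow> N = conj_diag a b \<alpha> (1 / \<alpha>) \<Longrightarrow> integer_matrix N \<Longrightarrow> r \<ge> 1 \<Longrightarrow>
     (mat 1 - N) *v (c - half_products a b) - (wedge b a / 2) *s row_products N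
       \<in> scaled_lattice (wedge b a / real r) \<Longrightarrow>
     inoue_group (group_II \<alpha> a b c r t)"
| type_III:
    "\<theta> \<ge> (1::int) \<Longrightarrow> \<alpha> = (of_int \<theta> + sqrt ((of_int \<theta>)\<^sup>2 + 4)) / 2 \<Longrightarrow>
     lin_indep_pair a b \<Longrightarrow> N = conj_diag a b \<alpha> (- (1 / \<alpha>)) \<Longrightarrow> integer_matrix N \<Longrightarrow> r \<ge> 1 \<Longrightarrow>
     (mat 1 + N) *v (c - half_products a b) - (wedge a b / 2) *s row_products N
       \<in> scaled_lattice (wedge a b / real r) \<Longrightarrow>
     inoue_group (group_III \<alpha> a b c r)"

definition inoue_surface :: "(complex^2 \<Rightarrow> complex^2) set \<Rightarrow> ((complex^2) set, 2) cmfd" where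
  "inoue_surface \<Gamma> = quotient_cmfd inoue_U \<Gamma>"

end

theory Submission
  imports Defs "HOL-Complex_Analysis.Cauchy_Integral_Formula"
begin

text \<open>Deck transformations are affine, so the trivial connection of \<open>U\<close> descends to \<open>S\<close>, and the
  difference of two connections on \<open>S\<close> is a holomorphic tensor \<open>T\<close> on \<open>U\<close> that is invariant
  under \<open>\<Gamma>\<close>. It remains to see that \<open>T = 0\<close>. The unipotent part of \<open>\<Gamma>\<close> acts cocompactly on
  the hypersurfaces \<open>Im w = const\<close>; hence a function invariant under it is bounded on every line
  \<open>{w} \<times> \<complex>\<close> and independent of \<open>z\<close> by Liouville. If it is moreover multiplied by a constant
  under \<open>g\<^sub>0\<close>, its real periods can be scaled to arbitrarily small ones, so that it is constant.
  The coefficients of \<open>T\<close> are treated in the order given by the triangular action. In types II and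
  III three of them are at first only shown to be constants \<open>p, q, s\<close>; the next ones satisfy
  \<open>f \<circ> g\<^sub>i = f + b\<^sub>i m\<close> and \<open>f \<circ> g\<^sub>0 = f / \<alpha>\<close> with \<open>m = - (p + q), p - s, q - s\<close>, and
  rescaling forces \<open>m = 0\<close>.\<close>

section \<open>Second derivatives of holomorphic functions of several variables\<close>

text \<open>Holomorphy is given as complex differentiability only, while flatness compares iterated
  derivatives; symmetric second derivatives in several variables therefore have to be produced
  first. Coordinate changes of the quotient are restrictions of elements of \<open>\<Gamma>\<close>,
  with locally constant derivatives. This makes the coordinate derivative of a field a field again,
  and it also removes the inhomogeneous term from the transformation of Christoffel symbols, so the
  symbols of any connection are themselves the tensor \<open>T\<close>. In types II and III with
  \<open>\<epsilon> = 1\<close> the coefficients \<open>p, q, s\<close> are preserved by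
  \<open>g0\<close>, so scaling alone cannot kill them. They appear as increments of the next
  coefficients: an increment \<open>b_i m\<close> over \<open>a_i\<close> becomes
  \<open>b_i m \<alpha>^n\<close> over \<open>a_i / \<alpha>^n\<close>, against continuity unless
  \<open>m = 0\<close>. The quotient charts need an orbit map that is locally injective. For this
  \<open>\<Gamma>\<close> is placed inside an explicit group \<open>elts\<close>, powers of
  \<open>g0\<close> combined with a discrete set \<open>\<Lambda>\<close> of unipotent maps. The
  integrality conditions on the parameters are what makes \<open>\<Lambda>\<close> stable under
  conjugation by \<open>g0\<close> and its inverse.\<close>

lemma norm_vector_scalar_mult: "norm (k *s (u::complex^'n)) = cmod k * norm u"
  by (simp add: norm_vec_def norm_mult L2_set_right_distrib)

lemma bounded_linear_scale_left: "bounded_linear (\<lambda>h. h *s (u::complex^'n))"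
  by (rule bounded_linear_intro[where K = "norm u"])
    (auto simp: vec_eq_iff algebra_simps norm_vector_scalar_mult)

lemma scaleR_eq_vector_scalar_mult: "r *\<^sub>R (u::complex^'n) = complex_of_real r *s u"
  unfolding vec_eq_iff vector_scaleR_component vector_smult_component
  by (simp add: scaleR_conv_of_real)

lemma holomorphic_fun_has_derivative:
  assumes "holomorphic_fun f V" "x \<in> V"
  shows "(f has_derivative frechet_derivative f (at x)) (at x)"
    and "frechet_derivative f (at x) (k *s v) = k * frechet_derivative f (at x) v"
proof -
  obtain f' where f': "(f has_derivative f') (at x)" "\<And>k v. f' (k *s v) = k * f' v"
    using assms unfolding holomorphic_fun_def by blast
  then have "f' = frechet_derivative f (at x)"
    by (simp add: frechet_derivative_at)
  with f' show "(f has_derivative frechet_derivative f (at x)) (at x)"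
    "frechet_derivative f (at x) (k *s v) = k * frechet_derivative f (at x) v" by auto
qed

lemma holomorphic_fun_line_derivative:
  assumes "holomorphic_fun f V" "x + z *s u \<in> V"
  shows "((\<lambda>z. f (x + z *s u)) has_field_derivative frechet_derivative f (at (x + z *s u)) u)
    (at z)"
proof -
  have "((\<lambda>z. x + z *s u) has_derivative (\<lambda>h. h *s u)) (at z)"
    by (auto intro!: derivative_eq_intros bounded_linear_imp_has_derivative
      bounded_linear_scale_left)
  from diff_chain_at[OF this holomorphic_fun_has_derivative(1)[OF assms]]
  show ?thesis
    unfolding has_field_derivative_def o_def holomorphic_fun_has_derivative(2)[OF assms]
    by (subst mult.commute[abs_def])
qed

lemma holomorphic_fun_continuous_on: "holomorphic_fun f V \<Longrightarrow> continuous_on V f"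
  by (meson continuous_at_imp_continuous_on has_derivative_continuous
    holomorphic_fun_has_derivative(1))

text \<open>On the complex line through \<open>x\<close> in direction \<open>u\<close> this is a
  one-variable estimate: Cauchy's inequality bounds the second derivative of
  \<open>g z = f (x + z u)\<close> on the unit disc, and Taylor's formula of order one is applied
  between 0 and 1.\<close>

lemma holomorphic_fun_taylor_bound:
  fixes f :: "complex^'n \<Rightarrow> complex"
  assumes hol: "holomorphic_fun f V" and V: "cball x0 (2 * R) \<subseteq> V" and R: "R > 0"
    and M: "\<And>x. x \<in> cball x0 (2 * R) \<Longrightarrow> cmod (f x) \<le> M"
    and x: "x \<in> cball x0 R" and u: "norm u \<le> R / 2"
  shows "cmod (f (x + u) - f x - frechet_derivative f (at x) u) \<le> 8 * M / R\<^sup>2 * (norm u)\<^sup>2"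
proof (cases "u = 0")
  case True
  have "linear (frechet_derivative f (at x))"
    using holomorphic_fun_has_derivative(1)[OF hol, of x] x V R
    by (auto simp: subset_iff dest: has_derivative_bounded_linear bounded_linear.linear)
  then show ?thesis using True by (simp add: linear_0)
next
  case False
  \<comment> \<open>The disc of radius \<open>r\<close> is mapped by
    \<open>z \<mapsto> x + z u\<close> into the ball of radius \<open>R\<close> about
    \<open>x\<close>, hence into \<open>cball x0 (2 * R)\<close>. As \<open>r \<ge> 2\<close>, a
    disc of radius \<open>r / 2\<close> about any point of the unit disc still lies in it.\<close>
  define r where "r = R / norm u"
  have r: "r \<ge> 2" using False u by (simp add: r_def field_simps)
  define g where "g = (\<lambda>z. f (x + z *s u))"
  have mem: "x + z *s u \<in> cball x0 (2 * R)" if "cmod z \<le> r" for z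
  proof -
    have "norm (z *s u) \<le> r * norm u" using that
      by (simp add: norm_vector_scalar_mult mult_right_mono)
    also have "\<dots> = R" using False by (simp add: r_def)
    finally have 1: "norm (z *s u) \<le> R" .
    have "dist x0 (x + z *s u) \<le> dist x0 x + norm (z *s u)"
      using dist_triangle[of x0 "x + z *s u" x] by (simp add: dist_norm)
    with 1 x show ?thesis by simp
  qed
  have der: "(g has_field_derivative frechet_derivative f (at (x + z *s u)) u) (at z)"
    if "cmod z \<le> r" for z
    unfolding g_def using holomorphic_fun_line_derivative[OF hol] mem[OF that] V by blast
  have hg: "g holomorphic_on ball 0 r"
    by (meson der field_differentiable_at_within field_differentiable_def holomorphic_on_def
        mem_ball_0 order_less_imp_le)
  have cont: "continuous_on (cball 0 r) g"
    by (meson DERIV_isCont continuous_at_imp_continuous_on der mem_cball_0)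
  have B: "cmod ((deriv ^^ 2) g z) \<le> 2 * M / (r / 2)\<^sup>2" if z: "cmod z \<le> 1" for z
  proof -
    have sub: "cball z (r / 2) \<subseteq> cball 0 r" 
    proof
      fix y assume "y \<in> cball z (r / 2)"
      then have "cmod y \<le> 1 + r / 2" using z norm_triangle_sub[of y z]
        by (simp add: dist_norm norm_minus_commute)
      then show "y \<in> cball 0 r" using r by simp
    qed
    have sub': "ball z (r / 2) \<subseteq> ball 0 r"
      using interior_mono[OF sub] by simp
    have "cmod ((deriv ^^ 2) g z) \<le> fact 2 * M / (r / 2) ^ 2"
    proof (rule Cauchy_inequality)
      show "g holomorphic_on ball z (r / 2)" using hg sub' by (rule holomorphic_on_subset)
      show "continuous_on (cball z (r / 2)) g" using cont sub by (rule continuous_on_subset)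
      show "0 < r / 2" using r by simp
      show "cmod (g y) \<le> M" if "cmod (z - y) = r / 2" for y
        unfolding g_def using that sub by (intro M mem) (auto simp: dist_norm subset_iff)
    qed
    then show ?thesis by (simp add: fact_2)
  qed
  have op: "open (ball (0::complex) r)" by simp
  have "cmod ((deriv ^^ 0) g 1 - (\<Sum>i\<le>1. (deriv ^^ i) g 0 * (1 - 0) ^ i / fact i))
     \<le> 2 * M / (r / 2)\<^sup>2 * cmod (1 - 0) ^ Suc 1 / fact 1"
  proof (rule complex_Taylor[where S = "cball 0 1" and f = "\<lambda>i. (deriv ^^ i) g"])
    fix i :: nat and y assume "y \<in> cball (0::complex) 1"
    then have "y \<in> ball 0 r" using r by simp
    with holomorphic_higher_deriv[OF hg op, of i]
    show "((deriv ^^ i) g has_field_derivative (deriv ^^ Suc i) g y) (at y within cball 0 1)"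
      by (simp add: DERIV_deriv_iff_field_differentiable has_field_derivative_at_within
          holomorphic_on_imp_differentiable_at[OF _ op])
  next
    show "cmod ((deriv ^^ Suc 1) g y) \<le> 2 * M / (r / 2)\<^sup>2" if "y \<in> cball 0 1" for y
      using B[of y] that by (simp add: numeral_2_eq_2)
  qed auto
  moreover have "deriv g 0 = frechet_derivative f (at x) u"
    using der[of 0] r by (intro DERIV_imp_deriv) simp
  moreover have "2 * M / (r / 2)\<^sup>2 = 8 * M / R\<^sup>2 * (norm u)\<^sup>2"
    using False by (simp add: r_def power_divide)
  ultimately show ?thesis by (simp add: g_def algebra_simps)
qed
text \<open>The function \<open>z \<mapsto> Df(x + z v)(u)\<close> is a locally uniform limit of difference quotients and
  hence holomorphic; Cauchy's inequality for the error term of these quotients then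
  differentiates \<open>y \<mapsto> Df(y)(v)\<close> without an integral formula in several variables.\<close>

lemma holomorphic_fun_derivative_estimate:
  fixes f :: "complex^'n \<Rightarrow> complex"
  assumes hol: "holomorphic_fun f V" and V: "open V" and x: "x \<in> V"
  obtains r C d where "r > 0" "C \<ge> 0" "d > 0"
    "\<And>z. z \<in> ball 0 r \<Longrightarrow> x + z *s v \<in> V"
    "\<And>u. (\<lambda>z. frechet_derivative f (at (x + z *s v)) u) holomorphic_on ball 0 r"
    "\<And>u. norm u \<le> d \<Longrightarrow> cmod (frechet_derivative f (at (x + u)) v - frechet_derivative f (at x) v
        - deriv (\<lambda>z. frechet_derivative f (at (x + z *s v)) u) 0) \<le> C * (norm u)\<^sup>2"
proof -
  obtain e where e: "e > 0" "cball x e \<subseteq> V" using V x open_contains_cball by blast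
  define R where "R = e / 2"
  have R: "R > 0" and ball: "cball x (2 * R) \<subseteq> V" using e by (auto simp: R_def)
  have "compact (f ` cball x (2 * R))"
    by (rule compact_continuous_image[OF continuous_on_subset[OF holomorphic_fun_continuous_on[OF
      hol] ball] compact_cball])
  then obtain M where M: "\<And>y. y \<in> cball x (2 * R) \<Longrightarrow> cmod (f y) \<le> M"
    using compact_imp_bounded bounded_iff by (metis imageI)
  have M0: "M \<ge> 0" using order_trans[OF norm_ge_zero M[of x]] R by simp
  define K where "K = 8 * M / R\<^sup>2"
  have K: "K \<ge> 0" using M0 by (simp add: K_def)
  \<comment> \<open>Adding 1 keeps the quotient meaningful for \<open>v = 0\<close>; points
    \<open>z\<close> of the disc then satisfy \<open>norm (z *s v) \<le> R\<close>.\<close>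
  define r where "r = R / (norm v + 1)"
  have nv: "norm v + 1 > 0" by (smt (verit) norm_ge_zero)
  have r: "r > 0" using R nv by (simp add: r_def)
  have small: "norm (z *s v) \<le> R" if "z \<in> ball 0 r" for z
  proof -
    have "cmod z * norm v \<le> r * (norm v + 1)" using that nv r by (intro mult_mono) auto
    then show ?thesis using nv by (simp add: r_def norm_vector_scalar_mult)
  qed
  have mem: "x + z *s v \<in> cball x R" if "z \<in> ball 0 r" for z
    using small[OF that] by (simp add: dist_norm)
  have mem2: "x + w + z *s v \<in> V" if "z \<in> ball 0 r" "norm w \<le> R / 2" for z w
  proof -
    have "norm (w + z *s v) \<le> 2 * R"
      using small[OF that(1)] that(2) R norm_triangle_ineq[of w "z *s v"] by linarith
    then have "x + w + z *s v \<in> cball x (2 * R)"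
      by (metis add.assoc add_diff_cancel_left' dist_norm mem_cball norm_minus_commute)
    with ball show ?thesis by blast
  qed
  have quad: "cmod (f (y + u) - f y - frechet_derivative f (at y) u) \<le> K * (norm u)\<^sup>2"
    if "y \<in> cball x R" "norm u \<le> R / 2" for y u
    unfolding K_def using holomorphic_fun_taylor_bound[OF hol ball R M that] .
  define \<psi> where "\<psi> = (\<lambda>u z. frechet_derivative f (at (x + z *s v)) u)"
  have hline: "(\<lambda>z. f (x + w + z *s v)) holomorphic_on ball 0 r" if "norm w \<le> R / 2" for w
    using holomorphic_fun_line_derivative[OF hol, of "x + w" _ v] mem2[OF _ that]
    by (meson field_differentiable_at_within field_differentiable_def holomorphic_on_def)
  have hline0: "(\<lambda>z. f (x + z *s v)) holomorphic_on ball 0 r"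
    using hline[of 0] R by simp
  have h\<psi>: "\<psi> u holomorphic_on ball 0 r" for u
  proof -
    \<comment> \<open>The points \<open>x + h n u + z v\<close> have to stay where the quadratic
      bound is available, so the step sizes are capped by \<open>\<delta>\<close>, with
      \<open>\<delta> * norm u \<le> R / 2\<close>.\<close>
    define \<delta> where "\<delta> = R / 2 / (norm u + 1)"
    have nu: "norm u + 1 > 0" by (smt (verit) norm_ge_zero)
    have \<delta>: "\<delta> > 0" using R nu by (simp add: \<delta>_def)
    define h where "h = (\<lambda>n. \<delta> / real (Suc n))"
    have h0: "h n > 0" for n using \<delta> by (simp add: h_def)
    have "\<delta> * norm u \<le> \<delta> * (norm u + 1)" using \<delta> by (intro mult_left_mono) auto
    also have "\<dots> = R / 2" using nu unfolding \<delta>_def by (intro nonzero_eq_divide_eq[THEN iffD1]) auto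
    finally have \<delta>u: "\<delta> * norm u \<le> R / 2" .
    have hu: "norm (complex_of_real (h n) *s u) \<le> R / 2" for n
    proof -
      have "h n \<le> \<delta>" using \<delta> by (simp add: h_def field_simps)
      then have "h n * norm u \<le> \<delta> * norm u" by (simp add: mult_right_mono)
      then show ?thesis using \<delta>u h0[of n] by (simp add: norm_vector_scalar_mult)
    qed
    define \<phi> where "\<phi> = (\<lambda>n z. (f (x + complex_of_real (h n) *s u + z *s v) - f (x + z *s v)) /
      complex_of_real (h n))"
    have bd: "cmod (\<phi> n z - \<psi> u z) \<le> K * (norm u)\<^sup>2 * h n" if z: "z \<in> ball 0 r" for n z
    proof -
      have lin: "frechet_derivative f (at (x + z *s v)) (complex_of_real (h n) *s u)
        = complex_of_real (h n) * \<psi> u z"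
        unfolding \<psi>_def using mem2[OF z, of 0] R
          by (intro holomorphic_fun_has_derivative(2)[OF hol]) simp
      have nz: "complex_of_real (h n) \<noteq> 0" using h0[of n] by simp
      have "\<phi> n z - \<psi> u z = (f (x + z *s v + complex_of_real (h n) *s u) - f (x + z *s v)
          - frechet_derivative f (at (x + z *s v)) (complex_of_real (h n) *s u)) / complex_of_real
          (h n)"
        unfolding lin \<phi>_def using nz by (simp add: field_simps)
      then have "cmod (\<phi> n z - \<psi> u z) = cmod (f (x + z *s v + complex_of_real (h n) *s u)
        - f (x + z *s v)
          - frechet_derivative f (at (x + z *s v)) (complex_of_real (h n) *s u)) / h n"
        using h0[of n] by (simp add: norm_divide)
      also have "\<dots> \<le> K * (norm (complex_of_real (h n) *s u))\<^sup>2 / h n"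
        using quad[OF mem[OF z] hu] h0[of n] by (intro divide_right_mono) auto
      also have "\<dots> = K * (norm u)\<^sup>2 * h n"
        using h0[of n] by (simp add: norm_vector_scalar_mult power_mult_distrib power2_eq_square)
      finally show ?thesis .
    qed
    have lim: "(\<lambda>n. K * (norm u)\<^sup>2 * h n) \<longlonglongrightarrow> 0"
      unfolding h_def by (rule tendsto_mult_right_zero) (rule LIMSEQ_Suc[OF lim_const_over_n])
    have ul: "uniform_limit (ball 0 r) \<phi> (\<psi> u) sequentially"
    proof (rule uniform_limitI)
      fix e :: real assume "e > 0"
      with lim have "\<forall>\<^sub>F n in sequentially. K * (norm u)\<^sup>2 * h n < e"
        by (rule order_tendstoD)
      then show "\<forall>\<^sub>F n in sequentially. \<forall>z\<in>ball 0 r. dist (\<phi> n z) (\<psi> u z) < e"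
        by (rule eventually_mono) (auto simp: dist_norm intro: order_le_less_trans[OF bd])
    qed
    show ?thesis
    proof (rule holomorphic_uniform_sequence[where f = \<phi>])
      show "\<phi> n holomorphic_on ball 0 r" for n
        unfolding \<phi>_def using h0[of n] by (intro holomorphic_intros hline hu hline0) auto
      fix z :: complex assume "z \<in> ball 0 r"
      then obtain d where "d > 0" "cball z d \<subseteq> ball 0 r" using open_contains_cball open_ball
        by metis
      then show "\<exists>d>0. cball z d \<subseteq> ball 0 r \<and> uniform_limit (cball z d) \<phi> (\<psi> u) sequentially"
        using uniform_limit_on_subset[OF ul] by blast
    qed simp
  qed
  have est: "cmod (frechet_derivative f (at (x + u)) v - frechet_derivative f (at x) v
    - deriv (\<psi> u) 0)
      \<le> 2 * K / r * (norm u)\<^sup>2" if u: "norm u \<le> R / 2" for u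
  proof -
    \<comment> \<open>\<open>E\<close> is the Taylor remainder of \<open>f\<close> in direction
      \<open>u\<close>, moved along the line in direction \<open>v\<close>. It is quadratically
      small in \<open>u\<close>, uniformly in \<open>z\<close>; Cauchy's inequality passes this
      bound to \<open>deriv E 0\<close>, the quantity to be estimated.\<close>
    define E where "E = (\<lambda>z. f (x + u + z *s v) - f (x + z *s v) - \<psi> u z)"
    have hE: "E holomorphic_on ball 0 r"
      unfolding E_def by (intro holomorphic_intros hline[OF u] hline0 h\<psi>)
    have EB: "cmod (E z) \<le> K * (norm u)\<^sup>2" if "z \<in> ball 0 r" for z
      using quad[OF mem[OF that] u] by (simp add: E_def \<psi>_def add.commute add.left_commute)
    have "cmod ((deriv ^^ 1) E 0) \<le> fact 1 * (K * (norm u)\<^sup>2) / (r / 2) ^ 1"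
    proof (rule Cauchy_inequality)
      show "E holomorphic_on ball 0 (r / 2)" using hE r by (auto intro: holomorphic_on_subset)
      show "continuous_on (cball 0 (r / 2)) E"
        using holomorphic_on_imp_continuous_on[OF hE] r by (auto intro: continuous_on_subset)
    qed (use r EB in auto)
    moreover have "deriv E 0 = frechet_derivative f (at (x + u)) v - frechet_derivative f (at x) v
      - deriv (\<psi> u) 0"
    proof (rule DERIV_imp_deriv)
      have "(\<psi> u has_field_derivative deriv (\<psi> u) 0) (at 0)"
        using h\<psi> r by (intro holomorphic_derivI[where S = "ball 0 r"]) auto
      moreover have "((\<lambda>z. f (x + u + z *s v)) has_field_derivative frechet_derivative f
        (at (x + u)) v) (at 0)"
        using holomorphic_fun_line_derivative[OF hol, of "x + u" 0 v] mem2[OF _ u, of 0] r by simp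
      moreover have "((\<lambda>z. f (x + z *s v)) has_field_derivative frechet_derivative f (at x) v)
        (at 0)"
        using holomorphic_fun_line_derivative[OF hol, of x 0 v] x by simp
      ultimately show "(E has_field_derivative frechet_derivative f (at (x + u)) v
        - frechet_derivative f (at x) v - deriv (\<psi> u) 0) (at 0)"
        unfolding E_def by (intro DERIV_diff)
    qed
    ultimately show ?thesis by (simp add: field_simps)
  qed
  show thesis
  proof (rule that[of r "2 * K / r" "R / 2"])
    show "x + z *s v \<in> V" if "z \<in> ball 0 r" for z using mem2[OF that, of 0] R by simp
  qed (use r K R h\<psi> est in \<open>auto simp: \<psi>_def\<close>)
qed

text \<open>The candidate \<open>f2\<close> differentiates \<open>Df(.)(u)\<close> along
  \<open>v\<close> instead of \<open>Df(.)(v)\<close> along \<open>u\<close>; this is the form that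
  the estimate above provides. Linearity of \<open>f2\<close> and the quadratic error make it a
  Frechet derivative, and the exchanged roles already contain the symmetry of second
  derivatives.\<close>

lemma has_derivative_frechet_derivative:
  fixes f :: "complex^'n \<Rightarrow> complex" and v :: "complex^'n"
  assumes hol: "holomorphic_fun f V" and V: "open V" and x: "x \<in> V"
  defines "f2 \<equiv> \<lambda>u. deriv (\<lambda>z. frechet_derivative f (at (x + z *s v)) u) 0"
  shows "((\<lambda>y. frechet_derivative f (at y) v) has_derivative f2) (at x)"
    and "f2 (k *s u) = k * f2 u"
proof -
  obtain r C d where r: "r > 0" "C \<ge> 0" "d > 0"
    and mem: "\<And>z. z \<in> ball 0 r \<Longrightarrow> x + z *s v \<in> V"
    and h\<psi>: "\<And>u. (\<lambda>z. frechet_derivative f (at (x + z *s v)) u) holomorphic_on ball 0 r"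
    and est: "\<And>u. norm u \<le> d \<Longrightarrow> cmod (frechet_derivative f (at (x + u)) v - frechet_derivative f
      (at x) v
        - f2 u) \<le> C * (norm u)\<^sup>2"
    unfolding f2_def using holomorphic_fun_derivative_estimate[OF hol V x, of v] by metis
  have fd: "(\<lambda>z. frechet_derivative f (at (x + z *s v)) u) field_differentiable at 0" for u
    using h\<psi> r(1) by (intro holomorphic_on_imp_differentiable_at[of _ "ball 0 r"]) auto
  have ev: "\<forall>\<^sub>F z in nhds 0. x + z *s v \<in> V"
    using mem r by (auto simp: eventually_nhds_metric intro!: exI[of _ r])
  have scale: "f2 (k *s u) = k * f2 u" for k u
  proof -
    have "f2 (k *s u) = deriv (\<lambda>z. k * frechet_derivative f (at (x + z *s v)) u) 0"
      unfolding f2_def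
      by (intro deriv_cong_ev refl eventually_mono[OF ev] holomorphic_fun_has_derivative(2)[OF hol])
    also have "\<dots> = k * f2 u" unfolding f2_def using fd by (rule deriv_cmult)
    finally show ?thesis .
  qed
  show "f2 (k *s u) = k * f2 u" by (rule scale)
  have add: "f2 (u + w) = f2 u + f2 w" for u w
  proof -
    have "f2 (u + w) = deriv (\<lambda>z. frechet_derivative f (at (x + z *s v)) u + frechet_derivative f
      (at (x + z *s v)) w) 0"
      unfolding f2_def
      by (intro deriv_cong_ev refl eventually_mono[OF ev] linear_add
          has_derivative_linear[OF holomorphic_fun_has_derivative(1)[OF hol]])
    also have "\<dots> = f2 u + f2 w" unfolding f2_def using fd fd by (rule deriv_add)
    finally show ?thesis .
  qed
  have "linear f2"
    by (rule linearI) (simp_all add: add scale scaleR_eq_vector_scalar_mult scaleR_conv_of_real)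
  then have bl: "bounded_linear f2" by (simp add: linear_conv_bounded_linear)
  show "((\<lambda>y. frechet_derivative f (at y) v) has_derivative f2) (at x)"
    unfolding has_derivative_at_alt
  proof (intro conjI bl allI impI)
    fix e :: real assume e: "e > 0"
    \<comment> \<open>The bound \<open>e / (C + 1)\<close> turns the quadratic error
      \<open>C * norm (y - x) ^ 2\<close> into \<open>e * norm (y - x)\<close>, also for
      \<open>C = 0\<close>.\<close>
    define d' where "d' = min d (e / (C + 1))"
    show "\<exists>d>0. \<forall>y. norm (y - x) < d \<longrightarrow>
      norm (frechet_derivative f (at y) v - frechet_derivative f (at x) v - f2 (y - x))
      \<le> e * norm (y - x)"
    proof (intro exI[of _ d'] conjI allI impI)
      show "d' > 0" using r e by (simp add: d'_def)
      fix y assume y: "norm (y - x) < d'"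
      have "norm (frechet_derivative f (at y) v - frechet_derivative f (at x) v - f2 (y - x))
        \<le> C * (norm (y - x))\<^sup>2"
        using est[of "y - x"] y by (simp add: d'_def)
      also have "\<dots> = (C * norm (y - x)) * norm (y - x)" by (simp add: power2_eq_square)
      also have "\<dots> \<le> e * norm (y - x)"
      proof (rule mult_right_mono)
        have "C * norm (y - x) \<le> (C + 1) * (e / (C + 1))"
          using y r by (intro mult_mono) (auto simp: d'_def)
        then show "C * norm (y - x) \<le> e" using r by simp
      qed simp
      finally show "norm (frechet_derivative f (at y) v - frechet_derivative f (at x) v
        - f2 (y - x)) \<le> e * norm (y - x)" .
    qed
  qed
qed

lemma holomorphic_fun_frechet_derivative:
  "holomorphic_fun f V \<Longrightarrow> open V \<Longrightarrow> holomorphic_fun (\<lambda>y. frechet_derivative f (at y) v) V"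
  unfolding holomorphic_fun_def[of "\<lambda>y. frechet_derivative f (at y) v"]
  using has_derivative_frechet_derivative by blast

text \<open>Both sides are the derivative at 0 of \<open>z \<mapsto> Df(x + z v)(u)\<close>: the
  left by the formula just obtained, the right by the chain rule along a line.\<close>

lemma frechet_derivative_symmetric:
  fixes f :: "complex^'n \<Rightarrow> complex"
  assumes "holomorphic_fun f V" "open V" "x \<in> V"
  shows "frechet_derivative (\<lambda>y. frechet_derivative f (at y) v) (at x) u =
         frechet_derivative (\<lambda>y. frechet_derivative f (at y) u) (at x) v"
proof -
  have "frechet_derivative (\<lambda>y. frechet_derivative f (at y) v) (at x) u
      = deriv (\<lambda>z. frechet_derivative f (at (x + z *s v)) u) 0"
    using has_derivative_frechet_derivative(1)[OF assms, THEN frechet_derivative_at] by metis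
  also have "\<dots> = frechet_derivative (\<lambda>y. frechet_derivative f (at y) u) (at x) v"
    using holomorphic_fun_line_derivative[OF holomorphic_fun_frechet_derivative[OF assms(1,2)], of x
      0 v u] assms(3)
    by (intro DERIV_imp_deriv) simp
  finally show ?thesis .
qed

section \<open>Vector-valued holomorphic maps, directional derivatives and their commutator\<close>

lemma has_derivative_vec_iff:
  fixes F :: "'a::real_normed_vector \<Rightarrow> complex^'m"
  shows "(F has_derivative F') (at x) \<longleftrightarrow> (\<forall>k. ((\<lambda>y. F y $ k) has_derivative (\<lambda>v. F' v $ k)) (at x))"
proof
  assume "\<forall>k. ((\<lambda>y. F y $ k) has_derivative (\<lambda>v. F' v $ k)) (at x)"
  then have "((\<lambda>y. F y $ k \<bullet> b) has_derivative (\<lambda>v. F' v $ k \<bullet> b)) (at x)" for k b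
    by (intro has_derivative_inner_left) auto
  then show "(F has_derivative F') (at x)"
    by (subst has_derivative_componentwise_within) (auto simp: Basis_vec_def inner_axis)
qed (auto intro: bounded_linear.has_derivative[OF bounded_linear_vec_nth])

lemma holomorphic_map_has_derivative:
  assumes "holomorphic_map F V" "x \<in> V"
  shows "(F has_derivative frechet_derivative F (at x)) (at x)"
    and "frechet_derivative F (at x) (k *s v) = k *s frechet_derivative F (at x) v"
proof -
  obtain F' where F': "(F has_derivative F') (at x)" "\<And>k v. F' (k *s v) = k *s F' v"
    using assms unfolding holomorphic_map_def by blast
  then have "F' = frechet_derivative F (at x)"
    by (simp add: frechet_derivative_at)
  with F' show "(F has_derivative frechet_derivative F (at x)) (at x)"
    "frechet_derivative F (at x) (k *s v) = k *s frechet_derivative F (at x) v" by auto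
qed

lemma holomorphic_map_iff:
  "holomorphic_map F V \<longleftrightarrow> (\<forall>k. holomorphic_fun (\<lambda>x. F x $ k) V)" (is "?L \<longleftrightarrow> ?R")
proof
  assume L: ?L
  show ?R
    unfolding holomorphic_fun_def
  proof (intro allI ballI)
    fix k x assume "x \<in> V"
    from holomorphic_map_has_derivative[OF L this]
    show "\<exists>f'. ((\<lambda>x. F x $ k) has_derivative f') (at x) \<and> (\<forall>c v. f' (c *s v) = c * f' v)"
      by (intro exI[of _ "\<lambda>v. frechet_derivative F (at x) v $ k"])
        (simp add: has_derivative_vec_iff)
  qed
next
  assume R: ?R
  show ?L
    unfolding holomorphic_map_def
  proof
    fix x assume "x \<in> V"
    with R show "\<exists>F'. (F has_derivative F') (at x) \<and> (\<forall>k v. F' (k *s v) = k *s F' v)"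
      by (intro exI[of _ "\<lambda>v. \<chi> k. frechet_derivative (\<lambda>y. F y $ k) (at x) v"])
        (auto simp: has_derivative_vec_iff vec_eq_iff intro: holomorphic_fun_has_derivative)
  qed
qed

lemma frechet_derivative_component:
  assumes "holomorphic_map F V" "x \<in> V"
  shows "frechet_derivative (\<lambda>y. F y $ k) (at x) v = frechet_derivative F (at x) v $ k"
proof -
  have "((\<lambda>y. F y $ k) has_derivative (\<lambda>v. frechet_derivative F (at x) v $ k)) (at x)"
    using holomorphic_map_has_derivative(1)[OF assms] by (simp add: has_derivative_vec_iff)
  then show ?thesis by (metis frechet_derivative_at)
qed

lemma frechet_derivative_expand:
  assumes "holomorphic_fun f V" "x \<in> V"
  shows "frechet_derivative f (at x) v = (\<Sum>i\<in>UNIV. v $ i * frechet_derivative f (at x) (axis i 1))"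
proof -
  have "frechet_derivative f (at x) v = frechet_derivative f (at x) (\<Sum>i\<in>UNIV. v $ i *s axis i 1)"
    by (simp add: basis_expansion)
  also have "\<dots> = (\<Sum>i\<in>UNIV. frechet_derivative f (at x) (v $ i *s axis i 1))"
    by (intro linear_sum has_derivative_linear[OF holomorphic_fun_has_derivative(1)[OF assms]])
  finally show ?thesis by (simp add: holomorphic_fun_has_derivative(2)[OF assms])
qed

lemma holomorphic_fun_cong:
  assumes "open V" "\<And>x. x \<in> V \<Longrightarrow> f x = g x" "holomorphic_fun f V"
  shows "holomorphic_fun g V"
  unfolding holomorphic_fun_def
proof
  fix x assume x: "x \<in> V"
  from has_derivative_transform_within_open[OF holomorphic_fun_has_derivative(1)[OF assms(3) x]
    assms(1) x assms(2)]
  show "\<exists>g'. (g has_derivative g') (at x) \<and> (\<forall>k v. g' (k *s v) = k * g' v)"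
    using holomorphic_fun_has_derivative(2)[OF assms(3) x] by blast
qed

lemma holomorphic_map_cong:
  assumes "open V" "\<And>x. x \<in> V \<Longrightarrow> F x = G x" "holomorphic_map F V"
  shows "holomorphic_map G V"
  unfolding holomorphic_map_iff
proof
  fix k
  show "holomorphic_fun (\<lambda>x. G x $ k) V"
    by (rule holomorphic_fun_cong[OF assms(1), of "\<lambda>x. F x $ k"])
      (use assms in \<open>auto simp: holomorphic_map_iff\<close>)
qed

text \<open>Expanding \<open>Y y\<close> in the standard basis turns \<open>Df(y)(Y y)\<close> into
  a finite sum of products, so the product rule applies: one term keeps \<open>Y\<close> fixed at
  \<open>x\<close>, the other keeps \<open>Df\<close> fixed at \<open>x\<close>.\<close>

lemma has_derivative_directional_derivative:
  fixes f :: "complex^'n \<Rightarrow> complex" and Y :: "complex^'n \<Rightarrow> complex^'n"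
  assumes f: "holomorphic_fun f V" and V: "open V" and x: "x \<in> V" and Y: "holomorphic_map Y V"
  shows "((\<lambda>y. frechet_derivative f (at y) (Y y)) has_derivative
      (\<lambda>u. frechet_derivative (\<lambda>y. frechet_derivative f (at y) (Y x)) (at x) u +
           frechet_derivative f (at x) (frechet_derivative Y (at x) u))) (at x)"
proof -
  let ?d = "\<lambda>i y. frechet_derivative f (at y) (axis i 1)"
  have hd: "(?d i has_derivative frechet_derivative (?d i) (at x)) (at x)" for i
    by (rule holomorphic_fun_has_derivative(1)[OF holomorphic_fun_frechet_derivative[OF f V] x])
  have hY: "((\<lambda>y. Y y $ i) has_derivative (\<lambda>u. frechet_derivative Y (at x) u $ i)) (at x)" for i
    using holomorphic_map_has_derivative(1)[OF Y x] by (simp add: has_derivative_vec_iff)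
  have 1: "((\<lambda>y. \<Sum>i\<in>UNIV. Y y $ i * ?d i y) has_derivative
      (\<lambda>u. \<Sum>i\<in>UNIV. Y x $ i * frechet_derivative (?d i) (at x) u + frechet_derivative Y (at x) u $ i
      * ?d i x)) (at x)"
    by (intro has_derivative_sum has_derivative_mult hY hd)
  have "((\<lambda>y. \<Sum>i\<in>UNIV. Y x $ i * ?d i y) has_derivative
      (\<lambda>u. \<Sum>i\<in>UNIV. Y x $ i * frechet_derivative (?d i) (at x) u)) (at x)"
    by (intro has_derivative_sum has_derivative_mult_right hd)
  then have "((\<lambda>y. frechet_derivative f (at y) (Y x)) has_derivative
      (\<lambda>u. \<Sum>i\<in>UNIV. Y x $ i * frechet_derivative (?d i) (at x) u)) (at x)"
    by (rule has_derivative_transform_within_open[OF _ V x])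
      (rule frechet_derivative_expand[OF f, symmetric])
  then have 2: "frechet_derivative (\<lambda>y. frechet_derivative f (at y) (Y x)) (at x)
      = (\<lambda>u. \<Sum>i\<in>UNIV. Y x $ i * frechet_derivative (?d i) (at x) u)"
    by (rule frechet_derivative_at[symmetric])
  have "((\<lambda>y. frechet_derivative f (at y) (Y y)) has_derivative
      (\<lambda>u. \<Sum>i\<in>UNIV. Y x $ i * frechet_derivative (?d i) (at x) u + frechet_derivative Y (at x) u $ i
      * ?d i x)) (at x)"
    by (rule has_derivative_transform_within_open[OF 1 V x])
      (rule frechet_derivative_expand[OF f, symmetric])
  then show ?thesis
    unfolding 2 frechet_derivative_expand[OF f x, of "frechet_derivative Y (at x) _"]
    by (simp add: sum.distrib)
qed

lemma holomorphic_fun_directional_derivative: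
  fixes f :: "complex^'n \<Rightarrow> complex" and Y :: "complex^'n \<Rightarrow> complex^'n"
  assumes f: "holomorphic_fun f V" and V: "open V" and Y: "holomorphic_map Y V"
  shows "holomorphic_fun (\<lambda>y. frechet_derivative f (at y) (Y y)) V"
  unfolding holomorphic_fun_def
proof
  fix x assume x: "x \<in> V"
  show "\<exists>f'. ((\<lambda>y. frechet_derivative f (at y) (Y y)) has_derivative f') (at x)
    \<and> (\<forall>k v. f' (k *s v) = k * f' v)"
    by (intro exI[of _ "\<lambda>u. frechet_derivative (\<lambda>y. frechet_derivative f (at y) (Y x)) (at x) u +
           frechet_derivative f (at x) (frechet_derivative Y (at x) u)"] conjI allI
        has_derivative_directional_derivative[OF f V x Y])
      (simp add: holomorphic_fun_has_derivative(2)[OF holomorphic_fun_frechet_derivative[OF f V] x]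
        holomorphic_map_has_derivative(2)[OF Y x] holomorphic_fun_has_derivative(2)[OF f x]
        distrib_left)
qed

lemma holomorphic_map_directional_derivative:
  fixes Z Y :: "complex^'n \<Rightarrow> complex^'n"
  assumes Z: "holomorphic_map Z V" and V: "open V" and Y: "holomorphic_map Y V"
  shows "holomorphic_map (\<lambda>y. frechet_derivative Z (at y) (Y y)) V"
  unfolding holomorphic_map_iff
proof
  fix k
  have "holomorphic_fun (\<lambda>y. frechet_derivative (\<lambda>y. Z y $ k) (at y) (Y y)) V"
    using Z V Y by (intro holomorphic_fun_directional_derivative)
      (auto simp: holomorphic_map_iff[of Z])
  then show "holomorphic_fun (\<lambda>y. frechet_derivative Z (at y) (Y y) $ k) V"
    by (rule holomorphic_fun_cong[OF V frechet_derivative_component[OF Z], rotated])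
qed

text \<open>This is the vanishing curvature of the plain derivative. Each iterated derivative splits
  into a second derivative of \<open>Z\<close>, which is symmetric and cancels, and a term through
  the derivative of the inner field; the latter two form the bracket.\<close>

lemma directional_derivative_commutator:
  fixes X Y Z :: "complex^'n \<Rightarrow> complex^'n"
  assumes V: "open V" and x: "x \<in> V"
    and X: "holomorphic_map X V" and Y: "holomorphic_map Y V" and Z: "holomorphic_map Z V"
  shows "frechet_derivative (\<lambda>y. frechet_derivative Z (at y) (Y y)) (at x) (X x)
       - frechet_derivative (\<lambda>y. frechet_derivative Z (at y) (X y)) (at x) (Y x)
       = frechet_derivative Z (at x) (frechet_derivative Y (at x) (X x) - frechet_derivative X
       (at x) (Y x))"
  unfolding vec_eq_iff
proof
  fix k
  let ?f = "\<lambda>y. Z y $ k"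
  have f: "holomorphic_fun ?f V" using Z by (simp add: holomorphic_map_iff)
  have *: "frechet_derivative (\<lambda>y. frechet_derivative Z (at y) (A y)) (at x) u $ k
      = frechet_derivative (\<lambda>y. frechet_derivative ?f (at y) (A x)) (at x) u
        + frechet_derivative ?f (at x) (frechet_derivative A (at x) u)"
    if A: "holomorphic_map A V" for A u
  proof -
    have "frechet_derivative (\<lambda>y. frechet_derivative Z (at y) (A y)) (at x) u $ k
        = frechet_derivative (\<lambda>y. frechet_derivative Z (at y) (A y) $ k) (at x) u"
      by (rule frechet_derivative_component[OF holomorphic_map_directional_derivative[OF Z V A] x,
        symmetric])
    also have "\<dots> = frechet_derivative (\<lambda>y. frechet_derivative ?f (at y) (A y)) (at x) u"
    proof -
      have "((\<lambda>y. frechet_derivative Z (at y) (A y) $ k) has_derivative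
          frechet_derivative (\<lambda>y. frechet_derivative ?f (at y) (A y)) (at x)) (at x)"
        by (rule has_derivative_transform_within_open[OF holomorphic_fun_has_derivative(1)[OF
              holomorphic_fun_directional_derivative[OF f V A] x] V x])
          (rule frechet_derivative_component[OF Z])
      from frechet_derivative_at[OF this, THEN fun_cong, symmetric] show ?thesis .
    qed
    also have "\<dots> = frechet_derivative (\<lambda>y. frechet_derivative ?f (at y) (A x)) (at x) u
        + frechet_derivative ?f (at x) (frechet_derivative A (at x) u)"
      by (rule has_derivative_directional_derivative[OF f V x A, THEN frechet_derivative_at, THEN
        fun_cong, symmetric])
    finally show ?thesis .
  qed
  have "linear (frechet_derivative ?f (at x))"
    using holomorphic_fun_has_derivative(1)[OF f x] by (rule has_derivative_linear)
  then show "(frechet_derivative (\<lambda>y. frechet_derivative Z (at y) (Y y)) (at x) (X x)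
       - frechet_derivative (\<lambda>y. frechet_derivative Z (at y) (X y)) (at x) (Y x)) $ k
       = frechet_derivative Z (at x) (frechet_derivative Y (at x) (X x) - frechet_derivative X
       (at x) (Y x)) $ k"
    using frechet_derivative_symmetric[OF f V x, of "Y x" "X x"]
    by (simp add: *[OF X] *[OF Y] frechet_derivative_component[OF Z x, symmetric] linear_diff)
qed

lemma holomorphic_map_subset: "holomorphic_map F V \<Longrightarrow> W \<subseteq> V \<Longrightarrow> holomorphic_map F W"
  unfolding holomorphic_map_def by blast

lemma holomorphic_map_add:
  assumes "holomorphic_map F V" "holomorphic_map G V"
  shows "holomorphic_map (\<lambda>x. F x + G x) V"
  unfolding holomorphic_map_def
proof
  fix x assume "x \<in> V"
  then obtain F' G' where "(F has_derivative F') (at x)" "\<And>k v. F' (k *s v) = k *s F' v"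
    "(G has_derivative G') (at x)" "\<And>k v. G' (k *s v) = k *s G' v"
    using assms unfolding holomorphic_map_def by blast
  then show "\<exists>H. ((\<lambda>x. F x + G x) has_derivative H) (at x) \<and> (\<forall>k v. H (k *s v) = k *s H v)"
    by (intro exI[of _ "\<lambda>u. F' u + G' u"]) (simp add: has_derivative_add vector_add_ldistrib)
qed

lemma holomorphic_fun_mult:
  assumes "holomorphic_fun f V" "holomorphic_fun g V"
  shows "holomorphic_fun (\<lambda>x. f x * g x) V"
  unfolding holomorphic_fun_def
proof
  fix x assume "x \<in> V"
  then obtain f' g' where "(f has_derivative f') (at x)" "\<And>k v. f' (k *s v) = k * f' v"
    "(g has_derivative g') (at x)" "\<And>k v. g' (k *s v) = k * g' v"
    using assms unfolding holomorphic_fun_def by blast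
  then show "\<exists>h. ((\<lambda>x. f x * g x) has_derivative h) (at x) \<and> (\<forall>k v. h (k *s v) = k * h v)"
    by (intro exI[of _ "\<lambda>u. f x * g' u + f' u * g x"]) (auto intro: has_derivative_mult simp:
      algebra_simps)
qed

lemma holomorphic_map_scale:
  "holomorphic_fun f V \<Longrightarrow> holomorphic_map F V \<Longrightarrow> holomorphic_map (\<lambda>x. f x *s F x) V"
  unfolding holomorphic_map_iff by (simp add: holomorphic_fun_mult)

lemma matrix_vector_mul_has_derivative: "((\<lambda>x::complex^'n. L *v x + v) has_derivative (*v) L)
  (at x)"
  by (auto intro!: derivative_eq_intros bounded_linear_imp_has_derivative)

text \<open>For a singleton, \<open>holomorphic_map F {x}\<close> still speaks of the derivative at
  \<open>x\<close> in full neighbourhoods. It expresses complex differentiability at one point and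
  allows holomorphy to be checked through germs.\<close>

lemma holomorphic_mapI:
  assumes "\<And>x. x \<in> V \<Longrightarrow> holomorphic_map F {x}"
  shows "holomorphic_map F V"
  using assms unfolding holomorphic_map_def by blast

lemma holomorphic_map_cong_ev:
  assumes "\<forall>\<^sub>F y in nhds x. F y = G y" "holomorphic_map F {x}"
  shows "holomorphic_map G {x}"
proof -
  obtain B where B: "open B" "x \<in> B" "\<And>y. y \<in> B \<Longrightarrow> F y = G y"
    using assms(1) unfolding eventually_nhds by blast
  have "(G has_derivative frechet_derivative F (at x)) (at x)"
    using holomorphic_map_has_derivative(1)[OF assms(2)] B
      by (blast intro: has_derivative_transform_within_open)
  then show ?thesis
    unfolding holomorphic_map_def using holomorphic_map_has_derivative(2)[OF assms(2)] by blast
qed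

lemma frechet_derivative_cong_ev:
  assumes "\<forall>\<^sub>F y in nhds x. F y = G y"
  shows "frechet_derivative F (at x) = frechet_derivative G (at x)"
proof -
  obtain B where B: "open B" "x \<in> B" "\<And>y. y \<in> B \<Longrightarrow> F y = G y"
    using assms(1) unfolding eventually_nhds by blast
  have "(F has_derivative D) (at x) \<longleftrightarrow> (G has_derivative D) (at x)" for D
    using has_derivative_transform_within_open[of F D x UNIV B G]
      has_derivative_transform_within_open[of G D x UNIV B F] B by auto
  then show ?thesis by (simp add: frechet_derivative_def)
qed

lemma holomorphic_map_const: "holomorphic_map (\<lambda>x. c) V"
  unfolding holomorphic_map_def by (auto intro!: exI[of _ "\<lambda>x. 0"])

lemma has_derivative_affine_compose:
  assumes "(F has_derivative F') (at (L *v x + v))"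
  shows "((\<lambda>y. F (L *v y + v)) has_derivative (\<lambda>u. F' (L *v u))) (at (x :: complex^'n))"
  using diff_chain_at[OF matrix_vector_mul_has_derivative assms] by (simp add: o_def)

lemma holomorphic_map_affine_compose:
  assumes "holomorphic_map F {L *v x + v}"
  shows "holomorphic_map (\<lambda>y. F (L *v y + v)) {x}"
proof -
  have "((\<lambda>y. F (L *v y + v)) has_derivative (\<lambda>u. frechet_derivative F (at (L *v x + v)) (L *v u)))
    (at x)"
    by (rule has_derivative_affine_compose[OF holomorphic_map_has_derivative(1)[OF assms]]) simp
  then show ?thesis
    unfolding holomorphic_map_def using holomorphic_map_has_derivative(2)[OF assms]
    by (auto simp: vector_scalar_commute)
qed

section \<open>Manifolds with affine coordinate changes\<close>

text \<open>Coordinate changes are affine only near each point, with a matrix that may depend on the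
  point: an overlap of chart domains can be disconnected, and in a quotient its components can
  belong to different group elements.\<close>

locale affine_manifold =
  fixes M :: "('p, 'n::finite) cmfd"
  assumes chart_open: "c \<in> atlas M \<Longrightarrow> openin (mtop M) (fst c)"
    and chart_inj: "c \<in> atlas M \<Longrightarrow> inj_on (snd c) (fst c)"
    and open_image: "c \<in> atlas M \<Longrightarrow> openin (mtop M) V \<Longrightarrow> open (snd c ` (fst c \<inter> V))"
    and affine_transition: "c \<in> atlas M \<Longrightarrow> d \<in> atlas M \<Longrightarrow> p \<in> fst c \<inter> fst d \<Longrightarrow>
      \<exists>L v. \<forall>\<^sub>F y in nhds (snd c p). (snd d \<circ> chart_inv c) y = L *v y + v"
begin

definition transition_deriv :: "('p, 'n) chart \<Rightarrow> ('p, 'n) chart \<Rightarrow> 'p \<Rightarrow> complex^'n \<Rightarrow> complex^'n"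
where
  "transition_deriv c d p = frechet_derivative (snd d \<circ> chart_inv c) (at (snd c p))"

lemma chart_inv_chart [simp]: "c \<in> atlas M \<Longrightarrow> p \<in> fst c \<Longrightarrow> chart_inv c (snd c p) = p"
  unfolding chart_inv_def using chart_inj by simp

lemma eventually_chart:
  assumes "c \<in> atlas M" "openin (mtop M) V" "p \<in> fst c \<inter> V"
  shows "\<forall>\<^sub>F y in nhds (snd c p). chart_inv c y \<in> fst c \<inter> V \<and> snd c (chart_inv c y) = y"
  unfolding eventually_nhds
  using assms open_image[OF assms(1,2)] by (intro exI[of _ "snd c ` (fst c \<inter> V)"]) auto

text \<open>An identity of germs at \<open>snd c p\<close> is an identity of germs at all nearby
  points (\<open>eventually_eventually\<close>). So the affine form gives not only the derivative at
  \<open>p\<close> but its local constancy, the last conclusion, on which the later transformation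
  rules rest.\<close>

lemma transition_obtain:
  assumes "c \<in> atlas M" "d \<in> atlas M" "p \<in> fst c \<inter> fst d"
  obtains L v where "\<forall>\<^sub>F y in nhds (snd c p). (snd d \<circ> chart_inv c) y = L *v y + v"
    "L *v snd c p + v = snd d p" "transition_deriv c d p = (*v) L"
    "\<forall>\<^sub>F y in nhds (snd c p). transition_deriv c d (chart_inv c y) = (*v) L"
proof -
  obtain L v where L: "\<forall>\<^sub>F y in nhds (snd c p). (snd d \<circ> chart_inv c) y = L *v y + v"
    using affine_transition[OF assms] by blast
  have D: "frechet_derivative (snd d \<circ> chart_inv c) (at y) = (*v) L"
    if "\<forall>\<^sub>F y in nhds y. (snd d \<circ> chart_inv c) y = L *v y + v" for y
    using frechet_derivative_cong_ev[OF that] frechet_derivative_at[OF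
      matrix_vector_mul_has_derivative] by metis
  have "\<forall>\<^sub>F y in nhds (snd c p). \<forall>\<^sub>F y in nhds y. (snd d \<circ> chart_inv c) y = L *v y + v"
    using L by (simp add: eventually_eventually)
  moreover have "\<forall>\<^sub>F y in nhds (snd c p). snd c (chart_inv c y) = y"
    using eventually_chart[OF assms(1) chart_open[OF assms(1)], of p] assms(3)
      by (auto elim: eventually_mono)
  ultimately have "\<forall>\<^sub>F y in nhds (snd c p). transition_deriv c d (chart_inv c y) = (*v) L"
    by eventually_elim (simp add: transition_deriv_def D)
  moreover have "L *v snd c p + v = snd d p"
    using eventually_nhds_x_imp_x[OF L] assms by simp
  ultimately show thesis using that L D[OF L] unfolding transition_deriv_def by blast
qed

lemma transition_deriv_matrix:
  assumes "c \<in> atlas M" "d \<in> atlas M" "p \<in> fst c \<inter> fst d"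
  obtains L where "transition_deriv c d p = (*v) L"
  by (rule transition_obtain[OF assms]) (rule that)

lemma eventually_transition:
  assumes c: "c \<in> atlas M" and d: "d \<in> atlas M" and p: "p \<in> fst c \<inter> fst d"
    and P: "\<forall>\<^sub>F y in nhds (snd d p). P y"
  shows "\<forall>\<^sub>F y in nhds (snd c p). P (snd d (chart_inv c y))"
proof -
  obtain L v where L: "\<forall>\<^sub>F y in nhds (snd c p). (snd d \<circ> chart_inv c) y = L *v y + v"
    "L *v snd c p + v = snd d p" "transition_deriv c d p = (*v) L"
    "\<forall>\<^sub>F y in nhds (snd c p). transition_deriv c d (chart_inv c y) = (*v) L"
    by (rule transition_obtain[OF c d p])
  have "isCont (\<lambda>y. L *v y + v) (snd c p)"
    using matrix_vector_mul_has_derivative by (rule has_derivative_continuous)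
  then have "filterlim (\<lambda>y. L *v y + v) (nhds (snd d p)) (nhds (snd c p))"
    using L(2) by (metis (no_types, lifting) isCont_def tendsto_nhds_iff)
  with P have "\<forall>\<^sub>F y in nhds (snd c p). P (L *v y + v)"
    by (simp add: filterlim_iff)
  with L(1) show ?thesis by eventually_elim simp
qed

lemma transition_deriv_self:
  assumes "c \<in> atlas M" "p \<in> fst c"
  shows "transition_deriv c c p v = v"
proof -
  have "\<forall>\<^sub>F y in nhds (snd c p). (snd c \<circ> chart_inv c) y = y"
    using eventually_chart[OF assms(1) chart_open[OF assms(1)], of p] assms(2)
      by (auto elim: eventually_mono)
  from frechet_derivative_cong_ev[OF this] show ?thesis by (simp add: transition_deriv_def o_def)
qed

lemma transition_deriv_trans:
  assumes c: "c \<in> atlas M" and d: "d \<in> atlas M" and e: "e \<in> atlas M" and p: "p \<in> fst c" "p \<in> fst d"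
    "p \<in> fst e"
  shows "transition_deriv d e p (transition_deriv c d p u) = transition_deriv c e p u"
proof -
  obtain L v where L: "\<forall>\<^sub>F y in nhds (snd c p). (snd d \<circ> chart_inv c) y = L *v y + v"
    "L *v snd c p + v = snd d p" "transition_deriv c d p = (*v) L"
    "\<forall>\<^sub>F y in nhds (snd c p). transition_deriv c d (chart_inv c y) = (*v) L"
    by (rule transition_obtain[OF c d IntI[OF p(1,2)]])
  obtain K w where K: "\<forall>\<^sub>F y in nhds (snd d p). (snd e \<circ> chart_inv d) y = K *v y + w"
    "K *v snd d p + w = snd e p" "transition_deriv d e p = (*v) K"
    "\<forall>\<^sub>F y in nhds (snd d p). transition_deriv d e (chart_inv d y) = (*v) K"
    by (rule transition_obtain[OF d e IntI[OF p(2,3)]])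
  have "\<forall>\<^sub>F y in nhds (snd c p). chart_inv c y \<in> fst c \<inter> fst d"
    using eventually_chart[OF c chart_open[OF d], of p] p by (auto elim: eventually_mono)
  with L(1) eventually_transition[OF c d IntI[OF p(1,2)] K(1)]
  have "\<forall>\<^sub>F y in nhds (snd c p). (snd e \<circ> chart_inv c) y = (K ** L) *v y + (K *v v + w)"
  proof eventually_elim
    case (elim y)
    moreover have "chart_inv d (snd d (chart_inv c y)) = chart_inv c y" using elim(3) d
      by (intro chart_inv_chart) auto
    ultimately show ?case using elim(1,2)
      by (simp add: matrix_vector_mul_assoc matrix_vector_right_distrib add.assoc)
  qed
  from frechet_derivative_cong_ev[OF this] frechet_derivative_at[OF
    matrix_vector_mul_has_derivative]
  have "transition_deriv c e p = (*v) (K ** L)" unfolding transition_deriv_def by metis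
  then show ?thesis by (simp add: L(3) K(3) matrix_vector_mul_assoc)
qed

lemma vector_fieldsD:
  assumes "X \<in> vector_fields M V"
  shows "c \<in> atlas M \<Longrightarrow> holomorphic_map (X c \<circ> chart_inv c) (snd c ` (fst c \<inter> V))"
    and "c \<in> atlas M \<Longrightarrow> d \<in> atlas M \<Longrightarrow> p \<in> fst c \<inter> fst d \<inter> V \<Longrightarrow> X d p = transition_deriv c d p (X c p)"
    and "\<not> (c \<in> atlas M \<and> p \<in> fst c \<inter> V) \<Longrightarrow> X c p = 0"
  using assms unfolding vector_fields_def transition_deriv_def by blast+

lemma vector_fieldsI:
  assumes "\<And>c. c \<in> atlas M \<Longrightarrow> holomorphic_map (X c \<circ> chart_inv c) (snd c ` (fst c \<inter> V))"
    and "\<And>c d p. c \<in> atlas M \<Longrightarrow> d \<in> atlas M \<Longrightarrow> p \<in> fst c \<Longrightarrow> p \<in> fst d \<Longrightarrow> p \<in> V \<Longrightarrow>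
      X d p = transition_deriv c d p (X c p)"
    and "\<And>c p. \<not> (c \<in> atlas M \<and> p \<in> fst c \<and> p \<in> V) \<Longrightarrow> X c p = 0"
  shows "X \<in> vector_fields M V"
  using assms unfolding vector_fields_def transition_deriv_def by blast

lemma holomorphic_map_chart_cong:
  assumes c: "c \<in> atlas M" and V: "openin (mtop M) V"
    and "\<And>p. p \<in> fst c \<inter> V \<Longrightarrow> F (snd c p) = G (snd c p)" "holomorphic_map F (snd c ` (fst c \<inter> V))"
  shows "holomorphic_map G (snd c ` (fst c \<inter> V))"
  by (rule holomorphic_map_cong[OF open_image[OF c V] _ assms(4)]) (use assms(3) in auto)

lemma transition_deriv_linear:
  assumes "c \<in> atlas M" "d \<in> atlas M" "p \<in> fst c \<inter> fst d"
  shows "transition_deriv c d p (u + w) = transition_deriv c d p u + transition_deriv c d p w"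
    and "transition_deriv c d p (u - w) = transition_deriv c d p u - transition_deriv c d p w"
    and "transition_deriv c d p (k *s u) = k *s transition_deriv c d p u"
    and "transition_deriv c d p 0 = 0"
    and "transition_deriv c d p (sum f I) = (\<Sum>i\<in>I. transition_deriv c d p (f i))"
proof -
  obtain L where L: "transition_deriv c d p = (*v) L" using transition_deriv_matrix[OF assms] .
  show "transition_deriv c d p (u + w) = transition_deriv c d p u + transition_deriv c d p w"
     "transition_deriv c d p (u - w) = transition_deriv c d p u - transition_deriv c d p w"
     "transition_deriv c d p (k *s u) = k *s transition_deriv c d p u"
     "transition_deriv c d p 0 = 0"
    by (simp_all add: L matrix_vector_right_distrib matrix_vector_mult_diff_distrib
      vector_scalar_commute)
  have "linear (transition_deriv c d p)" by (simp add: L)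
  then show "transition_deriv c d p (sum f I) = (\<Sum>i\<in>I. transition_deriv c d p (f i))"
    by (rule linear_sum)
qed

lemma vf_add_in: 
  assumes V: "openin (mtop M) V" and X: "X \<in> vector_fields M V" and Y: "Y \<in> vector_fields M V"
  shows "vf_add X Y \<in> vector_fields M V"
proof (rule vector_fieldsI)
  fix c assume c: "c \<in> atlas M"
  show "holomorphic_map (vf_add X Y c \<circ> chart_inv c) (snd c ` (fst c \<inter> V))"
    using holomorphic_map_add[OF vector_fieldsD(1)[OF X c] vector_fieldsD(1)[OF Y c]]
    by (simp add: vf_add_def o_def)
next
  show "vf_add X Y d p = transition_deriv c d p (vf_add X Y c p)"
    if "c \<in> atlas M" "d \<in> atlas M" "p \<in> fst c" "p \<in> fst d" "p \<in> V" for c d p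
    using that vector_fieldsD(2)[OF X, of c d p] vector_fieldsD(2)[OF Y, of c d p]
    by (simp add: vf_add_def transition_deriv_linear)
qed (auto simp: vf_add_def vector_fieldsD(3)[OF X] vector_fieldsD(3)[OF Y])

lemma vf_scale_in: 
  assumes V: "openin (mtop M) V" and X: "X \<in> vector_fields M V"
    and f: "holomorphic_function_on M V f"
  shows "vf_scale f X \<in> vector_fields M V"
proof (rule vector_fieldsI)
  fix c assume c: "c \<in> atlas M"
  show "holomorphic_map (vf_scale f X c \<circ> chart_inv c) (snd c ` (fst c \<inter> V))"
    using holomorphic_map_scale[OF _ vector_fieldsD(1)[OF X c], of "f \<circ> chart_inv c"] f c
    by (simp add: vf_scale_def o_def holomorphic_function_on_def)
next
  show "vf_scale f X d p = transition_deriv c d p (vf_scale f X c p)"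
    if "c \<in> atlas M" "d \<in> atlas M" "p \<in> fst c" "p \<in> fst d" "p \<in> V" for c d p
    using that vector_fieldsD(2)[OF X, of c d p] by (simp add: vf_scale_def transition_deriv_linear)
qed (auto simp: vf_scale_def vector_fieldsD(3)[OF X])

lemma vf_restrict_in:
  assumes V: "openin (mtop M) V" and W: "openin (mtop M) W" "W \<subseteq> V" and X: "X \<in> vector_fields M V"
  shows "vf_restrict W X \<in> vector_fields M W"
proof (rule vector_fieldsI)
  fix c assume c: "c \<in> atlas M"
  have "holomorphic_map (X c \<circ> chart_inv c) (snd c ` (fst c \<inter> W))"
    using vector_fieldsD(1)[OF X c] W by (auto intro: holomorphic_map_subset)
  then show "holomorphic_map (vf_restrict W X c \<circ> chart_inv c) (snd c ` (fst c \<inter> W))"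
    by (rule holomorphic_map_chart_cong[OF c W(1), rotated]) (simp add: vf_restrict_def c)
next
  show "vf_restrict W X d p = transition_deriv c d p (vf_restrict W X c p)"
    if "c \<in> atlas M" "d \<in> atlas M" "p \<in> fst c" "p \<in> fst d" "p \<in> W" for c d p
    using that W vector_fieldsD(2)[OF X, of c d p] by (auto simp: vf_restrict_def)
qed (use W in \<open>auto simp: vf_restrict_def vector_fieldsD(3)[OF X]\<close>)

text \<open>Since the transition derivatives are locally constant, componentwise derivatives transform
  like vector fields.\<close>

lemma coord_deriv_transform:
  assumes V: "openin (mtop M) V" and c: "c \<in> atlas M" and d: "d \<in> atlas M" and p: "p \<in> fst c"
    "p \<in> fst d" "p \<in> V"
    and X: "X \<in> vector_fields M V" and Y: "Y \<in> vector_fields M V"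
  shows "coord_deriv X Y d p = transition_deriv c d p (coord_deriv X Y c p)"
proof -
  obtain K w where K: "\<forall>\<^sub>F y in nhds (snd d p). (snd c \<circ> chart_inv d) y = K *v y + w"
    "K *v snd d p + w = snd c p" "transition_deriv d c p = (*v) K"
    "\<forall>\<^sub>F y in nhds (snd d p). transition_deriv d c (chart_inv d y) = (*v) K"
    by (rule transition_obtain[OF d c IntI[OF p(2,1)]])
  obtain L v where L: "\<forall>\<^sub>F y in nhds (snd c p). (snd d \<circ> chart_inv c) y = L *v y + v"
    "L *v snd c p + v = snd d p" "transition_deriv c d p = (*v) L"
    "\<forall>\<^sub>F y in nhds (snd c p). transition_deriv c d (chart_inv c y) = (*v) L"
    by (rule transition_obtain[OF c d IntI[OF p(1,2)]])
  define D where "D = frechet_derivative (Y c \<circ> chart_inv c) (at (snd c p))"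
  have D: "((Y c \<circ> chart_inv c) has_derivative D) (at (K *v snd d p + w))"
    unfolding K(2) D_def using vector_fieldsD(1)[OF Y c] p
      by (intro holomorphic_map_has_derivative(1)) auto
  have "\<forall>\<^sub>F y in nhds (snd d p). chart_inv d y \<in> fst d \<inter> (fst c \<inter> V)"
    using eventually_chart[OF d openin_Int[OF chart_open[OF c] V], of p] p
      by (auto elim: eventually_mono)
  with K(1) eventually_transition[OF d c IntI[OF p(2,1)] L(4)]
  have "\<forall>\<^sub>F y in nhds (snd d p). (Y d \<circ> chart_inv d) y = L *v (Y c \<circ> chart_inv c) (K *v y + w)"
  proof eventually_elim
    case y: (elim y)
    have q: "chart_inv c (snd c (chart_inv d y)) = chart_inv d y" using y(3) c
      by (intro chart_inv_chart) auto
    have "Y d (chart_inv d y) = L *v Y c (chart_inv d y)"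
      using vector_fieldsD(2)[OF Y c d, of "chart_inv d y"] y(2,3) unfolding q by simp
    moreover have "K *v y + w = snd c (chart_inv d y)" using y by simp
    ultimately show ?case using y c by simp
  qed
  from frechet_derivative_cong_ev[OF this]
  have "frechet_derivative (Y d \<circ> chart_inv d) (at (snd d p)) = (\<lambda>u. L *v D (K *v u))"
    using bounded_linear.has_derivative[OF matrix_vector_mul_bounded_linear
      has_derivative_affine_compose[OF D], of L]
    by (metis frechet_derivative_at)
  then show ?thesis
    unfolding coord_deriv_def L(3) D_def[symmetric] 
    using vector_fieldsD(2)[OF X d c, of p] p by (simp add: K(3))
qed

definition affine_connection :: "('p, 'n) connection" where
  "affine_connection =
     (\<lambda>V\<in>{V. openin (mtop M) V}. \<lambda>X\<in>vector_fields M V. \<lambda>Y\<in>vector_fields M V.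
          \<lambda>c p. if c \<in> atlas M \<and> p \<in> fst c \<inter> V then coord_deriv X Y c p else 0)"

lemma affine_connection_apply:
  assumes "openin (mtop M) V" "X \<in> vector_fields M V" "Y \<in> vector_fields M V"
  shows "affine_connection V X Y = (\<lambda>c p. if c \<in> atlas M \<and> p \<in> fst c \<inter> V then coord_deriv X Y c p
    else 0)"
  using assms by (simp add: affine_connection_def)

lemma affine_connection_in:
  assumes V: "openin (mtop M) V" and X: "X \<in> vector_fields M V" and Y: "Y \<in> vector_fields M V"
  shows "affine_connection V X Y \<in> vector_fields M V"
proof (rule vector_fieldsI)
  fix c assume c: "c \<in> atlas M"
  show "holomorphic_map (affine_connection V X Y c \<circ> chart_inv c) (snd c ` (fst c \<inter> V))"
    by (rule holomorphic_map_chart_cong[OF c V _ holomorphic_map_directional_derivative[OF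
            vector_fieldsD(1)[OF Y c] open_image[OF c V] vector_fieldsD(1)[OF X c]]])
      (simp add: affine_connection_apply[OF assms] c coord_deriv_def)
next
  show "affine_connection V X Y d p = transition_deriv c d p (affine_connection V X Y c p)"
    if "c \<in> atlas M" "d \<in> atlas M" "p \<in> fst c" "p \<in> fst d" "p \<in> V" for c d p
    using that coord_deriv_transform[OF V that X Y] by (simp add: affine_connection_apply[OF assms])
qed (auto simp: affine_connection_apply[OF assms])

lemma coord_deriv_has_derivative:
  assumes V: "openin (mtop M) V" and Y: "Y \<in> vector_fields M V" and c: "c \<in> atlas M"
    and p: "p \<in> fst c \<inter> V"
  shows "((Y c \<circ> chart_inv c) has_derivative frechet_derivative (Y c \<circ> chart_inv c) (at (snd c p)))
    (at (snd c p))"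
    and "frechet_derivative (Y c \<circ> chart_inv c) (at (snd c p)) (k *s v)
      = k *s frechet_derivative (Y c \<circ> chart_inv c) (at (snd c p)) v"
  using holomorphic_map_has_derivative[OF vector_fieldsD(1)[OF Y c], of "snd c p"] p by auto

lemma affine_connection_holomorphic: "holomorphic_connection M affine_connection"
  unfolding holomorphic_connection_def
proof (intro conjI allI impI ballI)
  show "affine_connection \<in> (\<Pi>\<^sub>E V\<in>{V. openin (mtop M) V}.
            vector_fields M V \<rightarrow>\<^sub>E vector_fields M V \<rightarrow>\<^sub>E vector_fields M V)"
    using affine_connection_in unfolding affine_connection_def by auto
next
  fix V W X Y
  assume VW: "openin (mtop M) V \<and> openin (mtop M) W \<and> W \<subseteq> V" and X: "X \<in> vector_fields M V"
    and Y: "Y \<in> vector_fields M V"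
  show "affine_connection W (vf_restrict W X) (vf_restrict W Y)
    = vf_restrict W (affine_connection V X Y)"
  proof (intro ext)
    fix c p
    have eq: "coord_deriv (vf_restrict W X) (vf_restrict W Y) c p = coord_deriv X Y c p"
      if "c \<in> atlas M" "p \<in> fst c" "p \<in> W"
    proof -
      have "\<forall>\<^sub>F y in nhds (snd c p). (vf_restrict W Y c \<circ> chart_inv c) y = (Y c \<circ> chart_inv c) y"
        using eventually_chart[of c W p] that VW
          by (auto elim!: eventually_mono simp: vf_restrict_def)
      from frechet_derivative_cong_ev[OF this] that show ?thesis
        by (simp add: coord_deriv_def vf_restrict_def o_def)
    qed
    show "affine_connection W (vf_restrict W X) (vf_restrict W Y) c p
      = vf_restrict W (affine_connection V X Y) c p"
      using VW eq vf_restrict_in[OF _ _ _ X, of W] vf_restrict_in[OF _ _ _ Y, of W]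
      by (auto simp: affine_connection_apply X Y vf_restrict_def[of _ "\<lambda>c p. _ c p"])
  qed
next
  fix V X X' Y
  assume V: "openin (mtop M) V" and X: "X \<in> vector_fields M V" and X': "X' \<in> vector_fields M V"
    and Y: "Y \<in> vector_fields M V"
  show "affine_connection V (vf_add X X') Y
    = vf_add (affine_connection V X Y) (affine_connection V X' Y)"
    unfolding affine_connection_apply[OF V X Y] affine_connection_apply[OF V X' Y]
      affine_connection_apply[OF V vf_add_in[OF V X X'] Y]
    using coord_deriv_has_derivative(1)[OF V Y, THEN has_derivative_linear]
    by (auto simp: vf_add_def coord_deriv_def fun_eq_iff linear_add)
next
  fix V X Y Y'
  assume V: "openin (mtop M) V" and X: "X \<in> vector_fields M V" and Y: "Y \<in> vector_fields M V"
    and Y': "Y' \<in> vector_fields M V"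
  have "frechet_derivative ((\<lambda>p. Y c p + Y' c p) \<circ> chart_inv c) (at (snd c p)) u
      = frechet_derivative (Y c \<circ> chart_inv c) (at (snd c p)) u + frechet_derivative
      (Y' c \<circ> chart_inv c) (at (snd c p)) u"
    if "c \<in> atlas M" "p \<in> fst c \<inter> V" for c p u
    using has_derivative_add[OF coord_deriv_has_derivative(1)[OF V Y that]
      coord_deriv_has_derivative(1)[OF V Y' that],
        THEN frechet_derivative_at, THEN fun_cong, symmetric] by (simp add: o_def)
  then show "affine_connection V X (vf_add Y Y')
    = vf_add (affine_connection V X Y) (affine_connection V X Y')"
    unfolding affine_connection_apply[OF V X Y] affine_connection_apply[OF V X Y']
      affine_connection_apply[OF V X vf_add_in[OF V Y Y']]
    by (auto simp: vf_add_def coord_deriv_def fun_eq_iff)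
next
  fix V f X Y
  assume V: "openin (mtop M) V" and f: "holomorphic_function_on M V f"
    and X: "X \<in> vector_fields M V" and Y: "Y \<in> vector_fields M V"
  show "affine_connection V (vf_scale f X) Y = vf_scale f (affine_connection V X Y)"
    unfolding affine_connection_apply[OF V X Y] affine_connection_apply[OF V vf_scale_in[OF V X f]
      Y]
    using coord_deriv_has_derivative(2)[OF V Y]
    by (auto simp: vf_scale_def coord_deriv_def fun_eq_iff)
  fix c p assume c: "c \<in> atlas M" and p: "p \<in> fst c \<inter> V"
  have hf: "((f \<circ> chart_inv c) has_derivative frechet_derivative (f \<circ> chart_inv c) (at (snd c p)))
    (at (snd c p))"
    using f c p unfolding holomorphic_function_on_def
      by (intro holomorphic_fun_has_derivative(1)) auto
  have "((\<lambda>y. (f \<circ> chart_inv c) y *s (Y c \<circ> chart_inv c) y) has_derivative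
    (\<lambda>u. frechet_derivative (f \<circ> chart_inv c) (at (snd c p)) u *s Y c p + f p *s frechet_derivative
    (Y c \<circ> chart_inv c) (at (snd c p)) u)) (at (snd c p))"
    unfolding has_derivative_vec_iff
  proof
    fix k
    have "((\<lambda>y. (f \<circ> chart_inv c) y * (Y c \<circ> chart_inv c) y $ k) has_derivative
      (\<lambda>u. (f \<circ> chart_inv c) (snd c p) * frechet_derivative (Y c \<circ> chart_inv c) (at (snd c p)) u $ k
        + frechet_derivative (f \<circ> chart_inv c) (at (snd c p)) u * (Y c \<circ> chart_inv c) (snd c p) $
        k)) (at (snd c p))"
      by (intro has_derivative_mult hf) (use coord_deriv_has_derivative(1)[OF V Y c p] in \<open>simp add:
        has_derivative_vec_iff\<close>)
    then show "((\<lambda>y. ((f \<circ> chart_inv c) y *s (Y c \<circ> chart_inv c) y) $ k) has_derivative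
      (\<lambda>u. (frechet_derivative (f \<circ> chart_inv c) (at (snd c p)) u *s Y c p
        + f p *s frechet_derivative (Y c \<circ> chart_inv c) (at (snd c p)) u) $ k)) (at (snd c p))"
      using c p by (simp add: o_def add.commute)
  qed
  from frechet_derivative_at[OF this, THEN fun_cong, symmetric] c p
  show "affine_connection V X (vf_scale f Y) c p = fun_deriv X f c p *s Y c p
    + f p *s affine_connection V X Y c p"
    unfolding affine_connection_apply[OF V X Y] affine_connection_apply[OF V X
      vf_scale_in[OF V Y f]]
    by (simp add: vf_scale_def coord_deriv_def fun_deriv_def o_def)
qed

text \<open>The bracket is defined by coordinate derivatives in each chart, so it is the
  antisymmetrised affine connection by unfolding. Torsion-freeness is then immediate, and the
  bracket is seen to be a vector field.\<close>

lemma lie_bracket_affine_connection: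
  assumes V: "openin (mtop M) V" and X: "X \<in> vector_fields M V" and Y: "Y \<in> vector_fields M V"
  shows "lie_bracket M V X Y = vf_diff (affine_connection V X Y) (affine_connection V Y X)"
  unfolding affine_connection_apply[OF V X Y] affine_connection_apply[OF V Y X] lie_bracket_def
    vf_diff_def
  by (auto simp: fun_eq_iff)

lemma vf_diff_in:
  assumes V: "openin (mtop M) V" and X: "X \<in> vector_fields M V" and Y: "Y \<in> vector_fields M V"
  shows "vf_diff X Y \<in> vector_fields M V"
proof -
  have "holomorphic_function_on M V (\<lambda>p. -1)"
    by (auto simp: holomorphic_function_on_def holomorphic_fun_def o_def intro!: exI[of _ "\<lambda>x. 0"])
  from vf_add_in[OF V X vf_scale_in[OF V Y this]] show ?thesis
    by (simp add: vf_add_def vf_scale_def vf_diff_def)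
qed

lemma affine_connection_torsion_free: "torsion_free_connection M affine_connection"
  unfolding torsion_free_connection_def
  by (auto simp: lie_bracket_affine_connection vf_diff_def)

text \<open>In one chart the covariant derivative is the plain directional derivative near the
  point, not merely at it. It can therefore be iterated there, and
  \<open>directional_derivative_commutator\<close> applies to the coordinate
  representatives.\<close>

lemma affine_connection_flat: "flat_connection M affine_connection"
  unfolding flat_connection_def
proof (intro allI impI ballI ext)
  fix V X Y Z c p
  assume V: "openin (mtop M) V" and X: "X \<in> vector_fields M V" and Y: "Y \<in> vector_fields M V"
    and Z: "Z \<in> vector_fields M V"
  have XY: "lie_bracket M V X Y \<in> vector_fields M V"
    unfolding lie_bracket_affine_connection[OF V X Y]
      by (intro vf_diff_in affine_connection_in V X Y)
  show "vf_diff (vf_diff (affine_connection V X (affine_connection V Y Z)) (affine_connection V Y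
    (affine_connection V X Z)))
      (affine_connection V (lie_bracket M V X Y) Z) c p = 0"
  proof (cases "c \<in> atlas M \<and> p \<in> fst c \<inter> V")
    case False
    then show ?thesis
      by (simp only: vf_diff_def affine_connection_apply[OF V X affine_connection_in[OF V Y Z]]
        affine_connection_apply[OF V Y affine_connection_in[OF V X Z]] affine_connection_apply[OF V
        XY Z] if_False) simp
  next
    case True
    then have c: "c \<in> atlas M" and p: "p \<in> fst c \<inter> V" by auto
    have *: "coord_deriv A (affine_connection V B Z) c p
      = frechet_derivative (\<lambda>y. frechet_derivative (Z c \<circ> chart_inv c) (at y)
      ((B c \<circ> chart_inv c) y)) (at (snd c p)) (A c p)"
      if "B \<in> vector_fields M V" for A B :: "('p, 'n) vfield"
    proof -
      have "\<forall>\<^sub>F y in nhds (snd c p). (affine_connection V B Z c \<circ> chart_inv c) y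
        = frechet_derivative (Z c \<circ> chart_inv c) (at y) ((B c \<circ> chart_inv c) y)"
        using eventually_chart[OF c V p] 
        by eventually_elim (simp add: affine_connection_apply[OF V that Z] c coord_deriv_def)
      from frechet_derivative_cong_ev[OF this] show ?thesis by (simp add: coord_deriv_def o_def)
    qed
    have "frechet_derivative (\<lambda>y. frechet_derivative (Z c \<circ> chart_inv c) (at y)
      ((Y c \<circ> chart_inv c) y)) (at (snd c p)) ((X c \<circ> chart_inv c) (snd c p))
       - frechet_derivative (\<lambda>y. frechet_derivative (Z c \<circ> chart_inv c) (at y)
       ((X c \<circ> chart_inv c) y)) (at (snd c p)) ((Y c \<circ> chart_inv c) (snd c p))
       = frechet_derivative (Z c \<circ> chart_inv c) (at (snd c p))
       (frechet_derivative (Y c \<circ> chart_inv c) (at (snd c p)) ((X c \<circ> chart_inv c) (snd c p)) 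
           - frechet_derivative (X c \<circ> chart_inv c) (at (snd c p)) ((Y c \<circ> chart_inv c) (snd c p)))"
      using p by (intro directional_derivative_commutator[OF open_image[OF c V] _
        vector_fieldsD(1)[OF X c] vector_fieldsD(1)[OF Y c] vector_fieldsD(1)[OF Z c]]) auto
    then show ?thesis
      using True
      by (simp add: vf_diff_def affine_connection_apply[OF V X affine_connection_in[OF V Y Z]]
        affine_connection_apply[OF V Y affine_connection_in[OF V X Z]] affine_connection_apply[OF V
        XY Z] *[OF X] *[OF Y])
        (simp add: coord_deriv_def lie_bracket_def)
  qed
qed

end

section \<open>Constant frames of a chart\<close>

context affine_manifold
begin

text \<open>Since transition derivatives are locally constant, a coordinate vector that is constant
  in \<open>c\<close> has locally constant components in every chart. This makes the field
  holomorphic and parallel for the affine connection.\<close>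

definition const_field :: "('p, 'n) chart \<Rightarrow> complex^'n \<Rightarrow> ('p, 'n) vfield" where
  "const_field c u = (\<lambda>d p. if d \<in> atlas M \<and> p \<in> fst c \<inter> fst d then transition_deriv c d p u else
  0)"

lemma const_field_self: "c \<in> atlas M \<Longrightarrow> p \<in> fst c \<Longrightarrow> const_field c u c p = u"
  by (simp add: const_field_def transition_deriv_self)

lemma const_field_eventually:
  assumes c: "c \<in> atlas M" and d: "d \<in> atlas M" and p: "p \<in> fst c \<inter> fst d"
  shows "\<forall>\<^sub>F y in nhds (snd d p). (const_field c u d \<circ> chart_inv d) y = transition_deriv c d p u"
proof -
  obtain L v where L: "\<forall>\<^sub>F y in nhds (snd c p). (snd d \<circ> chart_inv c) y = L *v y + v"
    "L *v snd c p + v = snd d p" "transition_deriv c d p = (*v) L"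
    "\<forall>\<^sub>F y in nhds (snd c p). transition_deriv c d (chart_inv c y) = (*v) L"
    by (rule transition_obtain[OF c d p])
  have "p \<in> fst d \<inter> fst c" using p by blast
  from eventually_transition[OF d c this L(4)] eventually_chart[OF d chart_open[OF c] this]
  show ?thesis
  proof eventually_elim
    case (elim y)
    moreover have "chart_inv c (snd c (chart_inv d y)) = chart_inv d y"
      using elim(2) c by (intro chart_inv_chart) auto
    ultimately show ?case using d by (simp add: const_field_def L(3))
  qed
qed

lemma const_field_in:
  assumes c: "c \<in> atlas M"
  shows "const_field c u \<in> vector_fields M (fst c)"
proof (rule vector_fieldsI)
  fix d assume d: "d \<in> atlas M"
  show "holomorphic_map (const_field c u d \<circ> chart_inv d) (snd d ` (fst d \<inter> fst c))"
  proof (rule holomorphic_mapI)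
    fix x assume "x \<in> snd d ` (fst d \<inter> fst c)"
    then obtain p where p: "p \<in> fst c \<inter> fst d" "x = snd d p" by blast
    have "\<forall>\<^sub>F y in nhds x. transition_deriv c d p u = (const_field c u d \<circ> chart_inv d) y"
      using const_field_eventually[OF c d p(1), of u] unfolding p(2) by eventually_elim simp
    then show "holomorphic_map (const_field c u d \<circ> chart_inv d) {x}"
      by (rule holomorphic_map_cong_ev[OF _ holomorphic_map_const])
  qed
next
  show "const_field c u e p = transition_deriv d e p (const_field c u d p)"
    if "d \<in> atlas M" "e \<in> atlas M" "p \<in> fst d" "p \<in> fst e" "p \<in> fst c" for d e p
    using that c by (simp add: const_field_def transition_deriv_trans)
qed (auto simp: const_field_def)

text \<open>In another chart \<open>d\<close> the function is the component in \<open>c\<close>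
  composed with the affine coordinate change. The condition \<open>W \<subseteq> fst c\<close> keeps
  away from points where \<open>X c\<close> has its default value 0.\<close>

lemma component_holomorphic:
  assumes c: "c \<in> atlas M" and W: "openin (mtop M) W" "W \<subseteq> fst c" and X: "X \<in> vector_fields M W"
  shows "holomorphic_function_on M W (\<lambda>p. X c p $ i)"
  unfolding holomorphic_function_on_def
proof
  fix d assume d: "d \<in> atlas M"
  have "holomorphic_map (X c \<circ> chart_inv d) (snd d ` (fst d \<inter> W))"
  proof (rule holomorphic_mapI)
    fix x assume "x \<in> snd d ` (fst d \<inter> W)"
    then obtain p where p: "p \<in> fst d" "p \<in> W" "x = snd d p" by blast
    then have pc: "p \<in> fst d \<inter> fst c" using W by blast
    obtain L v where L: "\<forall>\<^sub>F y in nhds (snd d p). (snd c \<circ> chart_inv d) y = L *v y + v"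
      "L *v snd d p + v = snd c p" "transition_deriv d c p = (*v) L"
      "\<forall>\<^sub>F y in nhds (snd d p). transition_deriv d c (chart_inv d y) = (*v) L"
      by (rule transition_obtain[OF d c pc])
    have "holomorphic_map (X c \<circ> chart_inv c) {L *v x + v}"
      by (rule holomorphic_map_subset[OF vector_fieldsD(1)[OF X c]]) (use p pc L(2) in auto)
    then have h: "holomorphic_map (\<lambda>y. (X c \<circ> chart_inv c) (L *v y + v)) {x}"
      by (rule holomorphic_map_affine_compose)
    have "\<forall>\<^sub>F y in nhds x. (X c \<circ> chart_inv c) (L *v y + v) = (X c \<circ> chart_inv d) y"
      using L(1) eventually_chart[OF d chart_open[OF c] pc] unfolding p(3)
    proof eventually_elim
      case (elim y)
      moreover have "chart_inv c (snd c (chart_inv d y)) = chart_inv d y"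
        using elim(2) c by (intro chart_inv_chart) auto
      ultimately show ?case by simp
    qed
    then show "holomorphic_map (X c \<circ> chart_inv d) {x}"
      using h by (rule holomorphic_map_cong_ev)
  qed
  then show "holomorphic_fun ((\<lambda>p. X c p $ i) \<circ> chart_inv d) (snd d ` (fst d \<inter> W))"
    by (simp add: holomorphic_map_iff o_def)
qed

end

section \<open>Christoffel symbols of an arbitrary holomorphic connection\<close>

locale affine_manifold_connection = affine_manifold M for M :: "('p, 'n::finite) cmfd" +
  fixes D :: "('p, 'n) connection"
  assumes connection: "holomorphic_connection M D"
begin

lemma D_in: 
  assumes "openin (mtop M) V" "X \<in> vector_fields M V" "Y \<in> vector_fields M V"
  shows "D V X Y \<in> vector_fields M V"
proof -
  have D: "D \<in> (\<Pi>\<^sub>E V\<in>{V. openin (mtop M) V}.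
            vector_fields M V \<rightarrow>\<^sub>E vector_fields M V \<rightarrow>\<^sub>E vector_fields M V)"
    using connection unfolding holomorphic_connection_def by (rule conjunct1)
  from PiE_mem[OF PiE_mem[OF PiE_mem[OF D]]] assms show ?thesis by blast
qed

lemma D_restrict:
  assumes "openin (mtop M) V" "openin (mtop M) W" "W \<subseteq> V" "X \<in> vector_fields M V"
    "Y \<in> vector_fields M V"
  shows "D W (vf_restrict W X) (vf_restrict W Y) = vf_restrict W (D V X Y)"
  using connection[unfolded holomorphic_connection_def, THEN conjunct2, THEN conjunct1, THEN spec,
    THEN spec, THEN mp, of V W] assms
  by simp

lemmas D_rules = connection[unfolded holomorphic_connection_def, THEN conjunct2, THEN conjunct2,
  THEN spec, THEN mp]

lemma D_add:
  assumes "openin (mtop M) V" "X \<in> vector_fields M V" "Y \<in> vector_fields M V"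
    "Z \<in> vector_fields M V"
  shows "D V (vf_add X Y) Z = vf_add (D V X Z) (D V Y Z)"
    "D V Z (vf_add X Y) = vf_add (D V Z X) (D V Z Y)"
  using D_rules[OF assms(1), THEN conjunct1] D_rules[OF assms(1), THEN conjunct2, THEN conjunct1]
    assms
  by simp_all

lemma D_scale:
  assumes "openin (mtop M) V" "X \<in> vector_fields M V" "Y \<in> vector_fields M V"
    "holomorphic_function_on M V f"
  shows "D V (vf_scale f X) Y = vf_scale f (D V X Y)"
    and "c \<in> atlas M \<Longrightarrow> p \<in> fst c \<inter> V \<Longrightarrow> D V X (vf_scale f Y) c p = fun_deriv X f c p *s Y c p
      + f p *s D V X Y c p"
  using D_rules[OF assms(1), THEN conjunct2, THEN conjunct2, THEN spec, THEN mp, OF assms(4), THEN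
    bspec, OF assms(2),
    THEN bspec, OF assms(3)]
  by simp_all

lemma zero_field_in: "openin (mtop M) V \<Longrightarrow> (\<lambda>c p. 0) \<in> vector_fields M V"
  by (rule vector_fieldsI) (auto simp: o_def holomorphic_map_const transition_deriv_linear)

lemma sum_field_in:
  assumes "openin (mtop M) V" "finite I" "\<And>i. i \<in> I \<Longrightarrow> F i \<in> vector_fields M V"
  shows "(\<lambda>c p. \<Sum>i\<in>I. F i c p) \<in> vector_fields M V"
  using assms(2,3)
proof (induction I rule: finite_induct)
  case empty
  then show ?case using zero_field_in[OF assms(1)] by simp
next
  case (insert i I)
  then show ?case
    using vf_add_in[OF assms(1), of "F i" "\<lambda>c p. \<Sum>i\<in>I. F i c p"] by (simp add: vf_add_def)
qed

lemma D_sum: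
  assumes V: "openin (mtop M) V" and I: "finite I" and F: "\<And>i. i \<in> I \<Longrightarrow> F i \<in> vector_fields M V"
    and Y: "Y \<in> vector_fields M V"
  shows "D V (\<lambda>c p. \<Sum>i\<in>I. F i c p) Y c p = (\<Sum>i\<in>I. D V (F i) Y c p)"
    and "D V Y (\<lambda>c p. \<Sum>i\<in>I. F i c p) c p = (\<Sum>i\<in>I. D V Y (F i) c p)"
proof -
  have "D V (\<lambda>c p. \<Sum>i\<in>I. F i c p) Y c p = (\<Sum>i\<in>I. D V (F i) Y c p) \<and>
    D V Y (\<lambda>c p. \<Sum>i\<in>I. F i c p) c p = (\<Sum>i\<in>I. D V Y (F i) c p)"
    using I F
  proof (induction I rule: finite_induct)
    case empty
    have z: "vf_add (\<lambda>c p. 0) (\<lambda>c p. 0) = ((\<lambda>c p. 0) :: ('p, 'n) vfield)" by (simp add: vf_add_def)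
    note zf = zero_field_in[OF V]
    \<comment> \<open>Additivity applied to \<open>0 + 0\<close> yields the zero law.\<close>
    have "D V (\<lambda>c p. 0) Y c p = D V (\<lambda>c p. 0) Y c p + D V (\<lambda>c p. 0) Y c p"
      using fun_cong[OF fun_cong[OF D_add(1)[OF V zf zf Y]], of c p] unfolding z
        by (simp add: vf_add_def)
    moreover have "D V Y (\<lambda>c p. 0) c p = D V Y (\<lambda>c p. 0) c p + D V Y (\<lambda>c p. 0) c p"
      using fun_cong[OF fun_cong[OF D_add(2)[OF V zf zf Y]], of c p] unfolding z
        by (simp add: vf_add_def)
    ultimately show ?case by simp
  next
    case (insert i I)
    let ?S = "\<lambda>c p. \<Sum>i\<in>I. F i c p"
    have s: "?S \<in> vector_fields M V" using insert V by (intro sum_field_in) auto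
    have e: "(\<lambda>c p. \<Sum>i\<in>insert i I. F i c p) = vf_add (F i) ?S"
      using insert by (simp add: vf_add_def)
    have i: "F i \<in> vector_fields M V" using insert by simp
    have IH: "D V ?S Y c p = (\<Sum>i\<in>I. D V (F i) Y c p) \<and> D V Y ?S c p = (\<Sum>i\<in>I. D V Y (F i) c p)"
      using insert by blast
    show ?case
      unfolding e D_add[OF V i s Y] using insert.hyps IH by (simp add: vf_add_def)
  qed
  then show "D V (\<lambda>c p. \<Sum>i\<in>I. F i c p) Y c p = (\<Sum>i\<in>I. D V (F i) Y c p)"
    "D V Y (\<lambda>c p. \<Sum>i\<in>I. F i c p) c p = (\<Sum>i\<in>I. D V Y (F i) c p)" by blast+
qed

definition christoffel :: "('p, 'n) chart \<Rightarrow> 'p \<Rightarrow> 'n \<Rightarrow> 'n \<Rightarrow> complex^'n" where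
  "christoffel c p i j = D (fst c) (const_field c (axis i 1)) (const_field c (axis j 1)) c p"

text \<open>In the coordinates of \<open>c\<close> this bilinear map is the difference between
  \<open>D\<close> and the affine connection at \<open>p\<close>; see
  \<open>connection_eq\<close>.\<close>

definition christoffel_map :: "('p, 'n) chart \<Rightarrow> 'p \<Rightarrow> complex^'n \<Rightarrow> complex^'n \<Rightarrow> complex^'n" where
  "christoffel_map c p u v = (\<Sum>i\<in>UNIV. \<Sum>j\<in>UNIV. (u $ i * v $ j) *s christoffel c p i j)"

lemma christoffel_holomorphic:
  assumes c: "c \<in> atlas M"
  shows "holomorphic_map (\<lambda>y. christoffel c (chart_inv c y) i j) (snd c ` fst c)"
  using vector_fieldsD(1)[OF D_in[OF chart_open[OF c] const_field_in[OF c] const_field_in[OF c]] c]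
  by (simp add: christoffel_def o_def)

text \<open>On \<open>W\<close>, the part of \<open>V\<close> inside the chart, both fields are
  combinations of the constant frame with holomorphic coefficients. Linearity over functions in
  \<open>X\<close> and the Leibniz rule in \<open>Y\<close> leave the derivatives of the
  coefficients of \<open>Y\<close>, which form \<open>coord_deriv\<close>, and the values of
  \<open>D\<close> on the frame.\<close>

lemma connection_eq:
  assumes c: "c \<in> atlas M" and V: "openin (mtop M) V" and p: "p \<in> fst c \<inter> V"
    and X: "X \<in> vector_fields M V" and Y: "Y \<in> vector_fields M V"
  shows "D V X Y c p = coord_deriv X Y c p + christoffel_map c p (X c p) (Y c p)"
proof -
  define W where "W = fst c \<inter> V"
  have W: "openin (mtop M) W" "W \<subseteq> V" "W \<subseteq> fst c" "p \<in> W"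
    using V chart_open[OF c] p by (auto simp: W_def)
  define E where "E = (\<lambda>i. vf_restrict W (const_field c (axis i 1)))"
  have E: "E i \<in> vector_fields M W" for i
    unfolding E_def by (rule vf_restrict_in[OF chart_open[OF c] W(1,3) const_field_in[OF c]])
  have Ecp: "E i c q = axis i 1" if "q \<in> W" for i q
    using that W by (auto simp: E_def vf_restrict_def const_field_self[OF c])
  \<comment> \<open>The expansion is needed in every chart \<open>d\<close>, not only in
    \<open>c\<close>: the coefficients are the components in \<open>c\<close>, and the frame carries
    the transition derivative.\<close>
  have expand: "vf_restrict W Z = (\<lambda>d q. \<Sum>i\<in>UNIV. vf_scale (\<lambda>q. vf_restrict W Z c q $ i) (E i) d q)"
    if Z: "Z \<in> vector_fields M V" for Z
  proof (intro ext)
    fix d q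
    show "vf_restrict W Z d q = (\<Sum>i\<in>UNIV. vf_scale (\<lambda>q. vf_restrict W Z c q $ i) (E i) d q)"
    proof (cases "d \<in> atlas M \<and> q \<in> fst d \<inter> W")
      case True
      then have q: "q \<in> fst c \<inter> fst d" "q \<in> V" "q \<in> W" and d: "d \<in> atlas M" using W by auto
      have "Z d q = transition_deriv c d q (\<Sum>i\<in>UNIV. Z c q $ i *s axis i 1)"
        using vector_fieldsD(2)[OF Z c d, of q] q by (simp add: basis_expansion)
      also have "\<dots> = (\<Sum>i\<in>UNIV. Z c q $ i *s transition_deriv c d q (axis i 1))"
        by (simp add: transition_deriv_linear[OF c d q(1)])
      finally show ?thesis using q d by (simp add: vf_restrict_def vf_scale_def E_def
        const_field_def)
    next
      case False
      then have "vf_restrict W Z d q = 0" "E i d q = 0" for i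
        using vector_fieldsD(3)[OF vf_restrict_in[OF V W(1,2) Z]] vector_fieldsD(3)[OF E] by blast+
      then show ?thesis by (simp add: vf_scale_def)
    qed
  qed
  let ?X = "vf_restrict W X" and ?Y = "vf_restrict W Y"
  have XW: "?X \<in> vector_fields M W" and YW: "?Y \<in> vector_fields M W"
    using vf_restrict_in[OF V W(1,2)] X Y by auto
  have fX: "holomorphic_function_on M W (\<lambda>q. ?X c q $ i)"
    and fY: "holomorphic_function_on M W (\<lambda>q. ?Y c q $ i)" for i
    using component_holomorphic[OF c W(1,3)] XW YW by auto
  have pW: "p \<in> fst c \<inter> W" using W by auto
  have Xp: "?X c p = X c p" "?Y c p = Y c p" using W by (auto simp: vf_restrict_def)
  define DY where "DY = frechet_derivative (?Y c \<circ> chart_inv c) (at (snd c p))"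
  have hY: "((?Y c \<circ> chart_inv c) has_derivative DY) (at (snd c p))"
    and sY: "DY (k *s u) = k *s DY u" for k u
    unfolding DY_def using coord_deriv_has_derivative[OF W(1) YW c pW] by auto
  have EE: "D W (E i) (E j) c p = christoffel c p i j" for i j
    unfolding E_def D_restrict[OF chart_open[OF c] W(1,3) const_field_in[OF c] const_field_in[OF c]]
    using W by (simp add: vf_restrict_def christoffel_def)
  have EY: "D W (E i) ?Y c p = DY (axis i 1) + (\<Sum>j\<in>UNIV. Y c p $ j *s christoffel c p i j)" for i
  proof -
    have fd: "fun_deriv (E i) (\<lambda>q. ?Y c q $ j) c p = DY (axis i 1) $ j" for j
    proof -
      have "((\<lambda>y. (?Y c \<circ> chart_inv c) y $ j) has_derivative (\<lambda>u. DY u $ j)) (at (snd c p))"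
        using hY by (simp add: has_derivative_vec_iff)
      from frechet_derivative_at[OF this, THEN fun_cong, symmetric] show ?thesis
        unfolding fun_deriv_def Ecp[OF W(4)] by (simp add: o_def)
    qed
    have "D W (E i) ?Y c p = (\<Sum>j\<in>UNIV. D W (E i) (vf_scale (\<lambda>q. ?Y c q $ j) (E j)) c p)"
      by (subst expand[OF Y]) (rule D_sum(2)[OF W(1) finite vf_scale_in[OF W(1) E fY] E])
    also have "\<dots> = (\<Sum>j\<in>UNIV. DY (axis i 1) $ j *s axis j 1 + Y c p $ j *s christoffel c p i j)"
      by (simp add: D_scale(2)[OF W(1) E E fY c pW] fd EE Ecp W Xp)
    also have "\<dots> = DY (axis i 1) + (\<Sum>j\<in>UNIV. Y c p $ j *s christoffel c p i j)"
      by (simp add: sum.distrib basis_expansion)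
    finally show ?thesis .
  qed
  have "D V X Y c p = vf_restrict W (D V X Y) c p" using W by (simp add: vf_restrict_def)
  also have "\<dots> = D W ?X ?Y c p" by (simp add: D_restrict[OF V W(1,2) X Y])
  also have "\<dots> = (\<Sum>i\<in>UNIV. D W (vf_scale (\<lambda>q. ?X c q $ i) (E i)) ?Y c p)"
    by (subst expand[OF X]) (rule D_sum(1)[OF W(1) finite vf_scale_in[OF W(1) E fX] YW])
  also have "\<dots> = (\<Sum>i\<in>UNIV. X c p $ i *s (DY (axis i 1) + (\<Sum>j\<in>UNIV. Y c p $ j *s christoffel c p i
    j)))"
    unfolding D_scale(1)[OF W(1) E YW fX] using EY by (simp add: vf_scale_def Xp)
  also have "\<dots> = DY (\<Sum>i\<in>UNIV. X c p $ i *s axis i 1) + christoffel_map c p (X c p) (Y c p)"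
    by (simp add: linear_sum[OF has_derivative_linear[OF hY]] sY christoffel_map_def
      vector_add_ldistrib sum.distrib
        vec.scale_sum_right)
  also have "DY (\<Sum>i\<in>UNIV. X c p $ i *s axis i 1) = coord_deriv X Y c p"
  proof -
    have "\<forall>\<^sub>F y in nhds (snd c p). (?Y c \<circ> chart_inv c) y = (Y c \<circ> chart_inv c) y"
      using eventually_chart[OF c W(1) pW] by eventually_elim (simp add: vf_restrict_def)
    from frechet_derivative_cong_ev[OF this] show ?thesis
      unfolding DY_def coord_deriv_def basis_expansion by (simp add: o_def)
  qed
  finally show ?thesis .
qed

text \<open>For general charts the symbols would pick up second derivatives of the coordinate
  change. Here the test fields are constant near \<open>p\<close> in both charts, so
  \<open>coord_deriv\<close> vanishes on either side and only the transformation law of the vector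
  field \<open>D (fst c) ?X ?Y\<close> remains.\<close>

lemma christoffel_map_tensor:
  assumes c: "c \<in> atlas M" and d: "d \<in> atlas M" and p: "p \<in> fst c \<inter> fst d"
  shows "christoffel_map d p (transition_deriv c d p u) (transition_deriv c d p v)
       = transition_deriv c d p (christoffel_map c p u v)"
proof -
  have pc: "p \<in> fst c \<inter> fst c" and pd: "p \<in> fst d \<inter> fst c" using p by auto
  note V = chart_open[OF c]
  let ?X = "const_field c u" and ?Y = "const_field c v"
  note X = const_field_in[OF c, of u] and Y = const_field_in[OF c, of v]
  have z: "coord_deriv ?X ?Y e p = 0" if e: "e \<in> atlas M" and pe: "p \<in> fst c \<inter> fst e" for e
    using frechet_derivative_cong_ev[OF const_field_eventually[OF c e pe, of v]]
    unfolding coord_deriv_def by (simp add: o_def)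
  have "christoffel_map d p (?X d p) (?Y d p) = D (fst c) ?X ?Y d p"
    using connection_eq[OF d V pd X Y] z[OF d p] by simp
  also have "\<dots> = transition_deriv c d p (D (fst c) ?X ?Y c p)"
    using vector_fieldsD(2)[OF D_in[OF V X Y] c d, of p] p by auto
  also have "D (fst c) ?X ?Y c p = christoffel_map c p u v"
    using connection_eq[OF c V pc X Y] z[OF c pc] pc by (simp add: const_field_self[OF c])
  finally show ?thesis using d p by (simp add: const_field_def)
qed

text \<open>Vanishing symbols settle the values on vector fields over open sets. The case
  distinctions treat all other arguments, where the extensional function spaces force both sides to
  be \<open>undefined\<close>.\<close>

lemma eq_affine_connection:
  assumes 0: "\<And>c p u v. c \<in> atlas M \<Longrightarrow> p \<in> fst c \<Longrightarrow> christoffel_map c p u v = 0"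
  shows "D = affine_connection"
proof (intro ext)
  fix V X Y c p
  have D: "D \<in> (\<Pi>\<^sub>E V\<in>{V. openin (mtop M) V}.
            vector_fields M V \<rightarrow>\<^sub>E vector_fields M V \<rightarrow>\<^sub>E vector_fields M V)"
    using connection unfolding holomorphic_connection_def by (rule conjunct1)
  show "D V X Y c p = affine_connection V X Y c p"
  proof (cases "openin (mtop M) V")
    case False
    then show ?thesis using PiE_arb[OF D] by (simp add: affine_connection_def)
  next
    case V: True
    have DV: "D V \<in> vector_fields M V \<rightarrow>\<^sub>E vector_fields M V \<rightarrow>\<^sub>E vector_fields M V"
      using PiE_mem[OF D] V by simp
    show ?thesis
    proof (cases "X \<in> vector_fields M V")
      case False
      then show ?thesis using PiE_arb[OF DV] V by (simp add: affine_connection_def)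
    next
      case X: True
      show ?thesis
      proof (cases "Y \<in> vector_fields M V")
        case False
        then show ?thesis using PiE_arb[OF PiE_mem[OF DV X]] V X
          by (simp add: affine_connection_def)
      next
        case Y: True
        show ?thesis
          using connection_eq[OF _ V _ X Y, of c p] 0[of c p] vector_fieldsD(3)[OF D_in[OF V X Y],
            of c p]
          by (auto simp: affine_connection_apply[OF V X Y])
      qed
    qed
  qed
qed

end

section \<open>Quotients by affine maps\<close>

text \<open>Freeness and discontinuity of the action enter as local injectivity of the orbit map.
  Open sets on which it is injective are the slices below; their images are the chart domains of the
  quotient.\<close>

locale affine_quotient =
  fixes A :: "(complex^'n::finite) set" and G :: "(complex^'n \<Rightarrow> complex^'n) set"
  assumes open_A: "open A"
    and id_in: "id \<in> G"
    and comp_in: "g \<in> G \<Longrightarrow> h \<in> G \<Longrightarrow> g \<circ> h \<in> G"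
    and inverse_in: "g \<in> G \<Longrightarrow> \<exists>h\<in>G. h \<circ> g = id \<and> g \<circ> h = id"
    and affine: "g \<in> G \<Longrightarrow> \<exists>L v. g = (\<lambda>x. L *v x + v)"
    and invariant: "g \<in> G \<Longrightarrow> x \<in> A \<Longrightarrow> g x \<in> A"
    and locally_injective: "x \<in> A \<Longrightarrow> \<exists>W. open W \<and> x \<in> W \<and> W \<subseteq> A \<and> inj_on (orbit_map G) W"
begin

abbreviation \<pi> :: "complex^'n \<Rightarrow> (complex^'n) set" where "\<pi> \<equiv> orbit_map G"

abbreviation Q :: "((complex^'n) set, 'n) cmfd" where "Q \<equiv> quotient_cmfd A G"

definition slice :: "(complex^'n) set \<Rightarrow> bool" where
  "slice W \<longleftrightarrow> open W \<and> W \<subseteq> A \<and> inj_on \<pi> W"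

definition slice_chart :: "(complex^'n) set \<Rightarrow> ((complex^'n) set, 'n) chart" where
  "slice_chart W = (\<pi> ` W, inv_into W \<pi>)"

lemma continuous_G: assumes "g \<in> G" shows "continuous_on S g"
proof -
  obtain L v where "g = (\<lambda>x. L *v x + v)" using affine[OF assms] by blast
  then show ?thesis
    by (auto intro!: continuous_intros continuous_at_imp_continuous_on has_derivative_continuous[OF
      matrix_vector_mul_has_derivative])
qed

lemma orbit_map_eq_iff: "\<pi> x = \<pi> y \<longleftrightarrow> (\<exists>g\<in>G. y = g x)"
proof
  assume "\<pi> x = \<pi> y"
  moreover have "y \<in> \<pi> y"
    unfolding orbit_map_def by (rule image_eqI[of _ _ id]) (simp_all add: id_in)
  ultimately show "\<exists>g\<in>G. y = g x" unfolding orbit_map_def by blast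
next
  have sub: "\<pi> (g z) \<subseteq> \<pi> z" if "g \<in> G" for g z
  proof
    fix u assume "u \<in> \<pi> (g z)"
    then obtain f where "f \<in> G" "u = (f \<circ> g) z" unfolding orbit_map_def by auto
    then show "u \<in> \<pi> z" unfolding orbit_map_def using comp_in that by blast
  qed
  assume "\<exists>g\<in>G. y = g x"
  then obtain g where g: "g \<in> G" "y = g x" by blast
  obtain h where h: "h \<in> G" "h \<circ> g = id" using inverse_in g by blast
  then have "x = h y" using g(2) by (metis comp_apply id_apply)
  then show "\<pi> x = \<pi> y" using sub[OF g(1), of x] sub[OF h(1), of y] g(2) by simp
qed

lemma orbit_map_G: "g \<in> G \<Longrightarrow> \<pi> (g x) = \<pi> x"
  using orbit_map_eq_iff by metis

lemma open_vimage_G: "g \<in> G \<Longrightarrow> open W \<Longrightarrow> open (g -` W)"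
  using continuous_G by (intro open_vimage)

lemma open_saturation:
  assumes "open W" "W \<subseteq> A"
  shows "open (A \<inter> \<pi> -` (\<pi> ` W))"
proof -
  have "A \<inter> \<pi> -` (\<pi> ` W) = (\<Union>g\<in>G. A \<inter> g -` W)"
  proof (intro equalityI subsetI)
    fix x assume "x \<in> A \<inter> \<pi> -` (\<pi> ` W)"
    then obtain w where "x \<in> A" "w \<in> W" "\<pi> x = \<pi> w" by auto
    then show "x \<in> (\<Union>g\<in>G. A \<inter> g -` W)" using orbit_map_eq_iff[of x w] by auto
  next
    fix x assume "x \<in> (\<Union>g\<in>G. A \<inter> g -` W)"
    then obtain g where "g \<in> G" "x \<in> A" "g x \<in> W" by auto
    then show "x \<in> A \<inter> \<pi> -` (\<pi> ` W)" using orbit_map_G by (metis IntI imageI vimageI)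
  qed
  also have "open \<dots>" using open_A open_vimage_G assms by auto
  finally show ?thesis .
qed

lemma openin_quotient: "openin (mtop Q) V \<longleftrightarrow> V \<subseteq> \<pi> ` A \<and> open (A \<inter> \<pi> -` V)"
proof -
  have "istopology (\<lambda>V. V \<subseteq> \<pi> ` A \<and> open (A \<inter> \<pi> -` V))"
    unfolding istopology_def
  proof (intro conjI allI impI)
    fix S T assume "S \<subseteq> \<pi> ` A \<and> open (A \<inter> \<pi> -` S)" "T \<subseteq> \<pi> ` A \<and> open (A \<inter> \<pi> -` T)"
    moreover have "A \<inter> \<pi> -` (S \<inter> T) = (A \<inter> \<pi> -` S) \<inter> (A \<inter> \<pi> -` T)" by blast
    ultimately show "S \<inter> T \<subseteq> \<pi> ` A" "open (A \<inter> \<pi> -` (S \<inter> T))" by auto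
  next
    fix K assume K: "\<forall>S\<in>K. S \<subseteq> \<pi> ` A \<and> open (A \<inter> \<pi> -` S)"
    have "A \<inter> \<pi> -` (\<Union>K) = (\<Union>S\<in>K. A \<inter> \<pi> -` S)" by blast
    moreover have "open (\<Union>S\<in>K. A \<inter> \<pi> -` S)" by (rule open_UN) (use K in blast)
    ultimately show "open (A \<inter> \<pi> -` (\<Union>K))" by (simp only:)
    show "\<Union>K \<subseteq> \<pi> ` A" using K by blast
  qed
  then show ?thesis
    by (simp add: quotient_cmfd_def openin_open_eq[OF open_A] topology_inverse')
qed

lemma atlas_quotient: "atlas Q = slice_chart ` {W. slice W}"
  by (auto simp: quotient_cmfd_def slice_chart_def slice_def openin_open_eq[OF open_A])

lemma slice_chart_in: "slice W \<Longrightarrow> slice_chart W \<in> atlas Q"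
  by (simp add: atlas_quotient)

lemma fst_slice_chart [simp]: "fst (slice_chart W) = \<pi> ` W"
  by (simp add: slice_chart_def)

lemma snd_slice_chart [simp]: "slice W \<Longrightarrow> y \<in> W \<Longrightarrow> snd (slice_chart W) (\<pi> y) = y"
  by (simp add: slice_chart_def slice_def)

lemma inj_slice_chart: "slice W \<Longrightarrow> inj_on (snd (slice_chart W)) (\<pi> ` W)"
  by (simp add: slice_chart_def inj_on_inv_into)

lemma chart_inv_slice_chart [simp]: 
  assumes "slice W" "y \<in> W" shows "chart_inv (slice_chart W) y = \<pi> y"
  using inv_into_f_f[OF inj_slice_chart[OF assms(1)], of "\<pi> y"] assms
  by (simp add: chart_inv_def)

lemma image_slice_chart: "slice W \<Longrightarrow> snd (slice_chart W) ` (\<pi> ` W \<inter> V) = W \<inter> \<pi> -` V"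
  by (force simp: image_iff)

lemma slice_exists: "x \<in> A \<Longrightarrow> \<exists>W. slice W \<and> x \<in> W"
  using locally_injective unfolding slice_def by blast

text \<open>A slice chart inverts the orbit map, and \<open>\<pi> (g y) = \<pi> y\<close>; so near
  \<open>x\<close> the passage from \<open>W\<close> to \<open>W'\<close> is the group element that
  carries \<open>x\<close> into \<open>W'\<close>.\<close>

lemma slice_transition:
  assumes W: "slice W" "x \<in> W" and W': "slice W'" "g x \<in> W'" and g: "g \<in> G"
  shows "\<forall>\<^sub>F y in nhds x. (snd (slice_chart W') \<circ> chart_inv (slice_chart W)) y = g y"
  unfolding eventually_nhds
proof (intro exI conjI ballI)
  show "open (W \<inter> g -` W')" using W W' open_vimage_G[OF g] by (auto simp: slice_def)
  show "x \<in> W \<inter> g -` W'" using W W' by simp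
  fix y assume "y \<in> W \<inter> g -` W'"
  then show "(snd (slice_chart W') \<circ> chart_inv (slice_chart W)) y = g y"
    using W W' by (simp flip: orbit_map_G[OF g, of y])
qed

sublocale Q: affine_manifold Q
proof
  fix c V assume c: "c \<in> atlas Q"
  then obtain W where W: "slice W" "c = slice_chart W" by (auto simp: atlas_quotient)
  show "openin (mtop Q) (fst c)"
    unfolding openin_quotient W(2) using W(1) open_saturation by (auto simp: slice_def)
  show "inj_on (snd c) (fst c)" using inj_slice_chart W by simp
  assume "openin (mtop Q) V"
  then have "open (W \<inter> (A \<inter> \<pi> -` V))" using W by (auto simp: openin_quotient slice_def)
  moreover have "W \<inter> (A \<inter> \<pi> -` V) = W \<inter> \<pi> -` V" using W by (auto simp: slice_def)
  ultimately show "open (snd c ` (fst c \<inter> V))" using image_slice_chart W by simp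
next
  fix c d p assume c: "c \<in> atlas Q" and d: "d \<in> atlas Q" and p: "p \<in> fst c \<inter> fst d"
  from c obtain W where W: "slice W" "c = slice_chart W" by (auto simp: atlas_quotient)
  from d obtain W' where W': "slice W'" "d = slice_chart W'" by (auto simp: atlas_quotient)
  from p W W' obtain x x' where x: "x \<in> W" "p = \<pi> x" and x': "x' \<in> W'" "p = \<pi> x'" by auto
  then obtain g where g: "g \<in> G" "x' = g x" using orbit_map_eq_iff by metis
  obtain L v where "g = (\<lambda>x. L *v x + v)" using affine[OF g(1)] by blast
  then have "\<And>x. g x = L *v x + v" by simp
  then show "\<exists>L v. \<forall>\<^sub>F y in nhds (snd c p). (snd d \<circ> chart_inv c) y = L *v y + v"
    using slice_transition[OF W(1) x(1) W'(1) _ g(1)] x x' g W W' by auto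
qed

lemma slice_transition_deriv:
  assumes W: "slice W" "x \<in> W" and W': "slice W'" "g x \<in> W'" and g: "g \<in> G" "\<And>x. g x = L *v x + v"
  shows "Q.transition_deriv (slice_chart W) (slice_chart W') (\<pi> x) u = L *v u"
proof -
  have "\<forall>\<^sub>F y in nhds x. (snd (slice_chart W') \<circ> chart_inv (slice_chart W)) y = L *v y + v"
    using slice_transition[OF W W' g(1)] g(2) by simp
  from frechet_derivative_cong_ev[OF this]
    frechet_derivative_at[OF matrix_vector_mul_has_derivative, THEN fun_cong, symmetric]
  show ?thesis using W by (simp add: Q.transition_deriv_def o_def)
qed

lemma slice_transition_deriv_id:
  assumes "slice W" "x \<in> W" "slice W'" "x \<in> W'"
  shows "Q.transition_deriv (slice_chart W) (slice_chart W') (\<pi> x) u = u"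
  using slice_transition_deriv[of W x W' id "mat 1" 0] assms id_in by simp

definition slice_at :: "complex^'n \<Rightarrow> (complex^'n) set" where
  "slice_at x = (SOME W. slice W \<and> x \<in> W)"

lemma slice_at: "x \<in> A \<Longrightarrow> slice (slice_at x)" "x \<in> A \<Longrightarrow> x \<in> slice_at x"
  unfolding slice_at_def using someI_ex[OF slice_exists] by blast+

end

definition bilinear_apply :: "('n::finite \<Rightarrow> 'n \<Rightarrow> complex^'n) \<Rightarrow> complex^'n \<Rightarrow> complex^'n \<Rightarrow> complex^'n"
where
  "bilinear_apply T u v = (\<Sum>i\<in>UNIV. \<Sum>j\<in>UNIV. (u $ i * v $ j) *s T i j)"

lemma bilinear_apply_axis: "bilinear_apply T (axis i 1) (axis j 1) = T i j"
proof -
  have "(axis i 1 $ k * axis j 1 $ l) *s T k l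
    = (if l = j then (if k = i then T k l else 0) else 0)" for k l
    by (simp add: axis_def)
  then show ?thesis unfolding bilinear_apply_def by simp
qed

locale quotient_connection = affine_quotient A G for A :: "(complex^'n::finite) set" and G +
  fixes D :: "((complex^'n) set, 'n) connection"
  assumes connection: "holomorphic_connection (quotient_cmfd A G) D"
begin

sublocale Q: affine_manifold_connection Q D
  by unfold_locales (rule connection)

text \<open>The Christoffel symbols of \<open>D\<close>, lifted to the covering. The slice is an
  arbitrary choice, but two slices around the same \<open>x\<close> differ near \<open>x\<close> by
  the identity, so the value does not depend on it (\<open>christoffel_slice\<close>).\<close>

definition tensor :: "complex^'n \<Rightarrow> 'n \<Rightarrow> 'n \<Rightarrow> complex^'n" where
  "tensor x = Q.christoffel (slice_chart (slice_at x)) (\<pi> x)"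

lemma christoffel_map_slice:
  assumes "slice W" "x \<in> W"
  shows "Q.christoffel_map (slice_chart W) (\<pi> x) u v = bilinear_apply (tensor x) u v"
proof -
  have x: "x \<in> A" using assms by (auto simp: slice_def)
  note s = slice_at[OF x]
  have "Q.christoffel_map (slice_chart (slice_at x)) (\<pi> x) u v
    = Q.christoffel_map (slice_chart W) (\<pi> x) u v"
    using Q.christoffel_map_tensor[OF slice_chart_in[OF assms(1)] slice_chart_in[OF s(1)], of "\<pi>
      x" u v] assms s
    by (simp add: slice_transition_deriv_id)
  then show ?thesis by (simp add: tensor_def Q.christoffel_map_def bilinear_apply_def)
qed

lemma christoffel_slice:
  assumes "slice W" "x \<in> W"
  shows "Q.christoffel (slice_chart W) (\<pi> x) i j = tensor x i j"
  using christoffel_map_slice[OF assms, of "axis i 1" "axis j 1"]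
  unfolding Q.christoffel_map_def bilinear_apply_def[symmetric] bilinear_apply_axis .

lemma tensor_holomorphic: "holomorphic_map (\<lambda>x. tensor x i j) A"
proof (rule holomorphic_mapI)
  fix x assume x: "x \<in> A"
  note s = slice_at[OF x]
  have "holomorphic_map (\<lambda>y. Q.christoffel (slice_chart (slice_at x))
    (chart_inv (slice_chart (slice_at x)) y) i j) {x}"
    by (rule holomorphic_map_subset[OF Q.christoffel_holomorphic[OF slice_chart_in[OF s(1)]]])
      (use s in \<open>force simp: image_iff\<close>)
  moreover have "\<forall>\<^sub>F y in nhds x. Q.christoffel (slice_chart (slice_at x))
    (chart_inv (slice_chart (slice_at x)) y) i j = tensor y i j"
    unfolding eventually_nhds using s
      by (intro exI[of _ "slice_at x"]) (auto simp: slice_def[of "slice_at x"] christoffel_slice)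
  ultimately show "holomorphic_map (\<lambda>x. tensor x i j) {x}"
    by (rule holomorphic_map_cong_ev[rotated])
qed

text \<open>The slices around \<open>x\<close> and around \<open>g x\<close> give two charts at the
  same point of the quotient, with transition derivative \<open>L\<close>. The tensor law of the
  symbols between these charts is the equivariance on the covering.\<close>

lemma tensor_equivariant:
  assumes g: "g \<in> G" "\<And>x. g x = L *v x + v" and x: "x \<in> A"
  shows "bilinear_apply (tensor (g x)) (L *v u) (L *v w) = L *v bilinear_apply (tensor x) u w"
proof -
  note s = slice_at[OF x] and s' = slice_at[OF invariant[OF g(1) x]]
  have "\<pi> (g x) = \<pi> x" by (rule orbit_map_G[OF g(1)])
  then have "\<pi> x \<in> \<pi> ` slice_at x \<inter> \<pi> ` slice_at (g x)" using s s' by (metis IntI imageI)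
  then have "Q.christoffel_map (slice_chart (slice_at (g x))) (\<pi> x) (L *v u) (L *v w)
      = L *v Q.christoffel_map (slice_chart (slice_at x)) (\<pi> x) u w"
    using Q.christoffel_map_tensor[OF slice_chart_in[OF s(1)] slice_chart_in[OF s'(1)], of "\<pi>
      x" u w]
    by (simp add: slice_transition_deriv[OF s s' g])
  then show ?thesis
    using christoffel_map_slice[OF s] christoffel_map_slice[OF s'] orbit_map_G[OF g(1)] by simp
qed

lemma eq_affine_connection_if_tensor_0:
  assumes "\<And>x i j. x \<in> A \<Longrightarrow> tensor x i j = 0"
  shows "D = Q.affine_connection"
proof (rule Q.eq_affine_connection)
  fix c p u v assume c: "c \<in> atlas Q" "p \<in> fst c"
  then obtain W x where W: "slice W" "c = slice_chart W" "x \<in> W" "p = \<pi> x"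
    by (auto simp: atlas_quotient)
  moreover have "x \<in> A" using W by (auto simp: slice_def)
  ultimately show "Q.christoffel_map c p u v = 0"
    using christoffel_map_slice[of W x] assms by (simp add: bilinear_apply_def)
qed

end

section \<open>The trivial connection on the covering and the pull-back\<close>

lemma affine_manifold_open_cmfd:
  assumes "open (A :: (complex^'n::finite) set)"
  shows "affine_manifold (open_cmfd A)"
proof
  fix c d p assume c: "c \<in> atlas (open_cmfd A)" and d: "d \<in> atlas (open_cmfd A)"
    and p: "p \<in> fst c \<inter> fst d"
  have "(snd d \<circ> chart_inv c) y = mat 1 *v y + 0" if "y \<in> A" for y
    using c d that inv_into_f_f[of "\<lambda>x. x" A y] by (simp add: open_cmfd_def chart_inv_def)
  then have "\<forall>\<^sub>F y in nhds (snd c p). (snd d \<circ> chart_inv c) y = mat 1 *v y + 0"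
    using assms p c unfolding eventually_nhds by (intro exI[of _ A]) (auto simp: open_cmfd_def)
  then show "\<exists>L v. \<forall>\<^sub>F y in nhds (snd c p). (snd d \<circ> chart_inv c) y = L *v y + v" by blast
qed (use assms in \<open>auto simp: open_cmfd_def openin_open_eq[OF assms]\<close>)

context affine_quotient
begin

abbreviation P :: "(complex^'n, 'n) cmfd" where "P \<equiv> open_cmfd A"

definition chart0 :: "(complex^'n, 'n) chart" where "chart0 = (A, \<lambda>x. x)"

sublocale P: affine_manifold P by (rule affine_manifold_open_cmfd[OF open_A])

lemma atlas_P: "atlas P = {chart0}" by (simp add: open_cmfd_def chart0_def)

lemma chart0 [simp]: "fst chart0 = A" "snd chart0 x = x" "x \<in> A \<Longrightarrow> chart_inv chart0 x = x"
  using inv_into_f_f[of "\<lambda>x. x" A x] by (auto simp: chart0_def chart_inv_def)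

lemma openin_P: "openin (mtop P) V \<longleftrightarrow> open V \<and> V \<subseteq> A"
  by (simp add: open_cmfd_def openin_open_eq[OF open_A])

lemma topspace_P: "topspace (mtop P) = A"
  by (simp add: open_cmfd_def)

lemma trivial_connection_eq: "trivial_connection A = P.affine_connection"
proof (intro ext)
  fix V X Y c p
  have "V \<subseteq> A" if "openin (mtop P) V" using that openin_P by blast
  then show "trivial_connection A V X Y c p = P.affine_connection V X Y c p"
    by (auto simp: trivial_connection_def P.affine_connection_def restrict_def atlas_P)
qed

text \<open>Read in a slice around \<open>x\<close>, the orbit map is the identity, so relatedness
  says that components agree. Another chart at \<open>\<pi> x\<close> may come from a slice that
  contains only a translate \<open>g x\<close>; there both sides acquire the same matrix
  \<open>L\<close>.\<close>

lemma vf_related_iff: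
  assumes V: "openin (mtop Q) V" and X: "X \<in> vector_fields Q V"
  shows "vf_related P Q \<pi> V X' X \<longleftrightarrow>
    (\<forall>W x. slice W \<and> x \<in> W \<and> \<pi> x \<in> V \<longrightarrow> X' chart0 x = X (slice_chart W) (\<pi> x))"
proof -
  have der: "frechet_derivative (snd (slice_chart W) \<circ> \<pi> \<circ> chart_inv chart0) (at x) u = L *v u"
    if x: "x \<in> A" and W: "slice W" "g x \<in> W" and g: "g \<in> G" "\<And>x. g x = L *v x + v" for x W g L v u
  proof -
    have "\<forall>\<^sub>F y in nhds x. (snd (slice_chart W) \<circ> \<pi> \<circ> chart_inv chart0) y = L *v y + v"
      unfolding eventually_nhds
    proof (intro exI conjI ballI)
      show "open (A \<inter> g -` W)" using open_A open_vimage_G[OF g(1)] W by (auto simp: slice_def)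
      show "x \<in> A \<inter> g -` W" using x W by simp
      fix y assume "y \<in> A \<inter> g -` W"
      then show "(snd (slice_chart W) \<circ> \<pi> \<circ> chart_inv chart0) y = L *v y + v"
        using W by (simp flip: orbit_map_G[OF g(1), of y] g(2))
    qed
    from frechet_derivative_cong_ev[OF this]
      frechet_derivative_at[OF matrix_vector_mul_has_derivative, THEN fun_cong, symmetric]
    show ?thesis by (simp add: o_def)
  qed
  show ?thesis
  proof
    assume R: "vf_related P Q \<pi> V X' X"
    show "\<forall>W x. slice W \<and> x \<in> W \<and> \<pi> x \<in> V \<longrightarrow> X' chart0 x = X (slice_chart W) (\<pi> x)"
    proof (intro allI impI)
      fix W x assume W: "slice W \<and> x \<in> W \<and> \<pi> x \<in> V"
      then have x: "x \<in> A" by (auto simp: slice_def)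
      have "frechet_derivative (snd (slice_chart W) \<circ> \<pi> \<circ> chart_inv chart0) (at x) (X' chart0 x)
        = X (slice_chart W) (\<pi> x)"
        using R W x slice_chart_in[of W] unfolding vf_related_def atlas_P by force
      then show "X' chart0 x = X (slice_chart W) (\<pi> x)"
        using der[OF x, of W id "mat 1" 0 "X' chart0 x"] W id_in by simp
    qed
  next
    assume R: "\<forall>W x. slice W \<and> x \<in> W \<and> \<pi> x \<in> V \<longrightarrow> X' chart0 x = X (slice_chart W) (\<pi> x)"
    show "vf_related P Q \<pi> V X' X"
      unfolding vf_related_def atlas_P
    proof (intro ballI, simp)
      fix d x assume d: "d \<in> atlas Q" and x: "x \<in> A \<and> \<pi> x \<in> fst d \<and> \<pi> x \<in> V"
      from d obtain W where W: "slice W" "d = slice_chart W" by (auto simp: atlas_quotient)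
      with x obtain q where q: "q \<in> W" "\<pi> x = \<pi> q" by auto
      then obtain g where g: "g \<in> G" "q = g x" using orbit_map_eq_iff by metis
      obtain L v where "g = (\<lambda>x. L *v x + v)" using affine[OF g(1)] by blast
      then have L: "\<And>x. g x = L *v x + v" by simp
      have xA: "x \<in> A" using x by simp
      note s = slice_at[OF xA]
      have gW: "g x \<in> W" using q g by simp
      have "X d (\<pi> x) = L *v X (slice_chart (slice_at x)) (\<pi> x)"
        using Q.vector_fieldsD(2)[OF X slice_chart_in[OF s(1)] d, of "\<pi> x"] x s W
          slice_transition_deriv[OF s W(1) gW g(1) L] by simp
      then show "frechet_derivative (snd d \<circ> \<pi> \<circ> chart_inv chart0) (at x) (X' chart0 x) = X d (\<pi> x)"
        using der[OF xA W(1) gW g(1) L] R s x W by simp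
    qed
  qed
qed

text \<open>The representatives of \<open>Y'\<close> and of \<open>Y\<close> in a slice agree in a
  neighbourhood of the point, so their derivatives agree as well.\<close>

lemma affine_connection_related:
  assumes V: "openin (mtop Q) V" and X: "X \<in> vector_fields Q V" and Y: "Y \<in> vector_fields Q V"
    and X': "X' \<in> vector_fields P (A \<inter> \<pi> -` V)" and Y': "Y' \<in> vector_fields P (A \<inter> \<pi> -` V)"
    and RX: "vf_related P Q \<pi> V X' X" and RY: "vf_related P Q \<pi> V Y' Y"
  shows "vf_related P Q \<pi> V (P.affine_connection (A \<inter> \<pi> -` V) X' Y') (Q.affine_connection V X Y)"
  unfolding vf_related_iff[OF V Q.affine_connection_in[OF V X Y]]
proof (intro allI impI)
  fix W x assume W: "slice W \<and> x \<in> W \<and> \<pi> x \<in> V"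
  then have x: "x \<in> A" and sW: "slice W" "x \<in> W" by (auto simp: slice_def)
  have oV: "open (A \<inter> \<pi> -` V)" using V by (simp add: openin_quotient)
  then have V': "openin (mtop P) (A \<inter> \<pi> -` V)" by (simp add: openin_P)
  have "\<forall>\<^sub>F y in nhds x. (Y' chart0 \<circ> chart_inv chart0) y
    = (Y (slice_chart W) \<circ> chart_inv (slice_chart W)) y"
    unfolding eventually_nhds
  proof (intro exI conjI ballI)
    show "open (W \<inter> (A \<inter> \<pi> -` V))" using oV sW by (auto simp: slice_def)
    show "x \<in> W \<inter> (A \<inter> \<pi> -` V)" using W x by simp
    fix y assume "y \<in> W \<inter> (A \<inter> \<pi> -` V)"
    then show "(Y' chart0 \<circ> chart_inv chart0) y = (Y (slice_chart W) \<circ> chart_inv (slice_chart W)) y"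
      using RY sW unfolding vf_related_iff[OF V Y] by simp
  qed
  from frechet_derivative_cong_ev[OF this]
  have "frechet_derivative (Y' chart0 \<circ> chart_inv chart0) (at x)
      = frechet_derivative (Y (slice_chart W) \<circ> chart_inv (slice_chart W)) (at x)"
      by (simp add: o_def)
  moreover have "X' chart0 x = X (slice_chart W) (\<pi> x)"
    using RX W unfolding vf_related_iff[OF V X] by simp
  ultimately show "P.affine_connection (A \<inter> \<pi> -` V) X' Y' chart0 x
    = Q.affine_connection V X Y (slice_chart W) (\<pi> x)"
    using W x slice_chart_in[OF sW(1)]
    by (simp add: P.affine_connection_apply[OF V' X' Y'] Q.affine_connection_apply[OF V X Y] atlas_P
      coord_deriv_def)
qed

definition lift_field :: "(complex^'n) set set \<Rightarrow> ((complex^'n) set, 'n) vfield \<Rightarrow> (complex^'n, 'n)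
vfield" where
  "lift_field V X = (\<lambda>c x. if c = chart0 \<and> x \<in> A \<inter> \<pi> -` V then X (slice_chart (slice_at x)) (\<pi> x)
  else 0)"

lemma lift_field_slice:
  assumes X: "X \<in> vector_fields Q V" and W: "slice W" "x \<in> W" "\<pi> x \<in> V"
  shows "lift_field V X chart0 x = X (slice_chart W) (\<pi> x)"
proof -
  have x: "x \<in> A" using W by (auto simp: slice_def)
  note s = slice_at[OF x]
  show ?thesis
    using Q.vector_fieldsD(2)[OF X slice_chart_in[OF s(1)] slice_chart_in[OF W(1)], of "\<pi> x"] x s W
    by (simp add: lift_field_def slice_transition_deriv_id)
qed

lemma lift_field_related:
  "openin (mtop Q) V \<Longrightarrow> X \<in> vector_fields Q V \<Longrightarrow> vf_related P Q \<pi> V (lift_field V X) X"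
  by (simp add: vf_related_iff lift_field_slice)

lemma lift_field_in:
  assumes V: "openin (mtop Q) V" and X: "X \<in> vector_fields Q V"
  shows "lift_field V X \<in> vector_fields P (A \<inter> \<pi> -` V)"
proof (rule P.vector_fieldsI)
  have oV: "open (A \<inter> \<pi> -` V)" using V by (simp add: openin_quotient)
  have "holomorphic_map (lift_field V X chart0 \<circ> chart_inv chart0) (A \<inter> \<pi> -` V)"
  proof (rule holomorphic_mapI)
    fix x assume x: "x \<in> A \<inter> \<pi> -` V"
    then have xA: "x \<in> A" by simp
    note s = slice_at[OF xA]
    let ?c = "slice_chart (slice_at x)"
    have "holomorphic_map (X ?c \<circ> chart_inv ?c) {x}"
      by (rule holomorphic_map_subset[OF Q.vector_fieldsD(1)[OF X slice_chart_in[OF s(1)]]])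
        (use x s image_slice_chart[OF s(1), of V] in simp)
    moreover have "\<forall>\<^sub>F y in nhds x. (X ?c \<circ> chart_inv ?c) y
      = (lift_field V X chart0 \<circ> chart_inv chart0) y"
      unfolding eventually_nhds
    proof (intro exI conjI ballI)
      show "open (slice_at x \<inter> (A \<inter> \<pi> -` V))" using oV s by (auto simp: slice_def)
      show "x \<in> slice_at x \<inter> (A \<inter> \<pi> -` V)" using x s by simp
      fix y assume "y \<in> slice_at x \<inter> (A \<inter> \<pi> -` V)"
      then show "(X ?c \<circ> chart_inv ?c) y = (lift_field V X chart0 \<circ> chart_inv chart0) y"
        using s lift_field_slice[OF X s(1), of y] by simp
    qed
    ultimately show "holomorphic_map (lift_field V X chart0 \<circ> chart_inv chart0) {x}"
      by (rule holomorphic_map_cong_ev[rotated])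
  qed
  moreover have "snd chart0 ` (fst chart0 \<inter> (A \<inter> \<pi> -` V)) = A \<inter> \<pi> -` V" by auto
  ultimately show "holomorphic_map (lift_field V X c \<circ> chart_inv c)
    (snd c ` (fst c \<inter> (A \<inter> \<pi> -` V)))"
    if "c \<in> atlas P" for c using that by (simp add: atlas_P)
qed (auto simp: atlas_P P.transition_deriv_self lift_field_def)

text \<open>To determine \<open>D'\<close>, it is tested on lifts of the constant fields of a slice.
  These lifts take prescribed values \<open>u\<close>, \<open>v\<close> at \<open>x\<close>, and on
  them \<open>D'\<close> agrees there with the affine connection; hence the Christoffel symbols of
  \<open>D'\<close> vanish at \<open>x\<close>.\<close>

theorem pullback_affine_connection_iff:
  "pullback_connection P Q \<pi> Q.affine_connection D' \<longleftrightarrow> D' = trivial_connection A"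
proof
  assume "D' = trivial_connection A"
  then show "pullback_connection P Q \<pi> Q.affine_connection D'"
    unfolding pullback_connection_def Let_def topspace_P trivial_connection_eq
    using P.affine_connection_holomorphic affine_connection_related by auto
next
  assume pb: "pullback_connection P Q \<pi> Q.affine_connection D'"
  then interpret D': affine_manifold_connection P D'
    by unfold_locales (simp add: pullback_connection_def)
  show "D' = trivial_connection A"
    unfolding trivial_connection_eq
  proof (rule D'.eq_affine_connection)
    fix c x u v assume "c \<in> atlas P" "x \<in> fst c"
    then have c: "c = chart0" and x: "x \<in> A" by (auto simp: atlas_P)
    note s = slice_at[OF x]
    let ?W = "slice_at x" let ?c = "slice_chart ?W" let ?V = "\<pi> ` ?W"
    let ?X = "Q.const_field ?c u" and ?Y = "Q.const_field ?c v"
    note cQ = slice_chart_in[OF s(1)]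
    have V: "openin (mtop Q) ?V" using Q.chart_open[OF cQ] by simp
    have X: "?X \<in> vector_fields Q ?V" and Y: "?Y \<in> vector_fields Q ?V"
      using Q.const_field_in[OF cQ] by auto
    let ?X' = "lift_field ?V ?X" and ?Y' = "lift_field ?V ?Y" and ?V' = "A \<inter> \<pi> -` ?V"
    note X' = lift_field_in[OF V X] and Y' = lift_field_in[OF V Y]
    note RX = lift_field_related[OF V X] and RY = lift_field_related[OF V Y]
    have V': "openin (mtop P) ?V'" using V by (simp add: openin_P openin_quotient)
    have xs: "slice ?W \<and> x \<in> ?W \<and> \<pi> x \<in> ?V" using s by simp
    have "vf_related P Q \<pi> ?V (D' ?V' ?X' ?Y') (Q.affine_connection ?V ?X ?Y)"
      using pb V X Y X' Y' RX RY unfolding pullback_connection_def Let_def topspace_P by blast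
    then have "D' ?V' ?X' ?Y' chart0 x = P.affine_connection ?V' ?X' ?Y' chart0 x"
      using affine_connection_related[OF V X Y X' Y' RX RY] xs
      unfolding vf_related_iff[OF V Q.affine_connection_in[OF V X Y]] by metis
    also have "\<dots> = coord_deriv ?X' ?Y' chart0 x"
      using x s by (simp add: P.affine_connection_apply[OF V' X' Y'] atlas_P)
    finally have "D'.christoffel_map chart0 x (?X' chart0 x) (?Y' chart0 x) = 0"
      using D'.connection_eq[OF _ V' _ X' Y', of chart0 x] x s by (simp add: atlas_P)
    then show "D'.christoffel_map c x u v = 0"
      using lift_field_slice[OF X s] lift_field_slice[OF Y s] s Q.const_field_self[OF cQ]
        by (simp add: c)
  qed
qed

end

section \<open>Holomorphic functions on the universal covering\<close>

text \<open>All generators of the three types have this shape. A real \<open>\<mu> > 0\<close> and a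
  real \<open>s\<close> preserve the half plane, and the shape is stable under composition
  (\<open>tri_comp\<close>).\<close>

definition tri :: "real \<Rightarrow> complex \<Rightarrow> real \<Rightarrow> complex \<Rightarrow> complex \<Rightarrow> complex^2 \<Rightarrow> complex^2" where
  "tri \<mu> \<nu> s b c x = vector [of_real \<mu> * x$1 + of_real s, \<nu> * x$2 + b * x$1 + c]"

lemma tri_vector [simp]:
  "tri \<mu> \<nu> s b c (vector [w, z]) = vector [of_real \<mu> * w + of_real s, \<nu> * z + b * w + c]"
  by (simp add: tri_def)

lemma vector_2_eta: "vector [x $ 1, x $ 2] = (x :: complex^2)"
  by (simp add: vec_eq_iff forall_2)

lemma vector_in_U [simp]: "vector [w, z] \<in> inoue_U \<longleftrightarrow> Im w > 0"
  by (simp add: inoue_U_def)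

lemma tri_in_U: "\<mu> > 0 \<Longrightarrow> x \<in> inoue_U \<Longrightarrow> tri \<mu> \<nu> s b c x \<in> inoue_U"
  by (simp add: inoue_U_def tri_def)

lemma open_U: "open inoue_U"
proof -
  have "inoue_U = (\<lambda>x. x $ 1) -` {w. Im w > 0}" by (auto simp: inoue_U_def)
  also have "open \<dots>" by (intro open_vimage open_halfspace_Im_gt continuous_intros)
  finally show ?thesis .
qed

lemma vector_line: "vector [w, z] = vector [w, 0] + z *s (axis 2 1 :: complex^2)"
  "vector [w, z] = vector [0, z] + w *s (axis 1 1 :: complex^2)"
  by (auto simp: vec_eq_iff forall_2 axis_def)

lemma holomorphic_in_second:
  assumes f: "holomorphic_fun f inoue_U" and w: "Im w > 0"
  shows "((\<lambda>z. f (vector [w, z])) has_field_derivative frechet_derivative f (at (vector [w, z]))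
    (axis 2 1)) (at z)"
  using holomorphic_fun_line_derivative[OF f, of "vector [w, 0]" z "axis 2 1"] w
  by (simp flip: vector_line)

lemma holomorphic_in_first:
  assumes f: "holomorphic_fun f inoue_U" and w: "Im w > 0"
  shows "((\<lambda>w. f (vector [w, z])) has_field_derivative frechet_derivative f (at (vector [w, z]))
    (axis 1 1)) (at w)"
  using holomorphic_fun_line_derivative[OF f, of "vector [0, z]" w "axis 1 1"] w
  by (simp flip: vector_line)

lemma bounded_on_box:
  assumes f: "holomorphic_fun f inoue_U" and y: "y > 0"
  shows "\<exists>B. \<forall>w z. \<bar>Re w - r\<bar> \<le> R1 \<and> Im w = y \<and> cmod z \<le> R2 \<longrightarrow> cmod (f (vector [w, z])) \<le> B"
proof -
  let ?j = "\<lambda>p::real \<times> complex. vector [Complex (fst p) y, snd p] :: complex^2"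
  let ?K = "{r - R1..r + R1} \<times> cball (0::complex) R2"
  have j: "?j = (\<lambda>p. \<chi> i. if i = 1 then of_real (fst p) + \<i> * of_real y else snd p)"
    by (rule ext) (simp add: vec_eq_iff forall_2 complex_eq_iff)
  have "continuous_on ?K ?j"
    unfolding j
  proof (rule continuous_on_vec_lambda)
    show "continuous_on ?K (\<lambda>p. if i = 1 then of_real (fst p) + \<i> * of_real y else snd p)"
      for i :: 2
      by (cases "i = 1") (auto intro!: continuous_intros)
  qed
  moreover have "compact ?K" by (intro compact_Times) auto
  ultimately have "compact (?j ` ?K)" by (rule compact_continuous_image)
  moreover have "?j ` ?K \<subseteq> inoue_U" using y by auto
  ultimately have "compact (f ` ?j ` ?K)"
    by (meson compact_continuous_image continuous_on_subset f holomorphic_fun_continuous_on)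
  then obtain B where B: "\<And>u. u \<in> f ` ?j ` ?K \<Longrightarrow> cmod u \<le> B"
    using compact_imp_bounded[of "f ` ?j ` ?K"] unfolding bounded_iff by blast
  show ?thesis
  proof (intro exI allI impI)
    fix w z assume w': "\<bar>Re w - r\<bar> \<le> R1 \<and> Im w = y \<and> cmod z \<le> R2"
    then have w: "Im w = y" by blast
    have "f (vector [w, z]) = f (?j (Re w, z))" unfolding w[symmetric] by simp
    moreover have "(Re w, z) \<in> ?K" using w' by (auto simp: abs_le_iff)
    ultimately show "cmod (f (vector [w, z])) \<le> B" using B by blast
  qed
qed

text \<open>Recurrence of \<open>f\<close>: the orbits of the unipotent part of the group that start on a vertical
  line return to a compact set.\<close>

definition recurrent :: "(complex^2 \<Rightarrow> complex) \<Rightarrow> bool" where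
  "recurrent f \<longleftrightarrow> (\<forall>w. Im w > 0 \<longrightarrow> (\<exists>R1 R2. \<forall>z. \<exists>w' z'. \<bar>Re w' - Re w\<bar> \<le> R1 \<and> Im w' = Im w \<and>
     cmod z' \<le> R2 \<and> f (vector [w', z']) = f (vector [w, z])))"

lemma recurrent_imp_const_in_second:
  assumes f: "holomorphic_fun f inoue_U" and rec: "recurrent f" and w: "Im w > 0"
  shows "f (vector [w, z]) = f (vector [w, 0])"
proof -
  obtain R1 R2 where R: "\<And>z. \<exists>w' z'. \<bar>Re w' - Re w\<bar> \<le> R1 \<and> Im w' = Im w \<and>
     cmod z' \<le> R2 \<and> f (vector [w', z']) = f (vector [w, z])"
    using rec w unfolding recurrent_def by blast
  obtain B where B: "\<forall>w' z'. \<bar>Re w' - Re w\<bar> \<le> R1 \<and> Im w' = Im w \<and> cmod z' \<le> R2 \<longrightarrow>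
    cmod (f (vector [w', z'])) \<le> B"
    using bounded_on_box[OF f w] by blast
  have "cmod (f (vector [w, z])) \<le> B" for z
    using R[of z] B by metis
  then have "bounded (range (\<lambda>z. f (vector [w, z])))"
    unfolding bounded_iff by blast
  moreover have "(\<lambda>z. f (vector [w, z])) holomorphic_on UNIV"
    using holomorphic_in_second[OF f w]
      by (meson field_differentiable_at_within field_differentiable_def holomorphic_on_def)
  ultimately have "(\<lambda>z. f (vector [w, z])) constant_on UNIV" by (intro Liouville_theorem)
  then show ?thesis unfolding constant_on_def by auto
qed

text \<open>Conjugating the translation by \<open>a\<close> with the \<open>n\<close>-th power of
  the dilation gives the translation by \<open>a / \<mu> ^ n\<close>. The increment \<open>m\<close>
  is kept general: 0 yields periods, and a nonzero value is what \<open>quasi_invariant_zero\<close>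
  excludes.\<close>

lemma scaled_increment:
  fixes h :: "complex \<Rightarrow> complex"
  assumes scale: "\<And>w. Im w > 0 \<Longrightarrow> h (of_real \<mu> * w) = \<xi> * h w" and shift: "\<And>w. Im w > 0 \<Longrightarrow>
    h (w + of_real a) = h w + m"
    and \<mu>: "\<mu> > 1" and \<xi>: "\<xi> \<noteq> 0" and w: "Im w > 0"
  shows "h (w + of_real (a / \<mu> ^ n)) = h w + m / \<xi> ^ n"
proof -
  have pow: "h (of_real (\<mu> ^ n) * v) = \<xi> ^ n * h v" if "Im v > 0" for v
  proof (induction n)
    case (Suc n)
    have "h (of_real (\<mu> ^ Suc n) * v) = h (of_real \<mu> * (of_real (\<mu> ^ n) * v))"
      by (simp add: mult.assoc)
    also have "\<dots> = \<xi> * h (of_real (\<mu> ^ n) * v)" using that \<mu> by (intro scale) simp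
    finally show ?case using Suc by simp
  qed simp
  have "\<xi> ^ n * h (w + of_real (a / \<mu> ^ n)) = h (of_real (\<mu> ^ n) * (w + of_real (a / \<mu> ^ n)))"
    using w by (intro pow[symmetric]) simp
  also have "of_real (\<mu> ^ n) * (w + of_real (a / \<mu> ^ n)) = of_real (\<mu> ^ n) * w + of_real a"
    using \<mu> by (simp add: distrib_left)
  also have "h \<dots> = \<xi> ^ n * h w + m"
    using pow[OF w] shift[of "of_real (\<mu> ^ n) * w"] w \<mu> by simp
  finally show ?thesis using \<xi> by (simp add: field_simps)
qed

lemma shift_tendsto: "\<mu> > (1::real) \<Longrightarrow> (\<lambda>n. w + complex_of_real (a / \<mu> ^ n)) \<longlonglongrightarrow> w"
proof -
  assume "\<mu> > 1"
  then have "(\<lambda>n. a / \<mu> ^ n) \<longlonglongrightarrow> 0" by (intro LIMSEQ_divide_realpow_zero)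
  then have "(\<lambda>n. w + complex_of_real (a / \<mu> ^ n)) \<longlonglongrightarrow> w + of_real 0" by (intro tendsto_intros)
  then show ?thesis by simp
qed

text \<open>The scaling relation turns the period \<open>a\<close> into the periods \<open>a / \<mu>\<^sup>n\<close>, which tend to 0.\<close>

lemma small_periods_imp_const:
  fixes h :: "complex \<Rightarrow> complex"
  assumes der: "\<And>w. Im w > 0 \<Longrightarrow> (h has_field_derivative h' w) (at w)"
    and scale: "\<And>w. Im w > 0 \<Longrightarrow> h (of_real \<mu> * w) = \<xi> * h w" and shift: "\<And>w. Im w > 0 \<Longrightarrow>
      h (w + of_real a) = h w"
    and \<mu>: "\<mu> > 1" and \<xi>: "\<xi> \<noteq> 0" and a: "a \<noteq> 0"
  obtains C where "\<And>w. Im w > 0 \<Longrightarrow> h w = C"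
proof -
  have "h' w = 0" if w: "Im w > 0" for w
  proof -
    have lim: "(\<lambda>n. complex_of_real (a / \<mu> ^ n)) \<longlonglongrightarrow> 0" using shift_tendsto[OF \<mu>, of 0 a] by simp
    have "((\<lambda>k. (h (w + k) - h w) / k) \<longlongrightarrow> h' w) (at 0)"
      using der[OF w] by (simp add: DERIV_def)
    moreover have "filterlim (\<lambda>n. complex_of_real (a / \<mu> ^ n)) (at 0) sequentially"
      using lim a \<mu> by (intro filterlim_atI) auto
    ultimately have "((\<lambda>n. (h (w + of_real (a / \<mu> ^ n)) - h w) / of_real (a / \<mu> ^ n)) \<longlongrightarrow> h' w)
      sequentially"
      by (rule filterlim_compose)
    \<comment> \<open>Every difference quotient along the increments \<open>a / \<mu> ^ n\<close> is
      0, and so is the derivative as their limit.\<close>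
    moreover have "h (w + of_real (a / \<mu> ^ n)) = h w + 0 / \<xi> ^ n" for n
      by (rule scaled_increment[where m = 0]) (use scale shift \<mu> \<xi> w in auto)
    ultimately have "((\<lambda>n. 0 :: complex) \<longlongrightarrow> h' w) sequentially" by simp
    then show ?thesis by (metis LIMSEQ_const_iff)
  qed
  then have "\<exists>C. \<forall>w\<in>{w. Im w > 0}. h w = C"
    using der by (intro has_field_derivative_zero_constant)
      (auto simp: convex_halfspace_Im_gt intro: has_field_derivative_at_within)
  then show thesis using that by blast
qed

text \<open>Once \<open>f\<close> is independent of \<open>z\<close>, the relations descend to the
  variable \<open>w\<close>, where small periods force a constant. A constant that is multiplied by
  \<open>\<xi> \<noteq> 1\<close> can only be 0.\<close>

lemma recurrent_invariant_const:
  assumes f: "holomorphic_fun f inoue_U" and rec: "recurrent f"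
    and inv: "\<And>x. x \<in> inoue_U \<Longrightarrow> f (tri 1 1 a b c x) = f x" and a: "a \<noteq> 0"
    and scale: "\<And>x. x \<in> inoue_U \<Longrightarrow> f (tri \<mu> \<nu> 0 0 t x) = \<xi> * f x" and \<mu>: "\<mu> > 1" and \<xi>: "\<xi> \<noteq> 0"
  shows "\<exists>C. (\<forall>x\<in>inoue_U. f x = C) \<and> (\<xi> \<noteq> 1 \<longrightarrow> C = 0)"
proof -
  note const = recurrent_imp_const_in_second[OF f rec]
  define h where "h = (\<lambda>w. f (vector [w, 0]))"
  have h: "f (vector [w, z]) = h w" if "Im w > 0" for w z unfolding h_def by (rule const[OF that])
  obtain C where C: "\<And>w. Im w > 0 \<Longrightarrow> h w = C"
  proof (rule small_periods_imp_const)
    show "(h has_field_derivative frechet_derivative f (at (vector [w, 0])) (axis 1 1)) (at w)"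
      if "Im w > 0" for w
      unfolding h_def using f that by (rule holomorphic_in_first)
    show "h (of_real \<mu> * w) = \<xi> * h w" if "Im w > 0" for w
      using scale[of "vector [w, 0]"] that \<mu> by (simp add: h)
    show "h (w + of_real a) = h w" if "Im w > 0" for w
      using inv[of "vector [w, 0]"] that by (simp add: h)
  qed (use \<mu> \<xi> a in auto)
  have fC: "f x = C" if "x \<in> inoue_U" for x
    using h[of "x $ 1" "x $ 2"] C that by (simp add: vector_2_eta inoue_U_def)
  have "C = 0" if "\<xi> \<noteq> 1"
  proof -
    note that
    moreover have "vector [\<i>, 0] \<in> inoue_U" by simp
    then have "C = \<xi> * C" using scale[of "vector [\<i>, 0]"] fC tri_in_U[of \<mu> "vector [\<i>, 0]" \<nu> 0 0 t]
      \<mu> by simp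
    ultimately show "C = 0" by simp
  qed
  with fC show ?thesis by blast
qed

section \<open>Iterated triangular maps and the components of an invariant tensor\<close>

lemma tri_comp: "tri \<mu> \<nu> s b c (tri \<mu>' \<nu>' s' b' c' x) =
    tri (\<mu> * \<mu>') (\<nu> * \<nu>') (\<mu> * s' + s) (\<nu> * b' + b * of_real \<mu>') (\<nu> * c' + b * of_real s' + c) x"
  by (simp add: tri_def algebra_simps)

lemma tri_cong: "s = s' \<Longrightarrow> b = b' \<Longrightarrow> c = c' \<Longrightarrow> tri 1 1 s b c x = tri 1 1 s' b' c' x"
  by simp

text \<open>The binomial term comes from \<open>g\<^sup>n\<close> for \<open>g = (w + a, z + b w + c)\<close>.\<close>

lemma invariant_iterate:
  assumes inv: "\<And>x. x \<in> inoue_U \<Longrightarrow> f (tri 1 1 a b c x) = f x" and x: "x \<in> inoue_U"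
  shows "f (tri 1 1 (of_int n * a) (of_int n * b)
     (of_int n * c + of_real a * b * (of_int n * (of_int n - 1) / 2)) x) = f x"
  using x
proof (induction n arbitrary: x rule: int_induct[where k = 0])
  case base
  then show ?case by (simp add: tri_def vector_2_eta)
next
  case (step1 n)
  let ?y = "tri 1 1 (of_int n * a) (of_int n * b) (of_int n * c
  + of_real a * b * (of_int n * (of_int n - 1) / 2)) x"
  have "tri 1 1 a b c ?y = tri 1 1 (of_int (n + 1) * a) (of_int (n + 1) * b) 
     (of_int (n + 1) * c + of_real a * b * (of_int (n + 1) * (of_int (n + 1) - 1) / 2)) x"
    unfolding tri_comp by (simp, rule tri_cong) (simp_all add: field_simps)
  moreover have "?y \<in> inoue_U" using step1 by (intro tri_in_U) auto
  ultimately show ?case using inv[of ?y] step1 by metis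
next
  case (step2 n)
  let ?y = "tri 1 1 (of_int (n - 1) * a) (of_int (n - 1) * b) (of_int (n - 1) * c
  + of_real a * b * (of_int (n - 1) * (of_int (n - 1) - 1) / 2)) x"
  have "tri 1 1 a b c ?y = tri 1 1 (of_int n * a) (of_int n * b) 
     (of_int n * c + of_real a * b * (of_int n * (of_int n - 1) / 2)) x"
    unfolding tri_comp by (simp, rule tri_cong) (simp_all add: field_simps)
  moreover have "?y \<in> inoue_U" using step2 by (intro tri_in_U) auto
  ultimately show ?case using inv[of ?y] step2 by metis
qed

definition tri_matrix :: "real \<Rightarrow> complex \<Rightarrow> complex \<Rightarrow> complex^2^2" where
  "tri_matrix \<mu> \<nu> b = vector [vector [of_real \<mu>, 0], vector [b, \<nu>]]"

lemma tri_affine: "tri \<mu> \<nu> s b c x = tri_matrix \<mu> \<nu> b *v x + vector [of_real s, c]"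
  by (simp add: tri_def tri_matrix_def vec_eq_iff forall_2 matrix_vector_mult_def sum_2
    algebra_simps)

text \<open>The second basis vector is an eigenvector of \<open>tri_matrix\<close>, and the first
  coordinate is an eigenfunctional. Hence \<open>T 2 2 $ 1\<close> satisfies an equation of its own,
  and the others are coupled, through \<open>b\<close>, only to components with more arguments equal
  to 2 or with output index 1. This fixes the order of elimination.\<close>

lemma tensor_tri_components:
  fixes T T' :: "2 \<Rightarrow> 2 \<Rightarrow> complex^2"
  assumes "\<And>u v. bilinear_apply T' (tri_matrix \<mu> \<nu> b *v u) (tri_matrix \<mu> \<nu> b *v v)
    = tri_matrix \<mu> \<nu> b *v bilinear_apply T u v"
  shows "\<nu>\<^sup>2 * T' 2 2 $ 1 = of_real \<mu> * T 2 2 $ 1"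
    and "\<nu>\<^sup>2 * T' 2 2 $ 2 = b * T 2 2 $ 1 + \<nu> * T 2 2 $ 2"
    and "of_real \<mu> * \<nu> * T' 1 2 $ 1 + b * \<nu> * T' 2 2 $ 1 = of_real \<mu> * T 1 2 $ 1"
    and "of_real \<mu> * \<nu> * T' 1 2 $ 2 + b * \<nu> * T' 2 2 $ 2 = b * T 1 2 $ 1 + \<nu> * T 1 2 $ 2"
    and "of_real \<mu> * \<nu> * T' 2 1 $ 1 + b * \<nu> * T' 2 2 $ 1 = of_real \<mu> * T 2 1 $ 1"
    and "of_real \<mu> * \<nu> * T' 2 1 $ 2 + b * \<nu> * T' 2 2 $ 2 = b * T 2 1 $ 1 + \<nu> * T 2 1 $ 2"
    and "(of_real \<mu>)\<^sup>2 * T' 1 1 $ 1 + of_real \<mu> * b * (T' 1 2 $ 1 + T' 2 1 $ 1) + b\<^sup>2 * T' 2 2 $ 1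
      = of_real \<mu> * T 1 1 $ 1"
    and "(of_real \<mu>)\<^sup>2 * T' 1 1 $ 2 + of_real \<mu> * b * (T' 1 2 $ 2 + T' 2 1 $ 2) + b\<^sup>2 * T' 2 2 $ 2
      = b * T 1 1 $ 1 + \<nu> * T 1 1 $ 2"
  using assms[of "axis 1 1" "axis 1 1"] assms[of "axis 1 1" "axis 2 1"] assms[of "axis 2 1"
    "axis 1 1"] assms[of "axis 2 1" "axis 2 1"]
  unfolding bilinear_apply_axis
  by (simp_all add: bilinear_apply_def tri_matrix_def vec_eq_iff forall_2 matrix_vector_mult_def
    sum_2 axis_def algebra_simps power2_eq_square)

definition tensor_invariant ::
    "(complex^2 \<Rightarrow> 2 \<Rightarrow> 2 \<Rightarrow> complex^2) \<Rightarrow> real \<Rightarrow> complex \<Rightarrow> real \<Rightarrow> complex \<Rightarrow> complex \<Rightarrow> bool" where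
  "tensor_invariant T \<mu> \<nu> s b c \<longleftrightarrow> (\<forall>x\<in>inoue_U. \<forall>u v.
     bilinear_apply (T (tri \<mu> \<nu> s b c x)) (tri_matrix \<mu> \<nu> b *v u) (tri_matrix \<mu> \<nu> b *v v)
     = tri_matrix \<mu> \<nu> b *v bilinear_apply (T x) u v)"

lemma tensor_invariantD:
  "tensor_invariant T \<mu> \<nu> s b c \<Longrightarrow> x \<in> inoue_U \<Longrightarrow>
     bilinear_apply (T (tri \<mu> \<nu> s b c x)) (tri_matrix \<mu> \<nu> b *v u) (tri_matrix \<mu> \<nu> b *v v)
     = tri_matrix \<mu> \<nu> b *v bilinear_apply (T x) u v"
  by (simp add: tensor_invariant_def)

lemma abs_frac_mult_le: "\<bar>frac x * a\<bar> \<le> \<bar>a :: real\<bar>"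
  using frac_lt_1[of x] frac_ge_0[of x] by (simp add: abs_mult mult_left_le_one_le)

lemma cmod_frac_mult_le: "cmod (of_real (frac x) * q) \<le> cmod q"
  using frac_lt_1[of x] frac_ge_0[of x] by (simp add: norm_mult mult_left_le_one_le)

subsection \<open>Invariant tensors of type I\<close>

text \<open>Every \<open>z\<close> is a combination of the \<open>b $ i\<close> with real weights
  that annihilate \<open>a\<close>. Removing the integer parts of the weights by lattice
  translations leaves fractional parts, so both coordinates stay within bounds independent of
  \<open>z\<close>.\<close>

lemma recurrent_lattice:
  fixes a :: "real^3" and b :: "complex^3"
  assumes span: "\<And>q. \<exists>x::real^3. (\<Sum>i\<in>UNIV. x $ i * a $ i) = 0 \<and> (\<Sum>i\<in>UNIV. of_real (x $ i) * b $ i)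
    = q"
    and inv: "\<And>i x. x \<in> inoue_U \<Longrightarrow> f (tri 1 1 (a $ i) 0 (b $ i) x) = f x"
  shows "recurrent f"
  unfolding recurrent_def
proof (intro allI impI)
  fix w assume w: "Im w > 0"
  show "\<exists>R1 R2. \<forall>z. \<exists>w' z'. \<bar>Re w' - Re w\<bar> \<le> R1 \<and> Im w' = Im w \<and> cmod z' \<le> R2 \<and> f (vector [w', z'])
    = f (vector [w, z])"
  proof (rule exI, rule exI, rule allI)
    fix z
    obtain x :: "real^3" where x: "x$1 * a$1 + x$2 * a$2 + x$3 * a$3 = 0"
      "of_real (x$1) * b$1 + of_real (x$2) * b$2 + of_real (x$3) * b$3 = z"
      using span[of z] by (auto simp: sum_3)
    have it: "f (tri 1 1 (of_int n * a $ i) 0 (of_int n * b $ i) y) = f y" if "y \<in> inoue_U"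
      for n i y
      using invariant_iterate[of f "a $ i" 0 "b $ i" y n] inv that by simp
    define n where "n = (\<lambda>i. - \<lfloor>x $ i\<rfloor>)"
    have n: "real_of_int (n i) = frac (x $ i) - x $ i" for i by (simp add: n_def frac_def)
    define w' where "w' = w + of_real (of_int (n 1) * a $ 1) + of_real (of_int (n 2) * a $ 2)
      + of_real (of_int (n 3) * a $ 3)"
    define z' where "z' = z + of_int (n 1) * b $ 1 + of_int (n 2) * b $ 2 + of_int (n 3) * b $ 3"
    have "f (vector [w', z']) = f (vector [w, z])"
      using it[of "vector [w, z]" "n 1" 1] it[of "vector [w + of_real (of_int (n 1) * a $ 1), z
        + of_int (n 1) * b $ 1]" "n 2" 2]
        it[of "vector [w + of_real (of_int (n 1) * a $ 1) + of_real (of_int (n 2) * a $ 2), z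
        + of_int (n 1) * b $ 1 + of_int (n 2) * b $ 2]" "n 3" 3] w
      by (simp add: w'_def z'_def)
    moreover have "Re w' - Re w = frac (x$1) * a$1 + frac (x$2) * a$2 + frac (x$3) * a$3"
      using x(1) by (simp add: w'_def n algebra_simps)
    then have "\<bar>Re w' - Re w\<bar> \<le> \<bar>a$1\<bar> + \<bar>a$2\<bar> + \<bar>a$3\<bar>"
      using abs_frac_mult_le[of "x$1" "a$1"] abs_frac_mult_le[of "x$2"
        "a$2"] abs_frac_mult_le[of "x$3" "a$3"] by linarith
    moreover have "z' = of_real (frac (x$1)) * b$1 + of_real (frac (x$2)) * b$2
      + of_real (frac (x$3)) * b$3"
    proof -
      have nn: "of_int (n i) = complex_of_real (frac (x $ i)) - of_real (x $ i)" for i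
        by (metis n of_real_diff of_real_of_int_eq)
      show ?thesis by (simp add: z'_def nn x(2)[symmetric] algebra_simps)
    qed
    then have "cmod z' \<le> cmod (b$1) + cmod (b$2) + cmod (b$3)"
      by (simp only:) (intro order_trans[OF norm_triangle_ineq] add_mono cmod_frac_mult_le)
    ultimately show "\<exists>w' z'. \<bar>Re w' - Re w\<bar> \<le> \<bar>a$1\<bar> + \<bar>a$2\<bar> + \<bar>a$3\<bar> \<and> Im w' = Im w
        \<and> cmod z' \<le> cmod (b$1) + cmod (b$2) + cmod (b$3) \<and> f (vector [w', z']) = f (vector [w, z])"
      by (intro exI[of _ w'] exI[of _ z']) (simp add: w'_def)
  qed
qed

text \<open>The linear parts are diagonal, so the eight equations decouple: each component is
  invariant under the translations and multiplied by \<open>q / p\<close> under \<open>g0\<close>.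
  With \<open>|\<beta>| = \<rho>\<close> and \<open>\<mu> = 1 / \<rho>^2\<close> the moduli of these
  factors are the powers of \<open>\<rho>\<close> with exponents -4, -1, -1, 2, -1, 2, 2, 5, in the
  order of the proof; none of them is 1.\<close>

lemma tensor_zero_I:
  fixes a :: "real^3" and b :: "complex^3" and T :: "complex^2 \<Rightarrow> 2 \<Rightarrow> 2 \<Rightarrow> complex^2"
  assumes \<beta>: "\<beta> \<noteq> 0" "cmod \<beta> < 1"
    and span: "\<And>s q. \<exists>x::real^3. (\<Sum>i\<in>UNIV. x $ i * a $ i) = s \<and> (\<Sum>i\<in>UNIV. of_real (x $ i) * b $ i)
      = q"
    and hol: "\<And>i j. holomorphic_map (\<lambda>x. T x i j) inoue_U"
    and inv: "\<And>i. tensor_invariant T 1 1 (a $ i) 0 (b $ i)"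
    and scale: "tensor_invariant T (1 / (cmod \<beta>)\<^sup>2) \<beta> 0 0 0"
    and x: "x \<in> inoue_U"
  shows "T x i j = 0"
proof -
  define \<rho> where "\<rho> = cmod \<beta>"
  have \<rho>: "0 < \<rho>" "\<rho> < 1" using \<beta> by (auto simp: \<rho>_def)
  define \<mu> where "\<mu> = 1 / \<rho>\<^sup>2"
  have \<mu>: "\<mu> > 1" using \<rho> by (simp add: \<mu>_def power_less_one_iff)
  have \<mu>\<rho>: "\<mu> * \<rho>\<^sup>2 = 1" using \<rho> by (simp add: \<mu>_def)
  \<comment> \<open>Some \<open>a $ l\<close> is nonzero because a real combination of the
    \<open>a $ i\<close> equals 1; it is the real period to be rescaled.\<close>
  obtain l where l: "a $ l \<noteq> 0" using span[of 1 0] by (force simp: sum_3)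
  have zero: "f x = 0"
    if f: "holomorphic_fun f inoue_U" and finv: "\<And>x i. x \<in> inoue_U \<Longrightarrow> f (tri 1 1 (a $ i) 0 (b $ i) x)
      = f x"
      and fs: "\<And>x. x \<in> inoue_U \<Longrightarrow> p * f (tri \<mu> \<beta> 0 0 0 x) = q * f x" and pq: "p \<noteq> 0" "q \<noteq> 0"
        "cmod p \<noteq> cmod q" for f p q
  proof -
    have rec: "recurrent f" by (rule recurrent_lattice[OF span finv])
    have fs': "f (tri \<mu> \<beta> 0 0 0 x) = q / p * f x" if "x \<in> inoue_U" for x
      using fs[OF that] pq by (simp add: field_simps)
    have "q / p \<noteq> 0" "q / p \<noteq> 1" using pq by auto
    from recurrent_invariant_const[OF f rec finv l fs' \<mu> this(1)] this(2) x show "f x = 0" by auto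
  qed
  have comp: "holomorphic_fun (\<lambda>x. T x i j $ k) inoue_U" for i j k
    using hol by (simp add: holomorphic_map_iff)
  note I = tensor_tri_components[OF tensor_invariantD[OF inv], simplified]
  note S = tensor_tri_components[OF tensor_invariantD[OF scale[folded \<rho>_def, folded \<mu>_def]],
    simplified]
  have \<mu>0: "complex_of_real \<mu> \<noteq> 0" using \<mu> by simp
  have n: "cmod (of_real \<mu>) = \<mu>" "cmod \<beta> = \<rho>" using \<mu> by (auto simp: \<rho>_def)
  have lt: "\<rho> * \<rho> < 1" "\<rho> * \<rho> < \<rho>" "\<rho> < \<mu>" "\<mu> < \<mu> * \<mu>" "\<rho> * \<mu> < \<mu>" "1 < \<rho> * \<mu>" "\<rho> * \<rho> < \<mu>"
    "\<rho> < \<mu> * \<mu>"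
  proof -
    show r1: "\<rho> * \<rho> < \<rho>" using \<rho> by simp
    then show r2: "\<rho> * \<rho> < 1" using \<rho> by linarith
    show r3: "\<rho> < \<mu>" using \<rho> \<mu> by linarith
    show r4: "\<mu> < \<mu> * \<mu>" using \<mu> by simp
    show "\<rho> * \<mu> < \<mu>" using \<rho> \<mu> by simp
    have "\<rho> * (\<rho> * \<mu>) = 1" using \<mu>\<rho> by (simp add: power2_eq_square algebra_simps)
    moreover have "\<rho> * (\<rho> * \<mu>) \<le> \<rho> * 1" if "\<rho> * \<mu> \<le> 1" using that \<rho> by (intro mult_left_mono) auto
    ultimately show "1 < \<rho> * \<mu>" using \<rho> by linarith
    show "\<rho> * \<rho> < \<mu>" using r1 r3 by linarith
    show "\<rho> < \<mu> * \<mu>" using r3 r4 by linarith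
  qed
  have "T x 2 2 $ 1 = 0"
    by (rule zero[OF comp, of 2 2 1 "\<beta>\<^sup>2" "of_real \<mu>"])
      (use I(1) S(1) \<beta> \<mu>0 lt in \<open>auto simp: norm_mult n power2_eq_square\<close>)
  moreover have "T x 2 2 $ 2 = 0"
    by (rule zero[OF comp, of 2 2 2 "\<beta>\<^sup>2" "\<beta>"])
      (use I(2) S(2) \<beta> \<mu>0 lt in \<open>auto simp: norm_mult n power2_eq_square\<close>)
  moreover have "T x 1 2 $ 1 = 0"
    by (rule zero[OF comp, of 1 2 1 "of_real \<mu> * \<beta>" "of_real \<mu>"])
      (use I(3) S(3) \<beta> \<mu>0 \<mu> \<rho> lt in \<open>auto simp: norm_mult n power2_eq_square\<close>)
  moreover have "T x 1 2 $ 2 = 0"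
    by (rule zero[OF comp, of 1 2 2 "of_real \<mu> * \<beta>" "\<beta>"])
      (use I(4) S(4) \<beta> \<mu>0 \<mu> \<rho> lt in \<open>auto simp: norm_mult n power2_eq_square\<close>)
  moreover have "T x 2 1 $ 1 = 0"
    by (rule zero[OF comp, of 2 1 1 "of_real \<mu> * \<beta>" "of_real \<mu>"])
      (use I(5) S(5) \<beta> \<mu>0 \<mu> \<rho> lt in \<open>auto simp: norm_mult n power2_eq_square\<close>)
  moreover have "T x 2 1 $ 2 = 0"
    by (rule zero[OF comp, of 2 1 2 "of_real \<mu> * \<beta>" "\<beta>"])
      (use I(6) S(6) \<beta> \<mu>0 \<mu> \<rho> lt in \<open>auto simp: norm_mult n power2_eq_square\<close>)
  moreover have "T x 1 1 $ 1 = 0"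
    by (rule zero[OF comp, of 1 1 1 "(of_real \<mu>)\<^sup>2" "of_real \<mu>"])
      (use I(7) S(7) \<beta> \<mu>0 lt in \<open>auto simp: norm_mult n power2_eq_square\<close>)
  moreover have "T x 1 1 $ 2 = 0"
    by (rule zero[OF comp, of 1 1 2 "(of_real \<mu>)\<^sup>2" "\<beta>"])
      (use I(8) S(8) \<beta> \<mu>0 lt in \<open>auto simp: norm_mult n power2_eq_square\<close>)
  ultimately have "\<forall>i j. T x i j = 0" by (simp add: vec_eq_iff forall_2)
  then show ?thesis by blast
qed

subsection \<open>Invariant tensors of types II and III\<close>

locale nilpotent_data =
  fixes a b c :: "real^2" and \<kappa> :: real
  assumes indep: "a$1 * b$2 - a$2 * b$1 \<noteq> 0" and \<kappa>: "\<kappa> \<noteq> 0"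
begin

abbreviation g :: "2 \<Rightarrow> complex^2 \<Rightarrow> complex^2" where
  "g i \<equiv> tri 1 1 (a $ i) (of_real (b $ i)) (of_real (c $ i))"

abbreviation g3 :: "complex^2 \<Rightarrow> complex^2" where
  "g3 \<equiv> tri 1 1 0 0 (of_real \<kappa>)"

text \<open>The imaginary part of \<open>z\<close> is moved by the \<open>g i\<close> in steps
  \<open>b $ i * Im w\<close>, the real part by \<open>g3\<close> in steps \<open>\<kappa>\<close>.
  Real weights that account for all of \<open>Im z\<close> while keeping \<open>w\<close> fixed are
  rounded to integers; fractional parts bound what is left, and \<open>g3\<close> reduces
  \<open>Re z\<close> last.\<close>

lemma recurrent_nilpotent:
  assumes inv: "\<And>i x. x \<in> inoue_U \<Longrightarrow> f (g i x) = f x" and inv3: "\<And>x. x \<in> inoue_U \<Longrightarrow> f (g3 x) = f x"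
  shows "recurrent f"
  unfolding recurrent_def
proof (intro allI impI)
  fix w assume w: "Im w > 0"
  show "\<exists>R1 R2. \<forall>z. \<exists>w' z'. \<bar>Re w' - Re w\<bar> \<le> R1 \<and> Im w' = Im w \<and> cmod z' \<le> R2 \<and> f (vector [w', z'])
    = f (vector [w, z])"
  proof (rule exI, rule exI, rule allI)
    fix z
    define d where "d = a$1 * b$2 - a$2 * b$1"
    have d: "d \<noteq> 0" using indep by (simp add: d_def)
    define e where "e = Im z / Im w"
    \<comment> \<open>Cramer's rule for \<open>x1 * a$1 + x2 * a$2 = 0\<close> and
      \<open>x1 * b$1 + x2 * b$2 = e\<close>, with determinant \<open>d\<close>.\<close>
    define x1 where "x1 = - (a$2 * e) / d"
    define x2 where "x2 = a$1 * e / d"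
    have xa: "x1 * a$1 + x2 * a$2 = 0" by (simp add: x1_def x2_def)
    have "x1 * b$1 + x2 * b$2 = e * (a$1 * b$2 - a$2 * b$1) / d"
      by (simp add: x1_def x2_def diff_divide_distrib algebra_simps)
    then have "x1 * b$1 + x2 * b$2 = e" using d by (simp flip: d_def)
    then have xb: "(x1 * b$1 + x2 * b$2) * Im w = Im z" using w by (simp add: e_def)
    define n1 n2 where "n1 = - \<lfloor>x1\<rfloor>" and "n2 = - \<lfloor>x2\<rfloor>"
    have n: "real_of_int n1 = frac x1 - x1" "real_of_int n2 = frac x2 - x2"
      by (simp_all add: n1_def n2_def frac_def)
    \<comment> \<open>Only the reality of the constant \<open>q\<close> is recorded: it changes
      \<open>Re z\<close> alone, which \<open>g3\<close> reduces at the end.\<close>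
    have it: "\<exists>q::real. \<forall>y\<in>inoue_U. f (tri 1 1 (of_int m * a $ i) (of_real (of_int m * b $ i))
      (of_real q) y) = f y" for m i
      using invariant_iterate[of f "a $ i" "of_real (b $ i)" "of_real (c $ i)" _ m] inv
      by (intro exI[of _ "of_int m * c $ i + a $ i * b $ i * (of_int m * (of_int m - 1) / 2)"]) simp
    obtain q1 where q1: "\<And>y. y \<in> inoue_U \<Longrightarrow>
      f (tri 1 1 (of_int n1 * a $ 1) (of_real (of_int n1 * b $ 1)) (of_real q1) y) = f y"
      using it by blast
    obtain q2 where q2: "\<And>y. y \<in> inoue_U \<Longrightarrow>
      f (tri 1 1 (of_int n2 * a $ 2) (of_real (of_int n2 * b $ 2)) (of_real q2) y) = f y"
      using it by blast
    have q3: "f (tri 1 1 0 0 (of_int m * of_real \<kappa>) y) = f y" if "y \<in> inoue_U" for m y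
      using invariant_iterate[of f 0 0 "of_real \<kappa>" y m] inv3 that by simp
    define w1 where "w1 = w + of_real (of_int n1 * a $ 1)"
    define z1 where "z1 = z + of_real (of_int n1 * b $ 1) * w + of_real q1"
    define w' where "w' = w1 + of_real (of_int n2 * a $ 2)"
    define z2 where "z2 = z1 + of_real (of_int n2 * b $ 2) * w1 + of_real q2"
    define n3 where "n3 = - \<lfloor>Re z2 / \<kappa>\<rfloor>"
    define z' where "z' = z2 + of_int n3 * of_real \<kappa>"
    have "f (vector [w1, z1]) = f (vector [w, z])"
      using q1[of "vector [w, z]"] w by (simp add: w1_def z1_def add.assoc add.commute)
    moreover have "f (vector [w', z2]) = f (vector [w1, z1])"
      using q2[of "vector [w1, z1]"] w by (simp add: w'_def z2_def add.assoc add.commute w1_def)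
    moreover have "f (vector [w', z']) = f (vector [w', z2])"
      using q3[of "vector [w', z2]" n3] w by (simp add: z'_def w'_def w1_def)
    ultimately have f: "f (vector [w', z']) = f (vector [w, z])" by simp
    have "Re w' - Re w = frac x1 * a$1 + frac x2 * a$2"
      using xa by (simp add: w'_def w1_def n algebra_simps)
    then have R1: "\<bar>Re w' - Re w\<bar> \<le> \<bar>a$1\<bar> + \<bar>a$2\<bar>"
      using abs_frac_mult_le[of x1 "a$1"] abs_frac_mult_le[of x2 "a$2"] by linarith
    have "Im z' = (frac x1 * b$1 + frac x2 * b$2) * Im w"
      using xb by (simp add: z'_def z2_def z1_def w1_def n algebra_simps)
    moreover have "\<bar>frac x1 * b$1 + frac x2 * b$2\<bar> \<le> \<bar>b$1\<bar> + \<bar>b$2\<bar>"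
      using abs_frac_mult_le[of x1 "b$1"] abs_frac_mult_le[of x2 "b$2"] by linarith
    ultimately have I: "\<bar>Im z'\<bar> \<le> (\<bar>b$1\<bar> + \<bar>b$2\<bar>) * Im w"
      using w by (simp add: abs_mult mult_right_mono)
    have "Re z' = frac (Re z2 / \<kappa>) * \<kappa>"
      using \<kappa> by (simp add: z'_def n3_def frac_def algebra_simps)
    then have "\<bar>Re z'\<bar> \<le> \<bar>\<kappa>\<bar>" by (simp add: abs_frac_mult_le)
    with I have "cmod z' \<le> \<bar>\<kappa>\<bar> + (\<bar>b$1\<bar> + \<bar>b$2\<bar>) * Im w"
      using cmod_le[of z'] by linarith
    with f R1 show "\<exists>w' z'. \<bar>Re w' - Re w\<bar> \<le> \<bar>a$1\<bar> + \<bar>a$2\<bar> \<and> Im w' = Im w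
        \<and> cmod z' \<le> \<bar>\<kappa>\<bar> + (\<bar>b$1\<bar> + \<bar>b$2\<bar>) * Im w \<and> f (vector [w', z']) = f (vector [w, z])"
      by (intro exI[of _ w'] exI[of _ z']) (simp add: w'_def w1_def)
  qed
qed

lemma a_nonzero: obtains i where "a $ i \<noteq> 0"
  using indep by force

lemma b_nonzero: obtains i where "b $ i \<noteq> 0"
  using indep by force

text \<open>The differences \<open>f (w, z + s) - f (w, z)\<close> are invariant, hence independent of \<open>z\<close>; so
  \<open>f\<close> is affine in \<open>z\<close>, and the period \<open>\<kappa>\<close> makes it constant in \<open>z\<close>.\<close>

lemma quasi_invariant_const_in_second:
  assumes f: "holomorphic_fun f inoue_U"
    and inv: "\<And>i x. x \<in> inoue_U \<Longrightarrow> f (g i x) = f x + of_real (b $ i) * m"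
      and inv3: "\<And>x. x \<in> inoue_U \<Longrightarrow> f (g3 x) = f x"
    and w: "Im w > 0"
  shows "f (vector [w, z]) = f (vector [w, 0])"
proof -
  define \<phi> where "\<phi> = (\<lambda>z. f (vector [w, z]))"
  define \<phi>' where "\<phi>' = (\<lambda>z. frechet_derivative f (at (vector [w, z])) (axis 2 1))"
  have der: "(\<phi> has_field_derivative \<phi>' z) (at z)" for z
    unfolding \<phi>_def \<phi>'_def by (rule holomorphic_in_second[OF f w])
  have incr: "\<phi> (z + s) - \<phi> z = \<phi> s - \<phi> 0" for z s
  proof -
    define k where "k = (\<lambda>x. f (x + s *s axis 2 1) - f x)"
    have shift_U: "x + s *s axis 2 1 \<in> inoue_U \<longleftrightarrow> x \<in> inoue_U" for x
      by (simp add: inoue_U_def axis_def)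
    have "holomorphic_fun (\<lambda>x. f (x + s *s axis 2 1)) inoue_U"
      unfolding holomorphic_fun_def
    proof
      fix x assume "x \<in> inoue_U"
      then have x: "mat 1 *v x + s *s axis 2 1 \<in> inoue_U" by (simp add: shift_U)
      show "\<exists>f'. ((\<lambda>x. f (x + s *s axis 2 1)) has_derivative f') (at x)
        \<and> (\<forall>k v. f' (k *s v) = k * f' v)"
        using diff_chain_at[OF matrix_vector_mul_has_derivative holomorphic_fun_has_derivative(1)[OF
          f x]]
          holomorphic_fun_has_derivative(2)[OF f x] by (auto simp: o_def)
    qed
    then have k: "holomorphic_fun k inoue_U"
      unfolding k_def holomorphic_fun_def
    proof (intro ballI)
      fix x assume H: "\<forall>x\<in>inoue_U. \<exists>f'. ((\<lambda>x. f (x + s *s axis 2 1)) has_derivative f') (at x)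
        \<and> (\<forall>k v. f' (k *s v) = k * f' v)"
        and x: "x \<in> inoue_U"
      then obtain f' where f': "((\<lambda>x. f (x + s *s axis 2 1)) has_derivative f') (at x)"
        "\<And>k v. f' (k *s v) = k * f' v"
        by blast
      show "\<exists>f'. ((\<lambda>x. f (x + s *s axis 2 1) - f x) has_derivative f') (at x)
        \<and> (\<forall>k v. f' (k *s v) = k * f' v)"
        by (intro exI[of _ "\<lambda>v. f' v - frechet_derivative f (at x) v"])
          (simp add: has_derivative_diff f' holomorphic_fun_has_derivative[OF f x]
          right_diff_distrib)
    qed
    \<comment> \<open>Vertical translations commute with the unipotent maps, so the additive terms
      \<open>b $ i * m\<close> cancel in \<open>k\<close>, which is therefore invariant.\<close>
    have comm: "tri 1 1 p q r x + s *s axis 2 1 = tri 1 1 p q r (x + s *s axis 2 1)" for p q r x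
      by (simp add: tri_def vec_eq_iff forall_2 axis_def)
    have "recurrent k"
      by (rule recurrent_nilpotent) (simp_all add: k_def comm inv inv3 shift_U)
    from recurrent_imp_const_in_second[OF k this w, of z]
    have "f (vector [w, z] + s *s axis 2 1) - f (vector [w, z]) = f (vector [w, 0] + s *s axis 2 1)
      - f (vector [w, 0])"
      by (simp add: k_def)
    moreover have "vector [w, v] + s *s axis 2 1 = (vector [w, v + s] :: complex^2)" for v
      by (simp add: vec_eq_iff forall_2 axis_def)
    ultimately show ?thesis by (simp add: \<phi>_def)
  qed
  have "\<phi>' z = \<phi>' 0" for z
  proof -
    have "((\<lambda>s. \<phi> (z + s)) has_field_derivative \<phi>' z) (at 0)"
      using DERIV_shift[of \<phi> "\<phi>' z" 0 z] der[of z] by (simp add: add.commute)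
    moreover have "(\<lambda>s. \<phi> (z + s)) = (\<lambda>s. \<phi> z + (\<phi> s - \<phi> 0))" using incr[of z]
      by (simp add: fun_eq_iff algebra_simps)
    moreover have "((\<lambda>s. \<phi> z + (\<phi> s - \<phi> 0)) has_field_derivative \<phi>' 0) (at 0)"
      by (auto intro!: derivative_eq_intros der)
    ultimately show ?thesis by (metis DERIV_unique)
  qed
  then have "((\<lambda>z. \<phi> z - \<phi>' 0 * z) has_field_derivative 0) (at z)" for z
    by (auto intro!: derivative_eq_intros der)
  then have "\<exists>C. \<forall>z\<in>UNIV. \<phi> z - \<phi>' 0 * z = C"
    by (intro has_field_derivative_zero_constant) auto
  then obtain C where C: "\<And>z. \<phi> z = C + \<phi>' 0 * z" by (force simp: algebra_simps)
  have "\<phi> (of_real \<kappa>) = \<phi> 0" using inv3[of "vector [w, 0]"] w by (simp add: \<phi>_def)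
  then have "\<phi>' 0 = 0" using \<kappa> by (simp add: C)
  then show ?thesis using C by (simp add: \<phi>_def)
qed

text \<open>By \<open>scaled_increment\<close> with factor \<open>1 / \<alpha>\<close>, moving by
  \<open>a $ i / \<alpha> ^ n\<close> changes \<open>f\<close> by
  \<open>b $ i * m * \<alpha> ^ n\<close>. Continuity at \<open>\<i>\<close> sends these changes to
  0, which forces \<open>m = 0\<close> for an index with \<open>b $ i \<noteq> 0\<close>. Then
  \<open>f\<close> is invariant and scaled by \<open>1 / \<alpha> \<noteq> 1\<close>, hence
  0.\<close>

lemma quasi_invariant_zero:
  assumes f: "holomorphic_fun f inoue_U"
    and inv: "\<And>i x. x \<in> inoue_U \<Longrightarrow> f (g i x) = f x + of_real (b $ i) * m"
      and inv3: "\<And>x. x \<in> inoue_U \<Longrightarrow> f (g3 x) = f x"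
    and scale: "\<And>x. x \<in> inoue_U \<Longrightarrow> f (tri \<alpha> \<epsilon> 0 0 t x) = f x / of_real \<alpha>" and \<alpha>: "\<alpha> > 1"
  shows "m = 0" and "x \<in> inoue_U \<Longrightarrow> f x = 0"
proof -
  have h: "f (vector [w, z]) = f (vector [w, 0])" if "Im w > 0" for w z
    by (rule quasi_invariant_const_in_second[OF f inv inv3 that])
  obtain i where i: "b $ i \<noteq> 0" by (rule b_nonzero)
  let ?h = "\<lambda>w. f (vector [w, 0])"
  have incr: "?h (\<i> + of_real (a $ i / \<alpha> ^ n)) = ?h \<i> + of_real (b $ i) * m / (1 / of_real \<alpha>) ^ n"
    for n
  proof (rule scaled_increment)
    show "?h (of_real \<alpha> * w) = 1 / of_real \<alpha> * ?h w" if "Im w > 0" for w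
      using scale[of "vector [w, 0]"] h[of "of_real \<alpha> * w" t] that \<alpha> by simp
    show "?h (w + of_real (a $ i)) = ?h w + of_real (b $ i) * m" if "Im w > 0" for w
      using inv[of "vector [w, 0]" i] h[of "w + of_real (a $ i)"
        "of_real (b $ i) * w + of_real (c $ i)"] that by simp
  qed (use \<alpha> in auto)
  have "isCont ?h \<i>" using holomorphic_in_first[OF f, of \<i> 0] by (auto intro: DERIV_isCont)
  then have "(\<lambda>n. ?h (\<i> + of_real (a $ i / \<alpha> ^ n))) \<longlonglongrightarrow> ?h \<i>"
    using shift_tendsto[OF \<alpha>] by (rule isCont_tendsto_compose)
  then have "(\<lambda>n. ?h (\<i> + of_real (a $ i / \<alpha> ^ n)) - ?h \<i>) \<longlonglongrightarrow> 0" by (rule LIM_zero)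
  then have "(\<lambda>n. of_real (b $ i) * m * of_real \<alpha> ^ n) \<longlonglongrightarrow> 0" unfolding incr
    by (simp add: power_one_over field_simps)
  moreover have "(\<lambda>n. 1 / complex_of_real \<alpha> ^ n) \<longlonglongrightarrow> 0"
    using shift_tendsto[OF \<alpha>, of 0 1] by simp
  ultimately have "(\<lambda>n. of_real (b $ i) * m * of_real \<alpha> ^ n * (1 / complex_of_real \<alpha> ^ n)) \<longlonglongrightarrow> 0 * 0"
    by (rule tendsto_mult)
  then have "(\<lambda>n. of_real (b $ i) * m) \<longlonglongrightarrow> 0" using \<alpha> by simp
  then have "of_real (b $ i) * m = 0" by (simp add: LIMSEQ_const_iff)
  then show m: "m = 0" using i by simp
  obtain l where l: "a $ l \<noteq> 0" by (rule a_nonzero)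
  have inv0: "f (g i x) = f x" if "x \<in> inoue_U" for i x using inv[OF that] m by simp
  have scale': "f (tri \<alpha> \<epsilon> 0 0 t x) = 1 / of_real \<alpha> * f x" if "x \<in> inoue_U" for x
    using scale[OF that] by simp
  have "1 / complex_of_real \<alpha> \<noteq> 0" "1 / complex_of_real \<alpha> \<noteq> 1" using \<alpha> by auto
  from recurrent_invariant_const[OF f recurrent_nilpotent[OF inv0 inv3] inv0[of _ l] l scale' \<alpha>
    this(1)] this(2)
  show "f x = 0" if "x \<in> inoue_U" using that by auto
qed

lemma tensor_zero:
  fixes T :: "complex^2 \<Rightarrow> 2 \<Rightarrow> 2 \<Rightarrow> complex^2" and \<epsilon> :: complex
  assumes \<alpha>: "\<alpha> > 1" and \<epsilon>: "\<epsilon> = 1 \<or> \<epsilon> = -1"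
    and hol: "\<And>i j. holomorphic_map (\<lambda>x. T x i j) inoue_U"
    and inv: "\<And>i. tensor_invariant T 1 1 (a $ i) (of_real (b $ i)) (of_real (c $ i))"
    and inv3: "tensor_invariant T 1 1 0 0 (of_real \<kappa>)"
    and scale: "tensor_invariant T \<alpha> \<epsilon> 0 0 t"
    and x: "x \<in> inoue_U"
  shows "T x i j = 0"
proof -
  have comp: "holomorphic_fun (\<lambda>x. T x i j $ k) inoue_U" for i j k
    using hol by (simp add: holomorphic_map_iff)
  note I = tensor_tri_components[OF tensor_invariantD[OF inv], simplified]
  note J = tensor_tri_components[OF tensor_invariantD[OF inv3], simplified]
  note S = tensor_tri_components[OF tensor_invariantD[OF scale], simplified]
  obtain l where l: "a $ l \<noteq> 0" by (rule a_nonzero)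
  have \<alpha>0: "complex_of_real \<alpha> \<noteq> 0" "complex_of_real \<alpha> \<noteq> 1" using \<alpha> by auto
  have \<epsilon>0: "\<epsilon> \<noteq> 0" "\<epsilon> * \<epsilon> = 1" "\<epsilon>\<^sup>2 = 1" using \<epsilon> by auto
  have const: "\<exists>C. (\<forall>x\<in>inoue_U. f x = C) \<and> (\<xi> \<noteq> 1 \<longrightarrow> C = 0)"
    if f: "holomorphic_fun f inoue_U" and "\<And>x i. x \<in> inoue_U \<Longrightarrow> f (g i x) = f x" "\<And>x. x \<in> inoue_U \<Longrightarrow>
      f (g3 x) = f x"
      and "\<And>x. x \<in> inoue_U \<Longrightarrow> f (tri \<alpha> \<epsilon> 0 0 t x) = \<xi> * f x" "\<xi> \<noteq> 0" for f \<xi>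
    by (rule recurrent_invariant_const[OF f recurrent_nilpotent[OF that(2,3)] that(2)[of _ l] l
      that(4) \<alpha> that(5)])
  have T221: "T x 2 2 $ 1 = 0" if "x \<in> inoue_U" for x
  proof -
    have 3: "T (tri \<alpha> \<epsilon> 0 0 t x) 2 2 $ 1 = of_real \<alpha> * T x 2 2 $ 1" if "x \<in> inoue_U" for x
      using S(1)[OF that] \<epsilon>0 by simp
    from const[OF comp I(1) J(1) 3 \<alpha>0(1)] \<alpha>0(2) that show ?thesis by auto
  qed
  \<comment> \<open>For \<open>\<epsilon> = 1\<close> the factor \<open>1 / \<epsilon>\<close> is 1,
    so at this stage only constancy follows; the same holds for \<open>q\<close> and
    \<open>s\<close>.\<close>
  obtain p where p: "\<And>x. x \<in> inoue_U \<Longrightarrow> T x 1 2 $ 1 = p"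
  proof -
    have 3: "T (tri \<alpha> \<epsilon> 0 0 t x) 1 2 $ 1 = 1 / \<epsilon> * T x 1 2 $ 1" if "x \<in> inoue_U" for x
      using S(3)[OF that] \<alpha>0 \<epsilon>0 by (simp add: field_simps)
    have 1: "T (g i x) 1 2 $ 1 = T x 1 2 $ 1" if "x \<in> inoue_U" for i x
      using I(3)[OF that, of i] T221[OF tri_in_U[OF _ that, of 1]] by simp
    have "1 / \<epsilon> \<noteq> 0" using \<epsilon>0 by simp
    from const[OF comp 1 J(3) 3 this] that show thesis by blast
  qed
  obtain q where q: "\<And>x. x \<in> inoue_U \<Longrightarrow> T x 2 1 $ 1 = q"
  proof -
    have 3: "T (tri \<alpha> \<epsilon> 0 0 t x) 2 1 $ 1 = 1 / \<epsilon> * T x 2 1 $ 1" if "x \<in> inoue_U" for x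
      using S(5)[OF that] \<alpha>0 \<epsilon>0 by (simp add: field_simps)
    have 1: "T (g i x) 2 1 $ 1 = T x 2 1 $ 1" if "x \<in> inoue_U" for i x
      using I(5)[OF that, of i] T221[OF tri_in_U[OF _ that, of 1]] by simp
    have "1 / \<epsilon> \<noteq> 0" using \<epsilon>0 by simp
    from const[OF comp 1 J(5) 3 this] that show thesis by blast
  qed
  obtain s where s: "\<And>x. x \<in> inoue_U \<Longrightarrow> T x 2 2 $ 2 = s"
  proof -
    have 3: "T (tri \<alpha> \<epsilon> 0 0 t x) 2 2 $ 2 = \<epsilon> * T x 2 2 $ 2" if "x \<in> inoue_U" for x
      using S(2)[OF that] \<epsilon>0 by simp
    have 1: "T (g i x) 2 2 $ 2 = T x 2 2 $ 2" if "x \<in> inoue_U" for i x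
      using I(2)[OF that, of i] T221[OF that] by simp
    have "\<epsilon> \<noteq> 0" using \<epsilon>0 by simp
    from const[OF comp 1 J(2) 3 this] that show thesis by blast
  qed
  have gU: "g i x \<in> inoue_U" "g3 x \<in> inoue_U" "tri \<alpha> \<epsilon> 0 0 t x \<in> inoue_U" if "x \<in> inoue_U" for i x
    using that \<alpha> by (auto intro: tri_in_U)
  \<comment> \<open>Both mixed components enter the equation for \<open>T 1 1 $ 1\<close> with
    coefficient \<open>b $ i\<close>. As they are the constants \<open>p\<close> and
    \<open>q\<close>, the increment is a fixed multiple of \<open>b $ i\<close>, as
    \<open>quasi_invariant_zero\<close> requires.\<close>
  have pq: "- (p + q) = 0" and T111: "\<And>x. x \<in> inoue_U \<Longrightarrow> T x 1 1 $ 1 = 0"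
  proof -
    have 1: "T (g i x) 1 1 $ 1 = T x 1 1 $ 1 + of_real (b $ i) * - (p + q)" if "x \<in> inoue_U" for i x
      using I(7)[OF that, of i] T221 p q gU that by (simp add: algebra_simps)
    have 2: "T (g3 x) 1 1 $ 1 = T x 1 1 $ 1" if "x \<in> inoue_U" for x using J(7)[OF that] by simp
    have 3: "T (tri \<alpha> \<epsilon> 0 0 t x) 1 1 $ 1 = T x 1 1 $ 1 / of_real \<alpha>" if "x \<in> inoue_U" for x
      using S(7)[OF that] \<alpha>0 by (simp add: field_simps power2_eq_square)
    show "- (p + q) = 0" by (rule quasi_invariant_zero(1)[OF comp 1 2 3 \<alpha>])
    show "T x 1 1 $ 1 = 0" if "x \<in> inoue_U" for x
      by (rule quasi_invariant_zero(2)[OF comp 1 2 3 \<alpha> that])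
  qed
  have ps: "p - s = 0" and T122: "\<And>x. x \<in> inoue_U \<Longrightarrow> T x 1 2 $ 2 = 0"
  proof -
    have 1: "T (g i x) 1 2 $ 2 = T x 1 2 $ 2 + of_real (b $ i) * (p - s)" if "x \<in> inoue_U" for i x
      using I(4)[OF that, of i] p s gU that by (simp add: algebra_simps)
    have 2: "T (g3 x) 1 2 $ 2 = T x 1 2 $ 2" if "x \<in> inoue_U" for x using J(4)[OF that] by simp
    have 3: "T (tri \<alpha> \<epsilon> 0 0 t x) 1 2 $ 2 = T x 1 2 $ 2 / of_real \<alpha>" if "x \<in> inoue_U" for x
      using S(4)[OF that] \<alpha>0 \<epsilon>0 by (simp add: field_simps)
    show "p - s = 0" by (rule quasi_invariant_zero(1)[OF comp 1 2 3 \<alpha>])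
    show "T x 1 2 $ 2 = 0" if "x \<in> inoue_U" for x
      by (rule quasi_invariant_zero(2)[OF comp 1 2 3 \<alpha> that])
  qed
  have qs: "q - s = 0" and T212: "\<And>x. x \<in> inoue_U \<Longrightarrow> T x 2 1 $ 2 = 0"
  proof -
    have 1: "T (g i x) 2 1 $ 2 = T x 2 1 $ 2 + of_real (b $ i) * (q - s)" if "x \<in> inoue_U" for i x
      using I(6)[OF that, of i] q s gU that by (simp add: algebra_simps)
    have 2: "T (g3 x) 2 1 $ 2 = T x 2 1 $ 2" if "x \<in> inoue_U" for x using J(6)[OF that] by simp
    have 3: "T (tri \<alpha> \<epsilon> 0 0 t x) 2 1 $ 2 = T x 2 1 $ 2 / of_real \<alpha>" if "x \<in> inoue_U" for x
      using S(6)[OF that] \<alpha>0 \<epsilon>0 by (simp add: field_simps)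
    show "q - s = 0" by (rule quasi_invariant_zero(1)[OF comp 1 2 3 \<alpha>])
    show "T x 2 1 $ 2 = 0" if "x \<in> inoue_U" for x
      by (rule quasi_invariant_zero(2)[OF comp 1 2 3 \<alpha> that])
  qed
  \<comment> \<open>The three relations together give \<open>2 * s = 0\<close>.\<close>
  have "p = s" "q = s" "p + q = 0" using pq ps qs
    by (simp_all only: neg_equal_0_iff_equal right_minus_eq)
  then have 0: "p = 0" "q = 0" "s = 0" by auto
  have "T x 1 1 $ 2 = 0"
  proof -
    have 1: "T (g i x) 1 1 $ 2 = T x 1 1 $ 2" if "x \<in> inoue_U" for i x
      using I(8)[OF that, of i] T122 T212 T111 s 0 gU that by simp
    have 3: "T (tri \<alpha> \<epsilon> 0 0 t x) 1 1 $ 2 = \<epsilon> / (of_real \<alpha>)\<^sup>2 * T x 1 1 $ 2" if "x \<in> inoue_U" for x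
      using S(8)[OF that] \<alpha>0 by (simp add: field_simps)
    \<comment> \<open>The factor has modulus \<open>1 / \<alpha>^2 < 1\<close>, so it differs from 1
      for either sign of \<open>\<epsilon>\<close>.\<close>
    have "cmod (\<epsilon> / (of_real \<alpha>)\<^sup>2) < 1"
      using \<epsilon> \<alpha> by (auto simp: norm_divide norm_power power_less_one_iff one_less_power)
    then have "\<epsilon> / (of_real \<alpha>)\<^sup>2 \<noteq> 1" by auto
    moreover have "\<epsilon> / (of_real \<alpha>)\<^sup>2 \<noteq> 0" using \<alpha>0 \<epsilon>0 by simp
    from const[OF comp 1 J(8) 3 this] x have "\<epsilon> / (of_real \<alpha>)\<^sup>2 \<noteq> 1 \<longrightarrow> T x 1 1 $ 2 = 0" by auto
    ultimately show ?thesis by blast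
  qed
  then have "\<forall>i j. T x i j = 0"
    using T221 p q s 0 T111 T122 T212 x by (simp add: vec_eq_iff forall_2)
  then show ?thesis by blast
qed

end

section \<open>Groups of triangular maps\<close>

lemma group_Aff: "group inoue_Aff"
proof (rule groupI)
  fix f g assume "f \<in> carrier inoue_Aff" "g \<in> carrier inoue_Aff"
  then obtain A v B w where f: "invertible A" "f = (\<lambda>x. A *v x + v)" "f ` inoue_U = inoue_U"
    and g: "invertible B" "g = (\<lambda>x. B *v x + w)" "g ` inoue_U = inoue_U"
    by (auto simp: inoue_Aff_def)
  have "f \<circ> g = (\<lambda>x. (A ** B) *v x + (A *v w + v))"
    by (simp add: f g fun_eq_iff matrix_vector_mul_assoc matrix_vector_right_distrib add.assoc)
  moreover have "invertible (A ** B)" using f g by (simp add: invertible_mult)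
  moreover have "(f \<circ> g) ` inoue_U = inoue_U" by (metis f(3) g(3) image_comp)
  ultimately show "f \<otimes>\<^bsub>inoue_Aff\<^esub> g \<in> carrier inoue_Aff"
    by (auto simp: inoue_Aff_def)
next
  have "invertible (mat 1 :: complex^2^2)" by (auto simp: invertible_def)
  moreover have "id = (\<lambda>x. mat 1 *v x + (0 :: complex^2))" by (simp add: fun_eq_iff)
  ultimately show "\<one>\<^bsub>inoue_Aff\<^esub> \<in> carrier inoue_Aff"
    unfolding inoue_Aff_def by (simp, blast)
next
  fix f assume "f \<in> carrier inoue_Aff"
  then obtain A v where f: "invertible A" "f = (\<lambda>x. A *v x + v)" "f ` inoue_U = inoue_U"
    by (auto simp: inoue_Aff_def)
  then obtain B where B: "A ** B = mat 1" "B ** A = mat 1" by (auto simp: invertible_def)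
  define h where "h = (\<lambda>x. B *v x + - (B *v v))"
  have hf: "h \<circ> f = id"
    by (simp add: h_def f fun_eq_iff matrix_vector_mul_assoc matrix_vector_right_distrib B)
  have "h ` inoue_U = (h \<circ> f) ` inoue_U" by (metis f(3) image_comp)
  then have "h ` inoue_U = inoue_U" by (simp add: hf)
  moreover have "invertible B" using B by (auto simp: invertible_def)
  ultimately have "(\<exists>A v. invertible A \<and> h = (\<lambda>x. A *v x + v)) \<and> h ` inoue_U = inoue_U"
    using h_def by blast
  then have "h \<in> carrier inoue_Aff" by (simp add: inoue_Aff_def)
  with hf show "\<exists>y\<in>carrier inoue_Aff. y \<otimes>\<^bsub>inoue_Aff\<^esub> f = \<one>\<^bsub>inoue_Aff\<^esub>"
    by (auto simp: inoue_Aff_def)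
qed (auto simp: inoue_Aff_def o_assoc)

lemma carrier_AffD: "g \<in> carrier inoue_Aff \<Longrightarrow> (\<exists>L v. g = (\<lambda>x. L *v x + v)) \<and> g ` inoue_U = inoue_U"
  by (auto simp: inoue_Aff_def)

lemma mult_Aff: "f \<otimes>\<^bsub>inoue_Aff\<^esub> g = f \<circ> g" and one_Aff: "\<one>\<^bsub>inoue_Aff\<^esub> = id"
  by (simp_all add: inoue_Aff_def)

lemma tri_id: "tri 1 1 0 0 0 = id"
  by (simp add: fun_eq_iff tri_def vector_2_eta)

lemma tri_compose: "tri \<mu> \<nu> s b c \<circ> tri \<mu>' \<nu>' s' b' c' =
    tri (\<mu> * \<mu>') (\<nu> * \<nu>') (\<mu> * s' + s) (\<nu> * b' + b * of_real \<mu>') (\<nu> * c' + b * of_real s' + c)"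
  by (simp add: fun_eq_iff tri_comp)

lemma tri_in_Aff:
  assumes \<mu>: "\<mu> > 0" and \<nu>: "\<nu> \<noteq> 0"
  shows "tri \<mu> \<nu> s b c \<in> carrier inoue_Aff"
proof -
  \<comment> \<open>The inverse is again triangular; its coefficients come from solving for
    \<open>w\<close> first and then for \<open>z\<close>.\<close>
  let ?h = "tri (1 / \<mu>) (1 / \<nu>) (- s / \<mu>) (- b / (of_real \<mu> * \<nu>)) ((b * of_real s / of_real \<mu> - c) /
  \<nu>)"
  have "tri \<mu> \<nu> s b c \<circ> ?h = tri 1 1 0 0 0"
    unfolding tri_compose using \<mu> \<nu> by (simp add: field_simps)
  then have h: "tri \<mu> \<nu> s b c (?h x) = x" for x by (metis comp_apply id_apply tri_id)
  have "?h x \<in> inoue_U" if "x \<in> inoue_U" for x using that \<mu> by (intro tri_in_U) auto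
  then have "inoue_U \<subseteq> tri \<mu> \<nu> s b c ` inoue_U" using h by (metis image_eqI subsetI)
  moreover have "tri \<mu> \<nu> s b c ` inoue_U \<subseteq> inoue_U" using tri_in_U \<mu> by blast
  ultimately have "tri \<mu> \<nu> s b c ` inoue_U = inoue_U" by blast
  moreover have "invertible (tri_matrix \<mu> \<nu> b)"
    unfolding invertible_def using \<mu> \<nu>
    by (intro exI[of _ "tri_matrix (1 / \<mu>) (1 / \<nu>) (- b / (of_real \<mu> * \<nu>))"])
      (simp add: tri_matrix_def matrix_matrix_mult_def mat_def vec_eq_iff forall_2 sum_2
      field_simps)
  moreover have "tri \<mu> \<nu> s b c = (\<lambda>x. tri_matrix \<mu> \<nu> b *v x + vector [of_real s, c])"
    by (simp add: fun_eq_iff tri_affine)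
  ultimately show ?thesis unfolding inoue_Aff_def by auto
qed

text \<open>A discrete subgroup \<open>\<Lambda>\<close> of the unipotent maps \<open>(w + s, z + b w + c)\<close>, normalised by
  \<open>(\<mu> w, \<nu> z + t)\<close>.\<close>

locale triangular_group =
  fixes \<mu> :: real and \<nu> t :: complex and \<Lambda> :: "(real \<times> complex \<times> complex) set"
  assumes \<mu>: "\<mu> > 1" and \<nu>: "\<nu> \<noteq> 0" and \<nu>t: "\<nu> = 1 \<or> t = 0"
    and zero: "(0, 0, 0) \<in> \<Lambda>"
    and mult: "(s, b, c) \<in> \<Lambda> \<Longrightarrow> (s', b', c') \<in> \<Lambda> \<Longrightarrow> (s + s', b + b', c + c' + b * of_real s') \<in> \<Lambda>"
    and inverse: "(s, b, c) \<in> \<Lambda> \<Longrightarrow> (- s, - b, - c + b * of_real s) \<in> \<Lambda>"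
    and conj: "(s, b, c) \<in> \<Lambda> \<Longrightarrow> (\<mu> * s, \<nu> * b / of_real \<mu>, \<nu> * c) \<in> \<Lambda>"
    and conj_inv: "(s, b, c) \<in> \<Lambda> \<Longrightarrow> (s / \<mu>, of_real \<mu> * b / \<nu>, c / \<nu>) \<in> \<Lambda>"
    and discrete: "Im w0 > 0 \<Longrightarrow> \<exists>\<delta>>0. \<forall>s b c w. (s, b, c) \<in> \<Lambda> \<and> cmod (w - w0) < \<delta> \<and> \<bar>s\<bar> < \<delta>
      \<and> cmod (b * w + c) < \<delta>
      \<longrightarrow> s = 0 \<and> b = 0 \<and> c = 0"
begin

text \<open>The unipotent map \<open>(s, b, c)\<close> after \<open>k\<close> applications of
  \<open>(\<mu> w, \<nu> z + t)\<close>, hence the factor \<open>\<mu> powi k\<close> at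
  \<open>b\<close>. By \<open>\<nu>t\<close> the accumulated translation is \<open>k * t\<close>:
  either \<open>\<nu> = 1\<close>, or \<open>t = 0\<close>.\<close>

definition elt :: "int \<Rightarrow> real \<Rightarrow> complex \<Rightarrow> complex \<Rightarrow> complex^2 \<Rightarrow> complex^2" where
  "elt k s b c = tri (\<mu> powi k) (\<nu> powi k) s (b * of_real (\<mu> powi k)) (c + of_int k * t)"

definition elts :: "(complex^2 \<Rightarrow> complex^2) set" where
  "elts = {elt k s b c | k s b c. (s, b, c) \<in> \<Lambda>}"

lemma \<mu>_pos: "\<mu> powi k > 0" using \<mu> by simp

lemma conj_int: "(s, b, c) \<in> \<Lambda> \<Longrightarrow> (\<mu> powi k * s, \<nu> powi k * b / of_real (\<mu> powi k), \<nu> powi k * c) \<in>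
  \<Lambda>"
proof (induction k rule: int_induct[where k = 0])
  case (step1 k)
  have "\<mu> powi (k + 1) = \<mu> * \<mu> powi k" "\<nu> powi (k + 1) = \<nu> * \<nu> powi k"
    using \<mu> \<nu> by (simp_all add: power_int_add_1')
  with step1 show ?case using conj[of "\<mu> powi k * s" "\<nu> powi k * b / of_real (\<mu> powi k)"
    "\<nu> powi k * c"]
    by (simp add: ac_simps)
next
  case (step2 k)
  then show ?case using conj_inv[of "\<mu> powi k * s" "\<nu> powi k * b / of_real (\<mu> powi k)"
    "\<nu> powi k * c"] \<mu> \<nu>
    by (simp add: power_int_diff ac_simps)
qed simp

text \<open>A semidirect product law: the second unipotent part is conjugated by the
  \<open>k\<close>-th power of the dilation and then multiplied to the first.\<close>

lemma elt_comp: "elt k s b c \<circ> elt l s' b' c' =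
  elt (k + l) (s + \<mu> powi k * s') (b + \<nu> powi k * b' / of_real (\<mu> powi k)) (c + \<nu> powi k * c'
  + b * of_real (\<mu> powi k * s'))"
proof -
  have t: "\<nu> powi k * (of_int l * t) = of_int l * t" using \<nu>t by auto
  have \<mu>k: "complex_of_real (\<mu> powi k) \<noteq> 0" using \<mu>_pos[of k]
    by (metis less_irrefl of_real_eq_0_iff)
  have p: "\<mu> powi (k + l) = \<mu> powi k * \<mu> powi l" "\<nu> powi (k + l) = \<nu> powi k * \<nu> powi l"
    using \<mu> \<nu> by (simp_all add: power_int_add)
  have "n * (b' * m') + b * m * m' = (b + n * b' / m) * (m * m')" if "m \<noteq> 0" for m n m' :: complex
    using that by (simp add: field_simps)
  note 1 = this[OF \<mu>k]
  have 2: "\<nu> powi k * (c' + of_int l * t) + b * m * of_real s' + (c + of_int k * t)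
      = c + \<nu> powi k * c' + b * (m * of_real s') + of_int (k + l) * t" for m
    by (simp only: distrib_left t) (simp add: algebra_simps)
  show ?thesis
    unfolding elt_def tri_compose p of_real_mult 1 2 by (simp only: add.commute)
qed

lemma elt_0: "elt 0 0 0 0 = id"
  by (simp add: elt_def tri_id)

lemma subgroup_elts: "subgroup elts inoue_Aff"
proof
  show "elts \<subseteq> carrier inoue_Aff"
    unfolding elts_def elt_def using \<mu>_pos \<nu> by (auto intro!: tri_in_Aff)
  show "\<one>\<^bsub>inoue_Aff\<^esub> \<in> elts"
    using elt_0 zero by (auto simp: inoue_Aff_def elts_def intro!: exI[of _ 0] sym[OF elt_0])
next
  fix x y assume "x \<in> elts" "y \<in> elts"
  then obtain k s b c l s' b' c' where x: "x = elt k s b c" "(s, b, c) \<in> \<Lambda>"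
    and y: "y = elt l s' b' c'" "(s', b', c') \<in> \<Lambda>"
    unfolding elts_def by blast
  show "x \<otimes>\<^bsub>inoue_Aff\<^esub> y \<in> elts"
    using mult[OF x(2) conj_int[OF y(2), of k]]
      by (auto simp: inoue_Aff_def x(1) y(1) elt_comp elts_def)
next
  fix x assume "x \<in> elts"
  then obtain k s b c where x: "x = elt k s b c" "(s, b, c) \<in> \<Lambda>"
    unfolding elts_def by blast
  \<comment> \<open>The inverse of the unipotent part, conjugated by the power \<open>- k\<close> of
    the dilation; \<open>inverse\<close> and \<open>conj_int\<close> keep it in
    \<open>\<Lambda>\<close>.\<close>
  define y where "y = elt (- k) (\<mu> powi (- k) * (- s)) (\<nu> powi (- k) * (- b) / of_real
    (\<mu> powi (- k))) (\<nu> powi (- k) * (- c + b * of_real s))"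
  have y: "y \<in> elts" using conj_int[OF inverse[OF x(2)], of "- k"] unfolding y_def elts_def by blast
  have nz: "complex_of_real (\<mu> powi (- k)) \<noteq> 0" using \<mu>_pos[of "- k"]
    by (metis less_irrefl of_real_eq_0_iff)
  have E0: "elt (- k + k) A B C = elt 0 0 0 0" if "A = 0" "B = 0" "C = 0" for A B C
    using that by simp
  have E1: "\<mu> powi - k * - s + \<mu> powi - k * s = 0" by simp
  have E2: "n * - b / m + n * b / m = 0" for n m by simp
  have E3: "n * (- c + b * of_real s) + n * c + n * - b / m * (m * of_real s) = 0" if "m \<noteq> 0"
    for n m
    using that by (simp add: field_simps)
  have "y \<circ> x = elt 0 0 0 0"
    unfolding y_def x(1) elt_comp of_real_mult by (rule E0[OF E1 E2 E3[OF nz]])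
  then have "y \<otimes>\<^bsub>inoue_Aff\<^esub> x = \<one>\<^bsub>inoue_Aff\<^esub>" by (simp add: mult_Aff one_Aff elt_0)
  moreover have "elts \<subseteq> carrier inoue_Aff"
    unfolding elts_def elt_def using \<mu>_pos \<nu> by (auto intro!: tri_in_Aff)
  ultimately have "inv\<^bsub>inoue_Aff\<^esub> x = y"
    using y \<open>x \<in> elts\<close> by (intro group.inv_equality[OF group_Aff]) auto
  then show "inv\<^bsub>inoue_Aff\<^esub> x \<in> elts" using y by simp
qed

text \<open>The imaginary part of the first coordinate is multiplied by \<open>\<mu> powi k\<close>,
  so a small ball can meet its image only for \<open>k = 0\<close>. The remaining unipotent map
  moves some point by a small amount only and is trivial by discreteness.\<close>

lemma small_displacement:
  assumes x: "x \<in> inoue_U"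
  shows "\<exists>\<rho>>0. ball x \<rho> \<subseteq> inoue_U \<and> (\<forall>g\<in>elts. \<forall>y\<in>ball x \<rho>. g y \<in> ball x \<rho> \<longrightarrow> g y = y)"
proof -
  define y0 where "y0 = Im (x $ 1)"
  have y0: "y0 > 0" using x by (simp add: inoue_U_def y0_def)
  obtain \<delta> where \<delta>: "\<delta> > 0" "\<And>s b c w. (s, b, c) \<in> \<Lambda> \<Longrightarrow> cmod (w - x $ 1) < \<delta> \<Longrightarrow> \<bar>s\<bar> < \<delta> \<Longrightarrow>
    cmod (b * w + c) < \<delta>
      \<Longrightarrow> s = 0 \<and> b = 0 \<and> c = 0"
    using discrete y0 unfolding y0_def by metis
  \<comment> \<open>The first bound keeps displacements within the ball below
    \<open>2 * \<rho> \<le> \<delta>\<close>. The second gives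
    \<open>y0 + \<rho> < \<mu> * (y0 - \<rho>)\<close>, so a single dilation already leaves the
    range of imaginary parts.\<close>
  define \<rho> where "\<rho> = min (\<delta> / 2) (y0 * (\<mu> - 1) / (2 * (\<mu> + 1)))"
  have \<rho>: "\<rho> > 0" "2 * \<rho> \<le> \<delta>" using \<delta> y0 \<mu> by (auto simp: \<rho>_def)
  have "\<rho> \<le> y0 * (\<mu> - 1) / (2 * (\<mu> + 1))" by (simp add: \<rho>_def)
  then have "\<rho> * (\<mu> + 1) \<le> y0 * (\<mu> - 1) / 2" using \<mu> by (simp add: field_simps)
  also have "\<dots> < y0 * (\<mu> - 1)" using \<mu> y0 by simp
  finally have \<rho>\<mu>: "y0 + \<rho> < \<mu> * (y0 - \<rho>)" by (simp add: algebra_simps)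
  have \<rho>y: "\<rho> < y0"
  proof (rule ccontr)
    assume "\<not> \<rho> < y0"
    then have "\<mu> * (y0 - \<rho>) \<le> 0" using \<mu> by (simp add: mult_nonneg_nonpos)
    with \<rho>\<mu> y0 \<rho> show False by linarith
  qed
  have comp: "cmod (y $ i - x $ i) < \<rho>" if "y \<in> ball x \<rho>" for y i
    using Finite_Cartesian_Product.norm_nth_le[of "y - x" i] that
      by (simp add: dist_norm norm_minus_commute)
  have Im: "y0 - \<rho> < Im (y $ 1)" "Im (y $ 1) < y0 + \<rho>" if "y \<in> ball x \<rho>" for y
    using abs_Im_le_cmod[of "y $ 1 - x $ 1"] comp[OF that, of 1] by (auto simp: y0_def)
  show ?thesis
  proof (intro exI[of _ \<rho>] conjI ballI impI)
    show "\<rho> > 0" by (rule \<rho>(1))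
    show "ball x \<rho> \<subseteq> inoue_U" using Im \<rho>y by (force simp: inoue_U_def)
    fix g y assume g: "g \<in> elts" and y: "y \<in> ball x \<rho>" and gy: "g y \<in> ball x \<rho>"
    obtain k s b c where g': "g = elt k s b c" "(s, b, c) \<in> \<Lambda>" using g unfolding elts_def by blast
    have gk: "Im (g y $ 1) = \<mu> powi k * Im (y $ 1)"
      by (simp add: g' elt_def tri_def flip: of_real_power_int)
    have "\<not> k \<ge> 1"
    proof
      assume "k \<ge> 1"
      then have "\<mu> powi 1 \<le> \<mu> powi k" using \<mu> by (intro power_int_increasing) auto
      then have "\<mu> * Im (y $ 1) \<le> Im (g y $ 1)" unfolding gk using Im[OF y] \<rho>y
        by (intro mult_right_mono) auto
      moreover have "\<mu> * (y0 - \<rho>) \<le> \<mu> * Im (y $ 1)" using Im[OF y] \<mu> by (intro mult_left_mono) auto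
      ultimately show False using Im[OF gy] \<rho>\<mu> by linarith
    qed
    moreover have "\<not> k \<le> -1"
    proof
      assume "k \<le> -1"
      then have "\<mu> powi (k + 1) \<le> \<mu> powi 0" using \<mu> by (intro power_int_increasing) auto
      then have "\<mu> * \<mu> powi k \<le> 1" using \<mu> by (simp add: power_int_add_1 mult.commute)
      then have "\<mu> * \<mu> powi k * Im (y $ 1) \<le> 1 * Im (y $ 1)" using Im[OF y] \<rho>y
        by (intro mult_right_mono) auto
      then have "\<mu> * Im (g y $ 1) \<le> Im (y $ 1)" unfolding gk by (simp add: mult.assoc)
      moreover have "\<mu> * (y0 - \<rho>) \<le> \<mu> * Im (g y $ 1)" using Im[OF gy] \<mu>
        by (intro mult_left_mono) auto
      ultimately show False using Im[OF y] \<rho>\<mu> by linarith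
    qed
    ultimately have k: "k = 0" by linarith
    have gy1: "g y $ 1 = y $ 1 + of_real s" and gy2: "g y $ 2 = y $ 2 + (b * y $ 1 + c)"
      by (simp_all add: g' elt_def tri_def k add.assoc)
    have d: "cmod (g y $ i - y $ i) < \<delta>" for i
    proof -
      have "cmod (g y $ i - y $ i) \<le> cmod (g y $ i - x $ i) + cmod (y $ i - x $ i)"
        by (metis norm_minus_commute norm_triangle_sub diff_add_cancel norm_triangle_ineq dist_norm
          dist_triangle2)
      then show ?thesis using comp[OF y, of i] comp[OF gy, of i] \<rho> by linarith
    qed
    have "s = 0 \<and> b = 0 \<and> c = 0"
    proof (rule \<delta>(2)[OF g'(2)])
      show "cmod (y $ 1 - x $ 1) < \<delta>" using comp[OF y, of 1] \<rho> by linarith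
      show "\<bar>s\<bar> < \<delta>" using d[of 1] by (simp add: gy1)
      show "cmod (b * y $ 1 + c) < \<delta>" using d[of 2] by (simp add: gy2)
    qed
    then show "g y = y" using gy1 gy2 by (simp add: vec_eq_iff forall_2)
  qed
qed

text \<open>The generated group is placed inside \<open>elts\<close> without being identified with
  it: the statement about small balls passes to subgroups and yields local injectivity of the orbit
  map.\<close>

lemma affine_quotient_generate:
  assumes H: "H \<subseteq> elts"
  shows "affine_quotient inoue_U (generate inoue_Aff H)"
proof -
  interpret group inoue_Aff by (rule group_Aff)
  let ?G = "generate inoue_Aff H"
  have Hc: "H \<subseteq> carrier inoue_Aff" using H subgroup.subset[OF subgroup_elts] by blast
  have G: "subgroup ?G inoue_Aff" using Hc by (rule generate_is_subgroup)
  have GN: "?G \<subseteq> elts" using H subgroup_elts by (rule generate_subgroup_incl)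
  have Gc: "?G \<subseteq> carrier inoue_Aff" using subgroup.subset[OF G] .
  show ?thesis
  proof
    show "open inoue_U" by (rule open_U)
    show "id \<in> ?G" using subgroup.one_closed[OF G] by (simp add: one_Aff)
    show "g \<circ> h \<in> ?G" if "g \<in> ?G" "h \<in> ?G" for g h
      using subgroup.m_closed[OF G that] by (simp add: mult_Aff)
    show "\<exists>h\<in>?G. h \<circ> g = id \<and> g \<circ> h = id" if "g \<in> ?G" for g
    proof -
      have "inv\<^bsub>inoue_Aff\<^esub> g \<in> ?G" using subgroup.m_inv_closed[OF G that] .
      moreover have "inv\<^bsub>inoue_Aff\<^esub> g \<otimes>\<^bsub>inoue_Aff\<^esub> g = \<one>\<^bsub>inoue_Aff\<^esub>"
        "g \<otimes>\<^bsub>inoue_Aff\<^esub> inv\<^bsub>inoue_Aff\<^esub> g = \<one>\<^bsub>inoue_Aff\<^esub>"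
        using that Gc by (auto intro: l_inv r_inv)
      ultimately show ?thesis by (auto simp: mult_Aff one_Aff)
    qed
    show "\<exists>L v. g = (\<lambda>x. L *v x + v)" if "g \<in> ?G" for g using that Gc carrier_AffD by blast
    show "g x \<in> inoue_U" if "g \<in> ?G" "x \<in> inoue_U" for g x
      using that Gc carrier_AffD by blast
    fix x :: "complex^2" assume x: "x \<in> inoue_U"
    obtain \<rho> where \<rho>: "\<rho> > 0" "ball x \<rho> \<subseteq> inoue_U"
      "\<forall>g\<in>elts. \<forall>y\<in>ball x \<rho>. g y \<in> ball x \<rho> \<longrightarrow> g y = y"
      using small_displacement[OF x] by blast
    have "inj_on (orbit_map ?G) (ball x \<rho>)"
    proof (rule inj_onI)
      fix y y' assume y: "y \<in> ball x \<rho>" "y' \<in> ball x \<rho>" and eq: "orbit_map ?G y = orbit_map ?G y'"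
      have "y' \<in> orbit_map ?G y'"
        unfolding orbit_map_def using subgroup.one_closed[OF G]
        by (intro image_eqI[of _ _ id]) (simp_all add: one_Aff)
      then obtain g where "g \<in> ?G" "y' = g y" unfolding eq[symmetric] unfolding orbit_map_def
        by blast
      moreover from this have "g y = y" using \<rho>(3) y GN by blast
      ultimately show "y = y'" by simp
    qed
    then show "\<exists>W. open W \<and> x \<in> W \<and> W \<subseteq> inoue_U \<and> inj_on (orbit_map ?G) W"
      using \<rho> by (intro exI[of _ "ball x \<rho>"]) auto
  qed
qed

end

section \<open>From vanishing invariant tensors to connections on the quotient\<close>

definition invariant_tensors_vanish :: "(complex^2 \<Rightarrow> complex^2) set \<Rightarrow> bool" where
  "invariant_tensors_vanish \<Gamma> \<longleftrightarrow> (\<forall>T.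
     (\<forall>i j. holomorphic_map (\<lambda>x. T x i j) inoue_U) \<longrightarrow>
     (\<forall>\<mu> \<nu> s b c. tri \<mu> \<nu> s b c \<in> \<Gamma> \<longrightarrow> tensor_invariant T \<mu> \<nu> s b c) \<longrightarrow>
     (\<forall>x\<in>inoue_U. \<forall>i j. T x i j = 0))"

text \<open>\<open>invariant_tensors_vanish\<close> is the interface to the three types; it speaks
  of triangular elements of \<open>\<Gamma>\<close>, since the generators are of that form. Applied
  to the lifted Christoffel symbols it identifies every connection with the affine one, whose
  properties are already known.\<close>

lemma unique_connection:
  assumes AQ: "affine_quotient inoue_U \<Gamma>" and zero: "invariant_tensors_vanish \<Gamma>"
  shows "(\<exists>!D. holomorphic_connection (inoue_surface \<Gamma>) D) \<and>
         (\<forall>D. holomorphic_connection (inoue_surface \<Gamma>) D \<longrightarrow>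
            (\<forall>D'. pullback_connection (open_cmfd inoue_U) (inoue_surface \<Gamma>) (orbit_map \<Gamma>) D D'
                    \<longleftrightarrow> D' = trivial_connection inoue_U) \<and>
            flat_connection (inoue_surface \<Gamma>) D \<and>
            torsion_free_connection (inoue_surface \<Gamma>) D)"
proof -
  interpret affine_quotient inoue_U \<Gamma> by (rule AQ)
  have uniq: "D = Q.affine_connection" if D: "holomorphic_connection Q D" for D
  proof -
    interpret C: quotient_connection inoue_U \<Gamma> D by unfold_locales (rule D)
    show ?thesis
    proof (rule C.eq_affine_connection_if_tensor_0)
      have "tensor_invariant C.tensor \<mu> \<nu> s b c" if "tri \<mu> \<nu> s b c \<in> \<Gamma>" for \<mu> \<nu> s b c
        unfolding tensor_invariant_def
        using that by (auto intro!: C.tensor_equivariant[where v = "vector [of_real s, c]"]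
          tri_affine)
      then show "C.tensor x i j = 0" if "x \<in> inoue_U" for x i j
        using zero[unfolded invariant_tensors_vanish_def, rule_format, of C.tensor]
          C.tensor_holomorphic that by blast
    qed
  qed
  show ?thesis
    unfolding inoue_surface_def
    using uniq Q.affine_connection_holomorphic Q.affine_connection_flat
      Q.affine_connection_torsion_free
      pullback_affine_connection_iff by blast
qed

subsection \<open>The groups of type I\<close>

lemma matrix_I_component: 
  "matrix_I a b $ i $ j = (if j = 1 then of_real (a $ i) else if j = 2 then b $ i else cnj (b $ i))"
  using exhaust_3[of j] by (auto simp: matrix_I_def transpose_def of_real_vec_def cnj_vec_def)

lemma matrix_inv_left: "invertible A \<Longrightarrow> matrix_inv A ** A = mat 1"
  unfolding invertible_def matrix_inv_def by (rule someI2_ex) auto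

lemma invertible_transpose: "invertible (A :: complex^'n^'n) \<Longrightarrow> invertible (transpose A)"
  unfolding invertible_def by (metis matrix_transpose_mul transpose_mat)

lemma matrix_I_invertible:
  assumes "compatible \<beta> a b"
  shows "invertible (matrix_I a b)"
proof -
  have "x = 0" if "matrix_I a b *v x = 0" for x
  proof -
    have "matrix_I a b *v x = x$1 *s of_real_vec a + x$2 *s b + x$3 *s cnj_vec b"
      by (simp add: vec_eq_iff matrix_vector_mult_def sum_3 matrix_I_component of_real_vec_def
        cnj_vec_def mult.commute)
    with that have "x$1 = 0 \<and> x$2 = 0 \<and> x$3 = 0"
      using assms unfolding compatible_def by metis
    then show ?thesis by (simp add: vec_eq_iff forall_3)
  qed
  then obtain B where "B ** matrix_I a b = mat 1"
    using matrix_left_invertible_ker[of "matrix_I a b"] by blast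
  then show ?thesis unfolding invertible_def using matrix_left_right_inverse by blast
qed

text \<open>Cancelling the inverse gives \<open>N P = P diag\<close>, so the columns
  \<open>a\<close> and \<open>b\<close> are eigenvectors of an integer matrix. Dilating a lattice
  generator therefore produces an integer combination of generators.\<close>

lemma eigenvector_rows:
  assumes c: "compatible \<beta> a b"
  obtains m :: "3 \<Rightarrow> 3 \<Rightarrow> int" where
    "\<And>i. (\<Sum>j\<in>UNIV. of_int (m i j) * a $ j) = 1 / (cmod \<beta>)\<^sup>2 * a $ i"
    "\<And>i. (\<Sum>j\<in>UNIV. of_int (m i j) * b $ j) = \<beta> * b $ i"
proof -
  let ?P = "matrix_I a b" and ?d = "diag (vector [of_real (1 / (cmod \<beta>)\<^sup>2), \<beta>, cnj \<beta>]) ::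
  complex^3^3"
  define N where "N = ?P ** ?d ** matrix_inv ?P"
  have "integer_matrix N" using c unfolding compatible_def N_def by blast
  then have "\<forall>i j. \<exists>m::int. N $ i $ j = of_int m" unfolding integer_matrix_def Ints_def by blast
  then obtain m :: "3 \<Rightarrow> 3 \<Rightarrow> int" where m: "\<And>i j. N $ i $ j = of_int (m i j)" by metis
  have "matrix_inv ?P ** ?P = mat 1" using matrix_I_invertible[OF c] by (rule matrix_inv_left)
  then have NP: "N ** ?P = ?P ** ?d" unfolding N_def by (simp flip: matrix_mul_assoc)
  have e: "(\<Sum>k\<in>UNIV. of_int (m i k) * ?P $ k $ j) = ?P $ i $ j * ?d $ j $ j" for i j
  proof -
    have "(\<Sum>k\<in>UNIV. of_int (m i k) * ?P $ k $ j) = (N ** ?P) $ i $ j"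
      by (simp add: matrix_matrix_mult_def m)
    also have "\<dots> = (\<Sum>k\<in>UNIV. ?P $ i $ k * ?d $ k $ j)"
      unfolding NP by (simp only: matrix_matrix_mult_def vec_lambda_beta)
    also have "\<dots> = (\<Sum>k\<in>UNIV. if k = j then ?P $ i $ k * ?d $ k $ k else 0)"
      by (intro sum.cong) (auto simp: diag_def)
    finally show ?thesis by simp
  qed
  show thesis
  proof
    fix i
    have "complex_of_real (\<Sum>j\<in>UNIV. of_int (m i j) * a $ j) = of_real (1 / (cmod \<beta>)\<^sup>2 * a $ i)"
      using e[of i 1] by (simp add: matrix_I_component diag_def)
    then show "(\<Sum>j\<in>UNIV. of_int (m i j) * a $ j) = 1 / (cmod \<beta>)\<^sup>2 * a $ i"
      by (simp only: of_real_eq_iff)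
    show "(\<Sum>j\<in>UNIV. of_int (m i j) * b $ j) = \<beta> * b $ i"
      using e[of i 2] by (simp add: matrix_I_component diag_def)
  qed
qed

lemma transpose_matrix_I_vec:
  "transpose (matrix_I a b) *v x = vector [\<Sum>i\<in>UNIV. of_real (a $ i) * x $ i, \<Sum>i\<in>UNIV. b $ i * x $ i,
  \<Sum>i\<in>UNIV. cnj (b $ i) * x $ i]"
  by (simp add: vec_eq_iff forall_3 matrix_vector_mult_def transpose_def matrix_I_component)

text \<open>The complex system with rows \<open>a\<close>, \<open>b\<close>, \<open>cnj b\<close>
  and right-hand side \<open>s\<close>, \<open>q\<close>, \<open>cnj q\<close> has a unique
  solution. Conjugation permutes its equations, so the conjugate is a solution too, and the solution
  is real.\<close>

lemma real_span:
  assumes c: "compatible \<beta> a b"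
  shows "\<exists>x::real^3. (\<Sum>i\<in>UNIV. x $ i * a $ i) = s \<and> (\<Sum>i\<in>UNIV. of_real (x $ i) * b $ i) = q"
proof -
  let ?R = "transpose (matrix_I a b)"
  have "invertible ?R" using matrix_I_invertible[OF c] by (rule invertible_transpose)
  then obtain B where B: "?R ** B = mat 1" "B ** ?R = mat 1" unfolding invertible_def by blast
  define v where "v = (vector [of_real s, q, cnj q] :: complex^3)"
  define x where "x = B *v v"
  have Rx: "?R *v x = v" by (simp add: x_def matrix_vector_mul_assoc B)
  define y where "y = cnj_vec x"
  have "?R *v y = v"
  proof -
    have 1: "(\<Sum>i\<in>UNIV. of_real (a $ i) * x $ i) = of_real s" "(\<Sum>i\<in>UNIV. b $ i * x $ i) = q"
      "(\<Sum>i\<in>UNIV. cnj (b $ i) * x $ i) = cnj q"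
      using Rx unfolding transpose_matrix_I_vec v_def by (simp_all add: vec_eq_iff forall_3)
    have "(\<Sum>i\<in>UNIV. of_real (a $ i) * y $ i) = cnj (\<Sum>i\<in>UNIV. of_real (a $ i) * x $ i)"
      "(\<Sum>i\<in>UNIV. b $ i * y $ i) = cnj (\<Sum>i\<in>UNIV. cnj (b $ i) * x $ i)"
      "(\<Sum>i\<in>UNIV. cnj (b $ i) * y $ i) = cnj (\<Sum>i\<in>UNIV. b $ i * x $ i)"
      by (simp_all add: y_def cnj_vec_def)
    then show ?thesis unfolding transpose_matrix_I_vec 1 v_def by simp
  qed
  then have "y = x" using Rx B(2) by (metis matrix_vector_mul_assoc matrix_vector_mul_lid)
  then have "cnj (x $ i) = x $ i" for i by (simp add: y_def cnj_vec_def vec_eq_iff)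
  then have xr: "x $ i = of_real (Re (x $ i))" for i by (simp add: complex_eq_iff)
  define z where "z = (\<chi> i. Re (x $ i))"
  have xz: "x $ i = of_real (z $ i)" for i using xr[of i] by (simp add: z_def)
  have "complex_of_real (\<Sum>i\<in>UNIV. z $ i * a $ i) = of_real s"
    "(\<Sum>i\<in>UNIV. of_real (z $ i) * b $ i) = q"
    using Rx unfolding transpose_matrix_I_vec v_def
      by (simp_all add: vec_eq_iff forall_3 xz mult.commute)
  then show ?thesis by (intro exI[of _ z]) (simp only: of_real_eq_iff simp_thms)
qed

text \<open>The inverse of the matrix with rows \<open>a\<close>, \<open>b\<close>,
  \<open>cnj b\<close> recovers the integers from the two sums and the conjugate of the second.
  Small sums give integers of modulus below 1.\<close>

lemma lattice_discrete:
  assumes c: "compatible \<beta> a b"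
  shows "\<exists>\<delta>>0. \<forall>n :: 3 \<Rightarrow> int. \<bar>\<Sum>i\<in>UNIV. of_int (n i) * a $ i\<bar> < \<delta>
    \<and> cmod (\<Sum>i\<in>UNIV. of_int (n i) * b $ i) < \<delta> \<longrightarrow> (\<forall>i. n i = 0)"
proof -
  let ?R = "transpose (matrix_I a b)"
  have "invertible ?R" using matrix_I_invertible[OF c] by (rule invertible_transpose)
  then obtain B where B: "B ** ?R = mat 1" unfolding invertible_def by blast
  \<comment> \<open>\<open>S\<close> exceeds every row sum of moduli of \<open>B\<close>; the added
    1 makes this strict and keeps \<open>S\<close> positive.\<close>
  define S where "S = 1 + (\<Sum>i\<in>UNIV. \<Sum>j\<in>UNIV. cmod (B $ i $ j))"
  have S: "S \<ge> 1" by (simp add: S_def sum_nonneg)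
  show ?thesis
  proof (intro exI[of _ "1 / S"] conjI allI impI)
    show "1 / S > 0" using S by simp
    fix n :: "3 \<Rightarrow> int" and i
    assume H: "\<bar>\<Sum>i\<in>UNIV. of_int (n i) * a $ i\<bar> < 1 / S \<and> cmod (\<Sum>i\<in>UNIV. of_int (n i) * b $ i)
      < 1 / S"
    define x where "x = (\<chi> i. complex_of_int (n i))"
    define v where "v = ?R *v x"
    have v1: "v $ 1 = of_real (\<Sum>i\<in>UNIV. of_int (n i) * a $ i)"
      and v2: "v $ 2 = (\<Sum>i\<in>UNIV. of_int (n i) * b $ i)"
      and v3: "v $ 3 = cnj (\<Sum>i\<in>UNIV. of_int (n i) * b $ i)"
      unfolding v_def transpose_matrix_I_vec by (simp_all add: x_def mult.commute)
    have v: "cmod (v $ j) \<le> 1 / S" for j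
      using exhaust_3[of j] H by (auto simp only: v1 v2 v3 complex_mod_cnj norm_of_real)
    have "x = B *v v" unfolding v_def matrix_vector_mul_assoc B by simp
    then have "x $ i = (\<Sum>j\<in>UNIV. B $ i $ j * v $ j)" by (simp add: matrix_vector_mult_def)
    then have "cmod (x $ i) \<le> (\<Sum>j\<in>UNIV. cmod (B $ i $ j) * (1 / S))"
      by (simp only:) (rule sum_norm_le, simp only: norm_mult, intro mult_left_mono v norm_ge_zero)
    also have "\<dots> = (\<Sum>j\<in>UNIV. cmod (B $ i $ j)) / S" by (simp add: sum_divide_distrib)
    also have "\<dots> < 1"
    proof -
      have "(\<Sum>j\<in>UNIV. cmod (B $ i $ j)) \<le> (\<Sum>i\<in>UNIV. \<Sum>j\<in>UNIV. cmod (B $ i $ j))"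
        by (rule member_le_sum) (auto intro: sum_nonneg)
      then have "(\<Sum>j\<in>UNIV. cmod (B $ i $ j)) < S" by (simp add: S_def)
      then show ?thesis using S by simp
    qed
    finally have "\<bar>of_int (n i) :: real\<bar> < 1" by (simp add: x_def)
    then show "n i = 0" by linarith
  qed
qed

definition lattice_I :: "real^3 \<Rightarrow> complex^3 \<Rightarrow> (real \<times> complex) set" where
  "lattice_I a b = {(\<Sum>i\<in>UNIV. of_int (n i) * a $ i, \<Sum>i\<in>UNIV. of_int (n i) * b $ i) | n :: 3 \<Rightarrow> int.
  True}"

lemma lattice_I_combination:
  assumes "(s, q) \<in> lattice_I a b" "(s', q') \<in> lattice_I a b"
  shows "(of_int k * s + of_int l * s', of_int k * q + of_int l * q') \<in> lattice_I a b"
proof -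
  obtain n n' :: "3 \<Rightarrow> int" where n: "s = (\<Sum>i\<in>UNIV. of_int (n i) * a $ i)"
    "q = (\<Sum>i\<in>UNIV. of_int (n i) * b $ i)"
    "s' = (\<Sum>i\<in>UNIV. of_int (n' i) * a $ i)" "q' = (\<Sum>i\<in>UNIV. of_int (n' i) * b $ i)"
    using assms unfolding lattice_I_def by blast
  show ?thesis
    unfolding lattice_I_def n
    by (rule CollectI, rule exI[of _ "\<lambda>i. k * n i + l * n' i"])
      (simp add: sum_distrib_left sum.distrib distrib_right mult.assoc)
qed

text \<open>The eigenvector equations make the lattice stable under the dilation. For the inverse
  dilation the cubic is used: its constant term is -1, so each root satisfies
  \<open>1 / x = x^2 - \<theta>2 x + \<theta>1\<close>, with integer coefficients.\<close>

lemma triangular_group_I: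
  assumes adm: "admissible \<beta>" and c: "compatible \<beta> a b"
  shows "triangular_group (1 / (cmod \<beta>)\<^sup>2) \<beta> 0 {(s, 0, q) | s q. (s, q) \<in> lattice_I a b}"
proof
  have \<beta>: "\<beta> \<noteq> 0" "cmod \<beta> < 1" using adm unfolding admissible_def by auto
  let ?\<mu> = "1 / (cmod \<beta>)\<^sup>2"
  show \<mu>: "?\<mu> > 1" using \<beta> by (simp add: power_less_one_iff)
  show "\<beta> \<noteq> 0" by (rule \<beta>)
  obtain m :: "3 \<Rightarrow> 3 \<Rightarrow> int" where m: "\<And>i. (\<Sum>j\<in>UNIV. of_int (m i j) * a $ j) = ?\<mu> * a $ i"
    "\<And>i. (\<Sum>j\<in>UNIV. of_int (m i j) * b $ j) = \<beta> * b $ i"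
    by (rule eigenvector_rows[OF c]) blast
  have mul: "(?\<mu> * s, \<beta> * q) \<in> lattice_I a b" if sq: "(s, q) \<in> lattice_I a b" for s q
  proof -
    obtain n :: "3 \<Rightarrow> int" where n: "s = (\<Sum>i\<in>UNIV. of_int (n i) * a $ i)"
      "q = (\<Sum>i\<in>UNIV. of_int (n i) * b $ i)"
      using sq unfolding lattice_I_def by blast
    have "?\<mu> * s = (\<Sum>i\<in>UNIV. of_int (n i) * (\<Sum>j\<in>UNIV. of_int (m i j) * a $ j))"
      by (simp only: m n sum_distrib_left mult.left_commute)
    also have "\<dots> = (\<Sum>j\<in>UNIV. of_int (\<Sum>i\<in>UNIV. n i * m i j) * a $ j)"
      by (simp add: sum_3 algebra_simps)
    finally have 1: "?\<mu> * s = (\<Sum>j\<in>UNIV. of_int (\<Sum>i\<in>UNIV. n i * m i j) * a $ j)" .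
    have "\<beta> * q = (\<Sum>i\<in>UNIV. of_int (n i) * (\<Sum>j\<in>UNIV. of_int (m i j) * b $ j))"
      by (simp only: m n sum_distrib_left mult.left_commute)
    also have "\<dots> = (\<Sum>j\<in>UNIV. of_int (\<Sum>i\<in>UNIV. n i * m i j) * b $ j)"
      by (simp add: sum_3 algebra_simps)
    finally have 2: "\<beta> * q = (\<Sum>j\<in>UNIV. of_int (\<Sum>i\<in>UNIV. n i * m i j) * b $ j)" .
    show ?thesis unfolding lattice_I_def 1 2
      by (rule CollectI, rule exI[of _ "\<lambda>j. \<Sum>i\<in>UNIV. n i * m i j"], intro conjI refl TrueI)
  qed
  obtain \<theta>1 \<theta>2 :: int where \<theta>: "{x::complex. x^3 - of_int \<theta>2 * x^2 + of_int \<theta>1 * x - 1 = 0}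
    = {of_real ?\<mu>, \<beta>, cnj \<beta>}"
    using adm unfolding admissible_def by blast
  have inv: "(s / ?\<mu>, q / \<beta>) \<in> lattice_I a b" if sq: "(s, q) \<in> lattice_I a b" for s q
  proof -
    have root: "1 / x = x * x - of_int \<theta>2 * x + of_int \<theta>1" if "x \<in> {of_real ?\<mu>, \<beta>, cnj \<beta>}"
      for x :: complex
    proof -
      have eq: "x^3 - of_int \<theta>2 * x^2 + of_int \<theta>1 * x - 1 = 0" using that \<theta> by blast
      then have "x \<noteq> 0" by auto
      moreover have "x * (x * x - of_int \<theta>2 * x + of_int \<theta>1) = 1"
        using eq by (simp add: power2_eq_square power3_eq_cube algebra_simps)
      ultimately show ?thesis by (simp add: field_simps)
    qed
    have r\<beta>: "1 / \<beta> = \<beta> * \<beta> - of_int \<theta>2 * \<beta> + of_int \<theta>1" by (rule root) simp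
    have "complex_of_real (1 / ?\<mu>) = of_real (?\<mu> * ?\<mu> - of_int \<theta>2 * ?\<mu> + of_int \<theta>1)"
      using root[of "of_real ?\<mu>"] by simp
    then have r\<mu>: "1 / ?\<mu> = ?\<mu> * ?\<mu> - of_int \<theta>2 * ?\<mu> + of_int \<theta>1" by (simp only: of_real_eq_iff)
    have "(of_int 1 * (?\<mu> * (?\<mu> * s)) + of_int (- \<theta>2) * (?\<mu> * s), of_int 1 * (\<beta> * (\<beta> * q))
      + of_int (- \<theta>2) * (\<beta> * q)) \<in> lattice_I a b"
      by (intro lattice_I_combination mul sq)
    from lattice_I_combination[OF this sq, of 1 \<theta>1]
    have "(?\<mu> * (?\<mu> * s) - of_int \<theta>2 * (?\<mu> * s) + of_int \<theta>1 * s, \<beta> * (\<beta> * q) - of_int \<theta>2 * (\<beta> * q)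
      + of_int \<theta>1 * q) \<in> lattice_I a b"
      by simp
    moreover have "s / ?\<mu> = ?\<mu> * (?\<mu> * s) - of_int \<theta>2 * (?\<mu> * s) + of_int \<theta>1 * s"
    proof -
      have "s / ?\<mu> = (1 / ?\<mu>) * s" by simp
      then show ?thesis unfolding r\<mu> by (simp only: distrib_right left_diff_distrib mult.assoc)
    qed
    moreover have "q / \<beta> = \<beta> * (\<beta> * q) - of_int \<theta>2 * (\<beta> * q) + of_int \<theta>1 * q"
    proof -
      have "q / \<beta> = (1 / \<beta>) * q" by simp
      then show ?thesis unfolding r\<beta> by (simp only: distrib_right left_diff_distrib mult.assoc)
    qed
    ultimately show ?thesis by (simp only:)
  qed
  show "\<beta> = 1 \<or> (0::complex) = 0" by simp
  have z: "(0, 0) \<in> lattice_I a b"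
    unfolding lattice_I_def by (rule CollectI, rule exI[of _ "\<lambda>i. 0"]) simp
  then show "(0, 0, 0) \<in> {(s, 0, q) | s q. (s, q) \<in> lattice_I a b}" by blast
  fix s :: real and b' c' :: complex assume x: "(s, b', c') \<in> {(s, 0, q) | s q. (s, q) \<in> lattice_I a
    b}"
  then have x: "b' = 0" "(s, c') \<in> lattice_I a b" by auto
  show "(- s, - b', - c' + b' * of_real s) \<in> {(s, 0, q) | s q. (s, q) \<in> lattice_I a b}"
    using lattice_I_combination[OF x(2) z, of "-1" 0] x(1) by simp
  show "(?\<mu> * s, \<beta> * b' / of_real ?\<mu>, \<beta> * c') \<in> {(s, 0, q) | s q. (s, q) \<in> lattice_I a b}"
    using mul[OF x(2)] x(1) by auto
  show "(s / ?\<mu>, of_real ?\<mu> * b' / \<beta>, c' / \<beta>) \<in> {(s, 0, q) | s q. (s, q) \<in> lattice_I a b}"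
    using inv[OF x(2)] x(1) by auto
  fix s2 :: real and b2 c2 :: complex assume "(s2, b2, c2) \<in> {(s, 0, q) | s q. (s, q) \<in> lattice_I a
    b}"
  then have y: "b2 = 0" "(s2, c2) \<in> lattice_I a b" by auto
  show "(s + s2, b' + b2, c' + c2 + b' * of_real s2) \<in> {(s, 0, q) | s q. (s, q) \<in> lattice_I a b}"
    using lattice_I_combination[OF x(2) y(2), of 1 1] x(1) y(1) by simp
next
  obtain \<delta> where \<delta>: "\<delta> > 0" "\<And>n :: 3 \<Rightarrow> int. \<bar>\<Sum>i\<in>UNIV. of_int (n i) * a $ i\<bar> < \<delta> \<Longrightarrow>
      cmod (\<Sum>i\<in>UNIV. of_int (n i) * b $ i) < \<delta> \<Longrightarrow> (\<forall>i. n i = 0)"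
    using lattice_discrete[OF c] by blast
  show "\<exists>\<delta>>0. \<forall>s b' c' w. (s, b', c') \<in> {(s, 0, q) | s q. (s, q) \<in> lattice_I a b} \<and> cmod (w - w0)
    < \<delta> \<and> \<bar>s\<bar> < \<delta> \<and> cmod (b' * w + c') < \<delta>
      \<longrightarrow> s = 0 \<and> b' = 0 \<and> c' = 0" for w0
  proof (intro exI[of _ \<delta>] conjI allI impI \<delta>(1))
    fix s :: real and b' c' w :: complex
    assume H: "(s, b', c') \<in> {(s, 0, q) | s q. (s, q) \<in> lattice_I a b} \<and> cmod (w - w0) < \<delta> \<and> \<bar>s\<bar> < \<delta>
      \<and> cmod (b' * w + c') < \<delta>"
    then show b': "b' = 0" by auto
    from H obtain n :: "3 \<Rightarrow> int" where n: "s = (\<Sum>i\<in>UNIV. of_int (n i) * a $ i)"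
      "c' = (\<Sum>i\<in>UNIV. of_int (n i) * b $ i)"
      unfolding lattice_I_def by auto
    have "\<forall>i. n i = 0" using H b' by (intro \<delta>(2)) (simp_all flip: n)
    then show "s = 0" "c' = 0" by (simp_all add: n)
  qed
qed

lemma generators_I:
  "(\<lambda>x. vector [of_real (1 / (cmod \<beta>)\<^sup>2) * x$1, \<beta> * x$2]) = tri (1 / (cmod \<beta>)\<^sup>2) \<beta> 0 0 0"
  "(\<lambda>x. vector [x$1 + of_real (s), x$2 + q]) = tri 1 1 s 0 q"
  by (simp_all add: fun_eq_iff tri_def)

lemma group_I_properties:
  assumes adm: "admissible \<beta>" and c: "compatible \<beta> a b"
  shows "affine_quotient inoue_U (group_I \<beta> a b)"
    and "invariant_tensors_vanish (group_I \<beta> a b)"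
proof -
  let ?H = "{tri (1 / (cmod \<beta>)\<^sup>2) \<beta> 0 0 0} \<union> {tri 1 1 (a $ i) 0 (b $ i) | i. True}"
  have G: "group_I \<beta> a b = generate inoue_Aff ?H"
    unfolding group_I_def generators_I ..
  interpret triangular_group "1 / (cmod \<beta>)\<^sup>2" \<beta> 0 "{(s, 0, q) | s q. (s, q) \<in> lattice_I a b}"
    by (rule triangular_group_I[OF adm c])
  have "tri (1 / (cmod \<beta>)\<^sup>2) \<beta> 0 0 0 \<in> elts"
    unfolding elts_def using zero by (intro CollectI exI[of _ 1] exI[of _ 0]) (simp add: elt_def)
  moreover have "tri 1 1 (a $ i) 0 (b $ i) \<in> elts" for i
  proof -
    have "(a $ i, b $ i) \<in> lattice_I a b"
      unfolding lattice_I_def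
      by (rule CollectI, rule exI[of _ "\<lambda>j. if j = i then 1 else 0"])
        (simp add: if_distrib[of of_int] if_distrib[of "\<lambda>x. x * _"] cong: if_cong)
    then show ?thesis
      unfolding elts_def by (intro CollectI exI[of _ 0] exI[of _ "a $ i"] exI[of _ "b $ i"])
        (simp add: elt_def)
  qed
  ultimately have "?H \<subseteq> elts" by blast
  then show "affine_quotient inoue_U (group_I \<beta> a b)"
    unfolding G by (rule affine_quotient_generate)
  have \<beta>: "\<beta> \<noteq> 0" "cmod \<beta> < 1" using adm unfolding admissible_def by auto
  show "invariant_tensors_vanish (group_I \<beta> a b)"
    unfolding invariant_tensors_vanish_def
  proof (intro allI impI ballI)
    fix T x i j
    assume hol: "\<forall>i j. holomorphic_map (\<lambda>x. T x i j) inoue_U"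
      and eq: "\<forall>\<mu> \<nu> s b' c. tri \<mu> \<nu> s b' c \<in> group_I \<beta> a b \<longrightarrow> tensor_invariant T \<mu> \<nu> s b' c"
      and x: "x \<in> inoue_U"
    note eq' = eq[rule_format]
    show "T x i j = 0"
    proof (rule tensor_zero_I[OF \<beta> real_span[OF c] hol[rule_format] eq' eq' x])
      show "tri 1 1 (a $ i) 0 (b $ i) \<in> group_I \<beta> a b" for i unfolding G
        by (rule generate.incl) blast
      show "tri (1 / (cmod \<beta>)\<^sup>2) \<beta> 0 0 0 \<in> group_I \<beta> a b" unfolding G by (rule generate.incl) blast
    qed
  qed
qed

subsection \<open>The groups of types II and III\<close>

text \<open>In the coordinate \<open>c - s b / 2\<close> the group law of the maps \<open>(w + s, z + b w + c)\<close> becomes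
  the symmetric Heisenberg law; \<open>hc\<close> and \<open>\<eta>\<close> below are these coordinates. Type II is
  \<open>\<epsilon> = 1\<close>, type III is \<open>\<epsilon> = -1\<close>.\<close>

locale heisenberg_data =
  fixes a b c hc :: "real^2" and r :: nat and \<alpha> \<epsilon> :: real and t :: complex and n11 n12 n21 n22 m1 m2
    :: int
    and \<delta> \<kappa> :: real
  assumes indep: "a$1 * b$2 - a$2 * b$1 \<noteq> 0" and r: "r \<ge> 1"
    and \<alpha>: "\<alpha> > 1" and \<epsilon>: "\<epsilon> = 1 \<or> \<epsilon> = -1" and \<epsilon>t: "\<epsilon> = 1 \<or> t = 0"
    and \<delta>: "\<delta> = b$1 * a$2 - b$2 * a$1" and \<kappa>: "\<kappa> = \<delta> / real r"
    and Na: "of_int n11 * a$1 + of_int n12 * a$2 = \<alpha> * a$1" "of_int n21 * a$1 + of_int n22 * a$2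
      = \<alpha> * a$2"
    and Nb: "of_int n11 * b$1 + of_int n12 * b$2 = \<epsilon> / \<alpha> * b$1" "of_int n21 * b$1 + of_int n22 * b$2
      = \<epsilon> / \<alpha> * b$2"
    and hc: "hc$1 = c$1 - a$1 * b$1 / 2" "hc$2 = c$2 - a$2 * b$2 / 2"
    and cond: "\<epsilon> * hc$1 = of_int n11 * hc$1 + of_int n12 * hc$2 + \<delta> / 2 * of_int (n11 * n12)
      + \<kappa> * of_int m1"
      "\<epsilon> * hc$2 = of_int n21 * hc$1 + of_int n22 * hc$2 + \<delta> / 2 * of_int (n21 * n22)
      + \<kappa> * of_int m2"
begin

lemma \<delta>_nonzero: "\<delta> \<noteq> 0"
  using indep by (simp add: \<delta> algebra_simps)

lemma \<delta>\<kappa>: "\<delta> = \<kappa> * real r"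
  using r by (simp add: \<kappa>)

lemma \<kappa>_nonzero: "\<kappa> \<noteq> 0"
  using \<delta>_nonzero \<delta>\<kappa> by auto

text \<open>Comparing the area spanned by \<open>a\<close> and \<open>b\<close> with that of their
  images under \<open>N\<close> gives the determinant
  \<open>\<alpha> * (\<epsilon> / \<alpha>) = \<epsilon>\<close>; so \<open>N\<close> is invertible
  over the integers.\<close>

lemma det: "n11 * n22 - n12 * n21 = (if \<epsilon> = 1 then 1 else -1)"
proof -
  have "of_int (n11 * n22 - n12 * n21) * (a$1 * b$2 - a$2 * b$1)
      = (of_int n11 * a$1 + of_int n12 * a$2) * (of_int n21 * b$1 + of_int n22 * b$2)
        - (of_int n21 * a$1 + of_int n22 * a$2) * (of_int n11 * b$1 + of_int n12 * b$2)"
    by (simp add: algebra_simps)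
  also have "\<dots> = \<epsilon> * (a$1 * b$2 - a$2 * b$1)"
    unfolding Na Nb using \<alpha> by (simp add: field_simps)
  finally have "real_of_int (n11 * n22 - n12 * n21) = \<epsilon>" using indep by simp
  then have "real_of_int (n11 * n22 - n12 * n21) = of_int (if \<epsilon> = 1 then 1 else -1)" using \<epsilon> by auto
  then show ?thesis by (simp only: of_int_eq_iff)
qed

definition e :: int where "e = (if \<epsilon> = 1 then 1 else -1)"

lemma e: "of_int e = \<epsilon>" "e * e = 1" "n11 * n22 - n12 * n21 = e" "e = 1 \<or> e = -1"
  using \<epsilon> det by (auto simp: e_def)

definition \<eta> :: "int \<Rightarrow> int \<Rightarrow> int \<Rightarrow> real" where
  "\<eta> k l m = of_int k * hc$1 + of_int l * hc$2 + \<delta> / 2 * of_int (k * l) + \<kappa> * of_int m"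

definition sa :: "int \<Rightarrow> int \<Rightarrow> real" where "sa k l = of_int k * a$1 + of_int l * a$2"
definition sb :: "int \<Rightarrow> int \<Rightarrow> real" where "sb k l = of_int k * b$1 + of_int l * b$2"

text \<open>The triple of \<open>g1^k g2^l g3^m\<close>. The summand with \<open>k * l\<close> in
  \<open>\<eta>\<close> is the cocycle of the symmetric Heisenberg law for the first two factors,
  and adding half of \<open>sa * sb\<close> returns to the original coordinate.\<close>

definition heis_elt :: "int \<Rightarrow> int \<Rightarrow> int \<Rightarrow> real \<times> complex \<times> complex" where
  "heis_elt k l m = (sa k l, of_real (sb k l), of_real (\<eta> k l m + sa k l * sb k l / 2))"

definition \<Lambda> :: "(real \<times> complex \<times> complex) set" where
  "\<Lambda> = {heis_elt k l m | k l m. True}"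

lemma even_product: obtains T :: int where "n * (n - 1) = 2 * T"
proof -
  have "even (n * (n - 1))" by simp
  then show thesis using that by (metis dvd_def)
qed

text \<open>Conjugation by \<open>g0\<close> acts on the exponents \<open>(k, l)\<close> by right
  multiplication with \<open>N\<close>. \<open>cond\<close> treats the two generators; for general
  exponents the quadratic terms contribute an integer multiple of \<open>\<delta>\<close>, hence of
  \<open>\<kappa>\<close>. The shift \<open>F\<close> is independent of \<open>m\<close>, which the
  inversion below exploits.\<close>

lemma \<eta>_conj: "\<exists>F. \<forall>m. \<epsilon> * \<eta> k l m = \<eta> (k * n11 + l * n21) (k * n12 + l * n22) (F + e * m)"
proof -
  obtain S where S: "k * (k - 1) = 2 * S" by (rule even_product)
  obtain T where T: "l * (l - 1) = 2 * T" by (rule even_product)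
  \<comment> \<open>\<open>2 * E\<close> is the discrepancy between the two quadratic expressions.
    It is even because \<open>k * (k - 1)\<close> and \<open>l * (l - 1)\<close> are, so the half in
    front of \<open>\<delta>\<close> disappears.\<close>
  define E where "E = - (n11 * n12 * S) - n21 * n22 * T - k * l * n12 * n21"
  have E: "k * n11 * n12 + l * n21 * n22 + e * (k * l) = (k * n11 + l * n21) * (k * n12 + l * n22)
    + 2 * E"
  proof -
    have "(k * n11 + l * n21) * (k * n12 + l * n22) + 2 * E
       = k * k * n11 * n12 + l * l * n21 * n22 + k * l * (n11 * n22 - n12 * n21)
       - n11 * n12 * (2 * S) - n21 * n22 * (2 * T)"
      by (simp add: E_def algebra_simps)
    also have "\<dots> = k * n11 * n12 + l * n21 * n22 + e * (k * l)"
      unfolding e(3) S[symmetric] T[symmetric] by (simp add: algebra_simps)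
    finally show ?thesis by simp
  qed
  have "\<epsilon> * \<eta> k l m = \<eta> (k * n11 + l * n21) (k * n12 + l * n22) ((k * m1 + l * m2 + int r * E)
    + e * m)" for m
  proof -
    have "\<epsilon> * \<eta> k l m = of_int k * (\<epsilon> * hc$1) + of_int l * (\<epsilon> * hc$2) + \<delta> / 2 * of_int (e * (k * l))
      + \<kappa> * of_int (e * m)"
      unfolding \<eta>_def by (simp add: e(1) algebra_simps)
    also have "\<dots> = of_int (k * n11 + l * n21) * hc$1 + of_int (k * n12 + l * n22) * hc$2
        + \<delta> / 2 * of_int (k * n11 * n12 + l * n21 * n22 + e * (k * l)) + \<kappa> * of_int (k * m1 + l * m2
        + e * m)"
      unfolding cond by (simp add: algebra_simps)
    also have "\<dots> = \<eta> (k * n11 + l * n21) (k * n12 + l * n22) ((k * m1 + l * m2 + int r * E)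
      + e * m)"
      unfolding E \<eta>_def by (simp add: \<delta>\<kappa> algebra_simps)
    finally show ?thesis .
  qed
  then show ?thesis by blast
qed

lemma sa_conj: "sa (k * n11 + l * n21) (k * n12 + l * n22) = \<alpha> * sa k l"
proof -
  have "sa (k * n11 + l * n21) (k * n12 + l * n22)
    = of_int k * (of_int n11 * a$1 + of_int n12 * a$2) + of_int l * (of_int n21 * a$1
    + of_int n22 * a$2)"
    by (simp add: sa_def algebra_simps)
  then show ?thesis unfolding Na by (simp add: sa_def algebra_simps)
qed

lemma sb_conj: "sb (k * n11 + l * n21) (k * n12 + l * n22) = \<epsilon> / \<alpha> * sb k l"
proof -
  have "sb (k * n11 + l * n21) (k * n12 + l * n22)
    = of_int k * (of_int n11 * b$1 + of_int n12 * b$2) + of_int l * (of_int n21 * b$1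
    + of_int n22 * b$2)"
    by (simp add: sb_def algebra_simps)
  then show ?thesis unfolding Nb by (simp add: sb_def algebra_simps)
qed

definition conj_heis_elt :: "real \<times> complex \<times> complex \<Rightarrow> real \<times> complex \<times> complex" where
  "conj_heis_elt = (\<lambda>(s, b, c). (\<alpha> * s, of_real \<epsilon> * b / of_real \<alpha>, of_real \<epsilon> * c))"

lemma heis_elt_conj: "\<exists>F. \<forall>m. conj_heis_elt (heis_elt k l m)
  = heis_elt (k * n11 + l * n21) (k * n12 + l * n22) (F + e * m)"
proof -
  obtain F where F: "\<And>m. \<epsilon> * \<eta> k l m = \<eta> (k * n11 + l * n21) (k * n12 + l * n22) (F + e * m)"
    using \<eta>_conj by blast
  have "conj_heis_elt (heis_elt k l m) = heis_elt (k * n11 + l * n21) (k * n12 + l * n22)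
    (F + e * m)" for m
  proof -
    have "conj_heis_elt (heis_elt k l m)
      = (\<alpha> * sa k l, of_real (\<epsilon> / \<alpha> * sb k l), of_real (\<epsilon> * \<eta> k l m
      + (\<alpha> * sa k l) * (\<epsilon> / \<alpha> * sb k l) / 2))"
      using \<alpha> by (simp add: conj_heis_elt_def heis_elt_def field_simps)
    then show ?thesis unfolding F heis_elt_def sa_conj sb_conj .
  qed
  then show ?thesis by blast
qed

lemma heis_elt_mult: "\<exists>m''. (sa k l + sa k' l', of_real (sb k l) + of_real (sb k' l'),
    of_real (\<eta> k l m + sa k l * sb k l / 2) + of_real (\<eta> k' l' m' + sa k' l' * sb k' l' / 2)
    + of_real (sb k l) * of_real (sa k' l')) = heis_elt (k + k') (l + l') m''"
\<comment> \<open>Moving \<open>g2^l\<close> past \<open>g1^k'\<close> costs \<open>- l * k'\<close>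
  times \<open>\<delta> = \<kappa> * r\<close>.\<close>
proof (rule exI[of _ "m + m' - int r * l * k'"])
  have "sb k l * sa k' l' - sa k l * sb k' l' = \<delta> * of_int (k * l' - l * k')"
    by (simp add: sa_def sb_def \<delta> algebra_simps)
  then have "\<eta> k l m + sa k l * sb k l / 2 + (\<eta> k' l' m' + sa k' l' * sb k' l' / 2)
    + sb k l * sa k' l'
    = \<eta> (k + k') (l + l') (m + m' - int r * l * k') + (sa k l + sa k' l') * (sb k l + sb k' l') / 2"
    unfolding \<eta>_def unfolding \<delta>\<kappa> by (simp add: field_simps)
  moreover have "sa (k + k') (l + l') = sa k l + sa k' l'"
    "sb (k + k') (l + l') = sb k l + sb k' l'"
    by (simp_all add: sa_def sb_def algebra_simps)
  ultimately show "(sa k l + sa k' l', of_real (sb k l) + of_real (sb k' l'),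
    of_real (\<eta> k l m + sa k l * sb k l / 2) + of_real (\<eta> k' l' m' + sa k' l' * sb k' l' / 2)
    + of_real (sb k l) * of_real (sa k' l')) = heis_elt (k + k') (l + l') (m + m' - int r * l * k')"
    unfolding heis_elt_def by (simp only: of_real_add[symmetric] of_real_mult[symmetric])
qed

lemma heis_elt_inverse: "(- sa k l, - of_real (sb k l), - of_real (\<eta> k l m + sa k l * sb k l / 2)
  + of_real (sb k l) * of_real (sa k l))
    = heis_elt (- k) (- l) (- m - int r * (k * l))"
proof -
  have h1: "- (\<eta> k l m + sa k l * sb k l / 2) + sb k l * sa k l
    = \<eta> (- k) (- l) (- m - int r * (k * l)) + sa k l * sb k l / 2"
    unfolding \<eta>_def unfolding \<delta>\<kappa> by (simp add: field_simps)
  have h2: "sa (- k) (- l) = - sa k l" "sb (- k) (- l) = - sb k l"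
    by (simp_all add: sa_def sb_def)
  show ?thesis
    unfolding heis_elt_def h2 minus_mult_minus
    by (simp only: of_real_minus[symmetric] of_real_add[symmetric] of_real_mult[symmetric] h1)
qed

text \<open>As \<open>N\<close> has determinant \<open>e\<close>, the integer inverse is
  \<open>e\<close> times the adjugate; this gives \<open>k'\<close> and \<open>l'\<close>. Since
  \<open>F\<close> does not depend on \<open>m\<close>, the equation \<open>F + e * m' = m\<close>
  is solved by \<open>m' = e * (m - F)\<close>.\<close>

lemma heis_elt_conj_inverse: "\<exists>k' l' m'. conj_heis_elt (heis_elt k' l' m') = heis_elt k l m"
proof -
  define k' where "k' = e * (n22 * k - n21 * l)"
  define l' where "l' = e * (n11 * l - n12 * k)"
  have "k' * n11 + l' * n21 = e * (n11 * n22 - n12 * n21) * k"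
    "k' * n12 + l' * n22 = e * (n11 * n22 - n12 * n21) * l"
    by (simp_all add: k'_def l'_def algebra_simps)
  then have kl: "k' * n11 + l' * n21 = k" "k' * n12 + l' * n22 = l" by (simp_all add: e)
  obtain F where F: "\<And>m. conj_heis_elt (heis_elt k' l' m) = heis_elt k l (F + e * m)"
    using heis_elt_conj[of k' l'] unfolding kl by blast
  have "F + e * (e * (m - F)) = F + (e * e) * (m - F)" by (simp only: mult.assoc)
  then have "F + e * (e * (m - F)) = m" by (simp add: e(2))
  then have "conj_heis_elt (heis_elt k' l' (e * (m - F))) = heis_elt k l m" by (simp only: F)
  then show ?thesis by blast
qed

lemma heis_elt_0: "heis_elt 0 0 0 = (0, 0, 0)"
  by (simp add: heis_elt_def sa_def sb_def \<eta>_def)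

text \<open>The third entry is real, so the vertical displacement has imaginary part
  \<open>sb k l * Im w\<close>, which controls \<open>sb\<close>; \<open>sa\<close> is small by
  assumption. Cramer's rule then makes \<open>k\<close> and \<open>l\<close> vanish, and a small
  multiple of \<open>\<kappa>\<close> remains.\<close>

lemma small_heis_elt:
  assumes y: "Im w0 > 0"
  shows "\<exists>d>0. \<forall>k l m w. cmod (w - w0) < d \<and> \<bar>sa k l\<bar> < d
    \<and> cmod (of_real (sb k l) * w + of_real (\<eta> k l m + sa k l * sb k l / 2)) < d
      \<longrightarrow> heis_elt k l m = (0, 0, 0)"
proof -
  define y0 where "y0 = Im w0"
  define B where "B = 1 + \<bar>a$1\<bar> + \<bar>a$2\<bar> + \<bar>b$1\<bar> + \<bar>b$2\<bar>"
  have B: "B > 0" "\<bar>a$i\<bar> \<le> B" "\<bar>b$i\<bar> \<le> B" for i using exhaust_2[of i] by (auto simp: B_def)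
  define D where "D = \<bar>\<delta>\<bar> / (2 * B)"
  have D: "D > 0" using \<delta>_nonzero B by (simp add: D_def)
  \<comment> \<open>In turn: \<open>Im w\<close> stays above \<open>y0 / 2\<close>;
    \<open>sa\<close> is below \<open>D\<close>; \<open>sb\<close> is below \<open>D\<close> after
    division by \<open>y0 / 2\<close>; a multiple of \<open>\<kappa>\<close> smaller than
    \<open>\<kappa>\<close> in modulus is 0. The value of \<open>D\<close> makes two terms of size
    \<open>D * B\<close> add up to the modulus of \<open>\<delta>\<close>.\<close>
  define d where "d = Min {y0 / 2, D, D * y0 / 2, \<bar>\<kappa>\<bar>}"
  have d: "d > 0" "d \<le> y0 / 2" "d \<le> D" "d \<le> D * y0 / 2" "d \<le> \<bar>\<kappa>\<bar>"
    using y D \<kappa>_nonzero by (auto simp: d_def y0_def)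
  show ?thesis
  proof (intro exI[of _ d] conjI allI impI d(1))
    fix k l m w
    assume H: "cmod (w - w0) < d \<and> \<bar>sa k l\<bar> < d
      \<and> cmod (of_real (sb k l) * w + of_real (\<eta> k l m + sa k l * sb k l / 2)) < d"
    have "\<bar>Im w - y0\<bar> < d" using H abs_Im_le_cmod[of "w - w0"] by (simp add: y0_def)
    then have Iw: "Im w > y0 / 2" using d(2) by linarith
    have "\<bar>sb k l * Im w\<bar> < d"
      using H abs_Im_le_cmod[of "of_real (sb k l) * w + of_real (\<eta> k l m + sa k l * sb k l / 2)"]
        by simp
    then have "\<bar>sb k l\<bar> * Im w < D * (y0 / 2)" using d(4) Iw y by (simp add: abs_mult y0_def)
    moreover have "\<bar>sb k l\<bar> * (y0 / 2) \<le> \<bar>sb k l\<bar> * Im w" using Iw by (intro mult_left_mono) auto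
    ultimately have "\<bar>sb k l\<bar> * (y0 / 2) < D * (y0 / 2)" by linarith
    then have sb: "\<bar>sb k l\<bar> < D" using y by (simp add: y0_def)
    have sa: "\<bar>sa k l\<bar> < D" using H d(3) by linarith
    have bound: "\<bar>sb k l * p - sa k l * q\<bar> < \<bar>\<delta>\<bar>" if "\<bar>p\<bar> \<le> B" "\<bar>q\<bar> \<le> B" for p q
    proof -
      have "\<bar>sb k l * p\<bar> \<le> \<bar>sb k l\<bar> * B" "\<bar>sa k l * q\<bar> \<le> \<bar>sa k l\<bar> * B"
        using that by (auto simp: abs_mult intro: mult_left_mono)
      moreover have "\<bar>sb k l\<bar> * B < D * B" "\<bar>sa k l\<bar> * B < D * B" using sa sb B
        by (auto intro: mult_strict_right_mono)
      moreover have "D * B + D * B = \<bar>\<delta>\<bar>" using B by (simp add: D_def)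
      ultimately show ?thesis by linarith
    qed
    \<comment> \<open>Cramer's rule: up to sign, \<open>\<delta>\<close> is the determinant of the
      system that expresses \<open>sa\<close> and \<open>sb\<close> through \<open>k\<close> and
      \<open>l\<close>.\<close>
    have "sb k l * a$2 - sa k l * b$2 = of_int k * \<delta>" "sb k l * a$1 - sa k l * b$1 = - of_int l * \<delta>"
      by (simp_all add: sa_def sb_def \<delta> algebra_simps)
    then have "\<bar>of_int k * \<delta>\<bar> < \<bar>\<delta>\<bar>" "\<bar>- of_int l * \<delta>\<bar> < \<bar>\<delta>\<bar>"
      using bound[OF B(2)[of 2] B(3)[of 2]] bound[OF B(2)[of 1] B(3)[of 1]] by auto
    then have "\<bar>real_of_int k\<bar> < 1" "\<bar>real_of_int l\<bar> < 1" using \<delta>_nonzero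
      by (simp_all add: abs_mult)
    then have kl: "k = 0" "l = 0" by linarith+
    have z: "sa 0 0 = 0" "sb 0 0 = 0" "\<eta> 0 0 m = \<kappa> * of_int m"
      by (simp_all add: sa_def sb_def \<eta>_def)
    have "cmod (of_real (\<kappa> * of_int m)) < d" using H unfolding kl z by simp
    then have "\<bar>\<kappa>\<bar> * \<bar>real_of_int m\<bar> < \<bar>\<kappa>\<bar> * 1" using d(5) by (simp only: norm_of_real abs_mult)
    then have "\<bar>real_of_int m\<bar> < 1" using \<kappa>_nonzero by simp
    then have "m = 0" by linarith
    then show "heis_elt k l m = (0, 0, 0)" using kl heis_elt_0 by simp
  qed
qed

sublocale triangular_group \<alpha> "of_real \<epsilon>" t \<Lambda>
proof
  show "\<alpha> > 1" by (rule \<alpha>)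
  show "complex_of_real \<epsilon> \<noteq> 0" "complex_of_real \<epsilon> = 1 \<or> t = 0" using \<epsilon> \<epsilon>t by auto
  show "(0, 0, 0) \<in> \<Lambda>" unfolding \<Lambda>_def using heis_elt_0[symmetric] by blast
next
  fix s :: real and b c :: complex assume x: "(s, b, c) \<in> \<Lambda>"
  then obtain k l m where klm: "heis_elt k l m = (s, b, c)" unfolding \<Lambda>_def by force
  then have x: "s = sa k l" "b = of_real (sb k l)" "c = of_real (\<eta> k l m + sa k l * sb k l / 2)"
    by (auto simp: heis_elt_def)
  show "(- s, - b, - c + b * of_real s) \<in> \<Lambda>" unfolding x heis_elt_inverse \<Lambda>_def by blast
  obtain F where F: "conj_heis_elt (heis_elt k l m)
    = heis_elt (k * n11 + l * n21) (k * n12 + l * n22) (F + e * m)"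
    using heis_elt_conj by blast
  have "conj_heis_elt (s, b, c) \<in> \<Lambda>" using F unfolding klm \<Lambda>_def by blast
  then show "(\<alpha> * s, of_real \<epsilon> * b / of_real \<alpha>, of_real \<epsilon> * c) \<in> \<Lambda>" by (simp add: conj_heis_elt_def)
  obtain k' l' m' where inv: "conj_heis_elt (heis_elt k' l' m') = heis_elt k l m"
    using heis_elt_conj_inverse by blast
  obtain s' b' c' where heis_elt': "heis_elt k' l' m' = (s', b', c')" by (metis prod_cases3)
  have "(s, b, c) = (\<alpha> * s', of_real \<epsilon> * b' / of_real \<alpha>, of_real \<epsilon> * c')"
    using inv unfolding klm heis_elt' by (simp add: conj_heis_elt_def)
  then have "(s / \<alpha>, of_real \<alpha> * b / of_real \<epsilon>, c / of_real \<epsilon>) = (s', b', c')" using \<alpha> \<epsilon> by auto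
  then show "(s / \<alpha>, of_real \<alpha> * b / of_real \<epsilon>, c / of_real \<epsilon>) \<in> \<Lambda>" unfolding \<Lambda>_def using heis_elt'
    by (metis (mono_tags, lifting) mem_Collect_eq)
  fix s2 :: real and b2 c2 :: complex assume "(s2, b2, c2) \<in> \<Lambda>"
  then obtain k2 l2 m2 where "heis_elt k2 l2 m2 = (s2, b2, c2)" unfolding \<Lambda>_def by force
  then have y: "s2 = sa k2 l2" "b2 = of_real (sb k2 l2)"
    "c2 = of_real (\<eta> k2 l2 m2 + sa k2 l2 * sb k2 l2 / 2)" by (auto simp: heis_elt_def)
  show "(s + s2, b + b2, c + c2 + b * of_real s2) \<in> \<Lambda>"
    unfolding x y \<Lambda>_def using heis_elt_mult by blast
next
  fix w0 :: complex assume "Im w0 > 0"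
  from small_heis_elt[OF this] show "\<exists>d>0. \<forall>s b c w. (s, b, c) \<in> \<Lambda> \<and> cmod (w - w0) < d \<and> \<bar>s\<bar> < d
    \<and> cmod (b * w + c) < d \<longrightarrow> s = 0 \<and> b = 0 \<and> c = 0"
    unfolding \<Lambda>_def heis_elt_def by (elim exE conjE, intro exI conjI) (assumption, force)
qed

sublocale nilpotent_data a b c \<kappa>
  by unfold_locales (use indep \<kappa>_nonzero in auto)

definition generators :: "(complex^2 \<Rightarrow> complex^2) set" where
  "generators = {tri \<alpha> (of_real \<epsilon>) 0 0 t} \<union> (range g \<union> {g3})"

lemma generators_in: "generators \<subseteq> elts"
proof -
  have "tri \<alpha> (of_real \<epsilon>) 0 0 t \<in> elts"
    unfolding elts_def using zero by (intro CollectI exI[of _ 1] exI[of _ 0]) (simp add: elt_def)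
  moreover have L: "tri 1 1 s b' c' \<in> elts" if "(s, b', c') \<in> \<Lambda>" for s b' c'
    unfolding elts_def using that by (intro CollectI exI[of _ 0] exI[of _ s] exI[of _ b']
      exI[of _ c']) (simp add: elt_def)
  have "heis_elt 1 0 0 = (a $ 1, of_real (b $ 1), of_real (c $ 1))"
    "heis_elt 0 1 0 = (a $ 2, of_real (b $ 2), of_real (c $ 2))"
    "heis_elt 0 0 1 = (0, 0, of_real \<kappa>)"
    by (simp_all add: heis_elt_def sa_def sb_def \<eta>_def hc)
  then have "(a $ 1, of_real (b $ 1), of_real (c $ 1)) \<in> \<Lambda>"
    "(a $ 2, of_real (b $ 2), of_real (c $ 2)) \<in> \<Lambda>"
    "(0, 0, of_real \<kappa>) \<in> \<Lambda>"
    unfolding \<Lambda>_def by (metis (mono_tags, lifting) mem_Collect_eq)+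
  then have "g i \<in> elts" "g3 \<in> elts" for i using exhaust_2[of i] by (auto intro: L)
  ultimately show ?thesis unfolding generators_def by blast
qed

lemma group_properties:
  shows "affine_quotient inoue_U (generate inoue_Aff generators)"
    and "invariant_tensors_vanish (generate inoue_Aff generators)"
proof -
  show "affine_quotient inoue_U (generate inoue_Aff generators)"
    using generators_in by (rule affine_quotient_generate)
  have \<epsilon>': "complex_of_real \<epsilon> = 1 \<or> complex_of_real \<epsilon> = -1" using \<epsilon> by auto
  show "invariant_tensors_vanish (generate inoue_Aff generators)"
    unfolding invariant_tensors_vanish_def
  proof (intro allI impI ballI)
    fix T x i j
    assume hol: "\<forall>i j. holomorphic_map (\<lambda>x. T x i j) inoue_U"
      and eq: "\<forall>\<mu> \<nu> s b' c. tri \<mu> \<nu> s b' c \<in> generate inoue_Aff generators \<longrightarrow>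
        tensor_invariant T \<mu> \<nu> s b' c"
      and x: "x \<in> inoue_U"
    note eq' = eq[rule_format]
    show "T x i j = 0"
    proof (rule tensor_zero[OF \<alpha> \<epsilon>' hol[rule_format] eq' eq' eq' x])
      show "g i \<in> generate inoue_Aff generators" for i
        by (rule generate.incl) (auto simp: generators_def)
      show "g3 \<in> generate inoue_Aff generators" by (rule generate.incl) (auto simp: generators_def)
      show "tri \<alpha> (of_real \<epsilon>) 0 0 t \<in> generate inoue_Aff generators"
        by (rule generate.incl) (auto simp: generators_def)
    qed
  qed
qed

end

section \<open>Reading off the data of types II and III\<close>

lemma conj_diag_integer:
  assumes ind: "lin_indep_pair a b" and N: "N = conj_diag a b \<alpha> \<beta>" "integer_matrix N"
  shows "a$1 * b$2 - a$2 * b$1 \<noteq> 0"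
    and "\<exists>n11 n12 n21 n22. N$1$1 = of_int n11 \<and> N$1$2 = of_int n12 \<and> N$2$1 = of_int n21 \<and> N$2$2
      = of_int n22 \<and>
      of_int n11 * a$1 + of_int n12 * a$2 = \<alpha> * a$1 \<and> of_int n21 * a$1 + of_int n22 * a$2
      = \<alpha> * a$2 \<and>
      of_int n11 * b$1 + of_int n12 * b$2 = \<beta> * b$1 \<and> of_int n21 * b$1 + of_int n22 * b$2 = \<beta> * b$2"
proof -
  let ?P = "transpose (vector [a, b]) :: real^2^2"
  show d: "a$1 * b$2 - a$2 * b$1 \<noteq> 0"
  proof
    assume 0: "a$1 * b$2 - a$2 * b$1 = 0"
    \<comment> \<open>With determinant 0 the coefficients \<open>b$i\<close> and
      \<open>- a$i\<close> give relations between \<open>a\<close> and \<open>b\<close>.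
      Independence makes all entries 0, and then the coefficients 1 and 0 violate it.\<close>
    have "b$i *s a + (- a$i) *s b = 0" for i
      using 0 exhaust_2[of i] by (auto simp: vec_eq_iff forall_2 algebra_simps)
    then have z: "a$i = 0 \<and> b$i = 0" for i using ind unfolding lin_indep_pair_def by fastforce
    then have "1 *s a + 0 *s b = 0" by (simp add: vec_eq_iff)
    then show False using ind unfolding lin_indep_pair_def by fastforce
  qed
  have P: "?P $ i $ j = (if j = 1 then a $ i else b $ i)" for i j
    using exhaust_2[of j] by (auto simp: transpose_def)
  have "det ?P \<noteq> 0" using d by (simp add: det_2 P algebra_simps)
  then have "invertible ?P" by (simp add: invertible_det_nz)
  then have "matrix_inv ?P ** ?P = mat 1" by (rule matrix_inv_left)
  then have NP: "N ** ?P = ?P ** diag (vector [\<alpha>, \<beta>])"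
    unfolding N(1) conj_diag_def Let_def by (simp flip: matrix_mul_assoc)
  have e: "N$i$1 * ?P$1$j + N$i$2 * ?P$2$j = ?P$i$1 * diag (vector [\<alpha>, \<beta>]) $ 1 $ j
    + ?P$i$2 * diag (vector [\<alpha>, \<beta>]) $ 2 $ j" for i j
  proof -
    have "(N ** ?P) $ i $ j = (?P ** diag (vector [\<alpha>, \<beta>])) $ i $ j" by (simp only: NP)
    then show ?thesis by (simp only: matrix_matrix_mult_def vec_lambda_beta sum_2)
  qed
  have ea: "N$i$1 * a$1 + N$i$2 * a$2 = \<alpha> * a$i" for i using e[of i 1] by (simp add: P diag_def)
  have eb: "N$i$1 * b$1 + N$i$2 * b$2 = \<beta> * b$i" for i using e[of i 2] by (simp add: P diag_def)
  obtain n11 n12 n21 n22 where n: "N$1$1 = of_int n11" "N$1$2 = of_int n12" "N$2$1 = of_int n21"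
    "N$2$2 = of_int n22"
    using N(2) unfolding integer_matrix_def by (metis Ints_cases)
  show "\<exists>n11 n12 n21 n22. N$1$1 = of_int n11 \<and> N$1$2 = of_int n12 \<and> N$2$1 = of_int n21 \<and> N$2$2
    = of_int n22 \<and>
      of_int n11 * a$1 + of_int n12 * a$2 = \<alpha> * a$1 \<and> of_int n21 * a$1 + of_int n22 * a$2
      = \<alpha> * a$2 \<and>
      of_int n11 * b$1 + of_int n12 * b$2 = \<beta> * b$1 \<and> of_int n21 * b$1 + of_int n22 * b$2 = \<beta> * b$2"
    using n ea[of 1] ea[of 2] eb[of 1] eb[of 2]
      by (intro exI[of _ n11] exI[of _ n12] exI[of _ n21] exI[of _ n22]) simp
qed

lemma nilpotent_generators_eq:
  "nilpotent_generators a b c r = range (\<lambda>i. tri 1 1 (a $ i) (of_real (b $ i)) (of_real (c $ i)))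
     \<union> {tri 1 1 0 0 (of_real (wedge b a / real r))}"
proof -
  have "(\<lambda>x. vector [x$1 + of_real (a$i), x$2 + of_real (b$i) * x$1 + of_real (c$i)])
    = tri 1 1 (a $ i) (of_real (b $ i)) (of_real (c $ i))" for i
    by (simp add: fun_eq_iff tri_def)
  moreover have "(\<lambda>x. vector [x$1, x$2 + of_real q]) = tri 1 1 0 0 (of_real q)" for q
    by (simp add: fun_eq_iff tri_def)
  ultimately show ?thesis unfolding nilpotent_generators_def by (simp only: full_SetCompr_eq) auto
qed

theorem theorem3p9:
  fixes \<Gamma> :: "(complex^2 \<Rightarrow> complex^2) set"
  assumes "inoue_group \<Gamma>"
  shows "(\<exists>!D. holomorphic_connection (inoue_surface \<Gamma>) D) \<and>
         (\<forall>D. holomorphic_connection (inoue_surface \<Gamma>) D \<longrightarrow>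
            (\<forall>D'. pullback_connection (open_cmfd inoue_U) (inoue_surface \<Gamma>) (orbit_map \<Gamma>) D D'
                    \<longleftrightarrow> D' = trivial_connection inoue_U) \<and>
            flat_connection (inoue_surface \<Gamma>) D \<and>
            torsion_free_connection (inoue_surface \<Gamma>) D)"
  using assms
proof cases
  case (type_I \<beta> a b)
  note R = group_I_properties[OF type_I(2,3), folded type_I(1)]
  show ?thesis by (rule unique_connection[OF R])
next
  case (type_II \<theta> \<alpha> a b N r c t)
  have "3 \<le> real_of_int \<theta>" using type_II(2) by linarith
  moreover from this have "2\<^sup>2 \<le> (real_of_int \<theta>)\<^sup>2" by (intro power_mono) auto
  then have "0 \<le> sqrt ((real_of_int \<theta>)\<^sup>2 - 4)" by simp
  ultimately have "2 < real_of_int \<theta> + sqrt ((real_of_int \<theta>)\<^sup>2 - 4)" by linarith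
  then have \<alpha>: "\<alpha> > 1" unfolding type_II(3) by simp
  note ind = conj_diag_integer(1)[OF type_II(4-6)]
  obtain n11 n12 n21 n22 where n: "N$1$1 = of_int n11" "N$1$2 = of_int n12" "N$2$1 = of_int n21"
    "N$2$2 = of_int n22"
    and Na: "of_int n11 * a$1 + of_int n12 * a$2 = \<alpha> * a$1" "of_int n21 * a$1 + of_int n22 * a$2
      = \<alpha> * a$2"
    and Nb: "of_int n11 * b$1 + of_int n12 * b$2 = 1 / \<alpha> * b$1" "of_int n21 * b$1 + of_int n22 * b$2
      = 1 / \<alpha> * b$2"
    using conj_diag_integer(2)[OF type_II(4-6)] by blast
  define hc where "hc = c - half_products a b"
  \<comment> \<open>Componentwise this is \<open>cond\<close> with \<open>\<epsilon> = 1\<close>;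
    the entries of \<open>k\<close> become the integers \<open>m1\<close> and
    \<open>m2\<close>.\<close>
  obtain k where k: "\<forall>i. k $ i \<in> \<int>" "(mat 1 - N) *v hc - (wedge b a / 2) *s row_products N
    = (wedge b a / real r) *s k"
    using type_II(8) unfolding hc_def scaled_lattice_def by blast
  obtain m1 m2 where m: "k $ 1 = of_int m1" "k $ 2 = of_int m2" using k(1) by (metis Ints_cases)
  interpret heisenberg_data a b c hc r \<alpha> 1 t n11 n12 n21 n22 m1 m2 "wedge b a" "wedge b a / real r"
  proof
    show "hc$1 = c$1 - a$1 * b$1 / 2" "hc$2 = c$2 - a$2 * b$2 / 2"
      by (simp_all add: hc_def half_products_def)
    have k': "((mat 1 - N) *v hc - (wedge b a / 2) *s row_products N) $ i
      = ((wedge b a / real r) *s k) $ i" for i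
      by (simp only: k(2))
    show "1 * hc$1 = of_int n11 * hc$1 + of_int n12 * hc$2 + wedge b a / 2 * of_int (n11 * n12)
      + wedge b a / real r * of_int m1"
      using k'[of 1] by (simp add: matrix_vector_mult_def sum_2 mat_def row_products_def n m
        algebra_simps)
    show "1 * hc$2 = of_int n21 * hc$1 + of_int n22 * hc$2 + wedge b a / 2 * of_int (n21 * n22)
      + wedge b a / real r * of_int m2"
      using k'[of 2] by (simp add: matrix_vector_mult_def sum_2 mat_def row_products_def n m
        algebra_simps)
  qed (use ind type_II(7) \<alpha> Na Nb in \<open>auto simp: wedge_def\<close>)
  have "\<Gamma> = generate inoue_Aff generators"
    unfolding type_II(1) group_II_def nilpotent_generators_eq generators_def
    by (rule arg_cong[where f = "\<lambda>A. generate inoue_Aff (A \<union> _)"]) (simp add: fun_eq_iff tri_def)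
  note R = group_properties[folded this]
  show ?thesis by (rule unique_connection[OF R])
next
  case (type_III \<theta> \<alpha> a b N r c)
  have "1 \<le> real_of_int \<theta>" using type_III(2) by linarith
  moreover have "0 \<le> (real_of_int \<theta>)\<^sup>2" by simp
  then have "1 < (real_of_int \<theta>)\<^sup>2 + 4" by argo
  then have "1 < sqrt ((real_of_int \<theta>)\<^sup>2 + 4)" by simp
  ultimately have "2 < real_of_int \<theta> + sqrt ((real_of_int \<theta>)\<^sup>2 + 4)" by linarith
  then have \<alpha>: "\<alpha> > 1" unfolding type_III(3) by simp
  note ind = conj_diag_integer(1)[OF type_III(4-6)]
  obtain n11 n12 n21 n22 where n: "N$1$1 = of_int n11" "N$1$2 = of_int n12" "N$2$1 = of_int n21"
    "N$2$2 = of_int n22"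
    and Na: "of_int n11 * a$1 + of_int n12 * a$2 = \<alpha> * a$1" "of_int n21 * a$1 + of_int n22 * a$2
      = \<alpha> * a$2"
    and Nb: "of_int n11 * b$1 + of_int n12 * b$2 = - (1 / \<alpha>) * b$1"
      "of_int n21 * b$1 + of_int n22 * b$2 = - (1 / \<alpha>) * b$2"
    using conj_diag_integer(2)[OF type_III(4-6)] by blast
  define hc where "hc = c - half_products a b"
  obtain k where k: "\<forall>i. k $ i \<in> \<int>" "(mat 1 + N) *v hc - (wedge a b / 2) *s row_products N
    = (wedge a b / real r) *s k"
    using type_III(8) unfolding hc_def scaled_lattice_def by blast
  obtain m1 m2 where m: "k $ 1 = of_int m1" "k $ 2 = of_int m2" using k(1) by (metis Ints_cases)
  \<comment> \<open>The type III condition is written with the opposite orientation. Solving it for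
    \<open>- hc\<close> changes the sign, so in terms of \<open>wedge b a\<close> it becomes
    \<open>cond\<close> with \<open>\<epsilon> = -1\<close>.\<close>
  have w: "wedge a b = - wedge b a" by (simp add: wedge_def)
  interpret heisenberg_data a b c hc r \<alpha> "-1" 0 n11 n12 n21 n22 m1 m2 "wedge b a"
  "wedge b a / real r"
  proof
    show "hc$1 = c$1 - a$1 * b$1 / 2" "hc$2 = c$2 - a$2 * b$2 / 2"
      by (simp_all add: hc_def half_products_def)
    have k': "((mat 1 + N) *v hc - (wedge a b / 2) *s row_products N) $ i
      = ((wedge a b / real r) *s k) $ i" for i
      by (simp only: k(2))
    show "-1 * hc$1 = of_int n11 * hc$1 + of_int n12 * hc$2 + wedge b a / 2 * of_int (n11 * n12)
      + wedge b a / real r * of_int m1"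
      using k'[of 1] by (simp add: matrix_vector_mult_def sum_2 mat_def row_products_def n m w
        algebra_simps)
    show "-1 * hc$2 = of_int n21 * hc$1 + of_int n22 * hc$2 + wedge b a / 2 * of_int (n21 * n22)
      + wedge b a / real r * of_int m2"
      using k'[of 2] by (simp add: matrix_vector_mult_def sum_2 mat_def row_products_def n m w
        algebra_simps)
  qed (use ind type_III(7) \<alpha> Na Nb in \<open>auto simp: wedge_def\<close>)
  have "\<Gamma> = generate inoue_Aff generators"
    unfolding type_III(1) group_III_def nilpotent_generators_eq generators_def
    by (rule arg_cong[where f = "\<lambda>A. generate inoue_Aff (A \<union> _)"]) (simp add: fun_eq_iff tri_def)
  note R = group_properties[folded this]
  show ?thesis by (rule unique_connection[OF R])
qed

end
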